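(* Let $K$ be a field and let $\mathbb G$ be an affine functor of groups or a $K$-group scheme. Then $$\operatorname{Hom}_{grp}(G_a^\vee,\mathbb G)=\operatorname{Derinv}(\mathbb G)=T_e\mathbb G,$$ where an invariant vector field $D$ corresponds to its value $D_e\in T_e\mathbb G$ at the identity, and a morphism of functors of groups $f:G_a^\vee\to\mathbb G$ corresponds to the tangent vector $f(1+\epsilon x)\in T_e\mathbb G$, with $1+\epsilon x\in G_a^\vee(K[\epsilon])$.
   Context: All functors are covariant functors on the category of commutative $K$-algebras; schemes are identified with their functors of points. $\mathcal K(S)=S$. $G_a=\operatorname{Spec}K[x]$ and $G_a^\vee:=\mathbb{H}om_{mon}(G_a,\mathcal K)$ ($\mathcal K$ a monoid under multiplication); explicitly $G_a^\vee(S)=\{\mu(x)\in S[x]:\mu(0)=1,\ \mu(x+x')=\mu(x)\mu(x')\}$ with multiplication of polynomials. For a functor of sets $\mathbb X$ and $x\in\mathbb X(S)$, with $S[\epsilon]=S[t]/(t^2)$, $T_x\mathbb X:=\{v\in\mathbb X(S[\epsilon]): v\mapsto x\text{ under }\epsilon\mapsto0\}$. A vector field $D$ on $\mathbb X$ is a functorial assignment, for every $S$ and $x\in\mathbb X(S)$, of a tangent vector $D_x\in T_x\mathbb X$. A vector field $D$ on $\mathbb G$ is invariant if $g'\cdot D_g=D_{g'\cdot g}$ for all points $g,g'$ of $\mathbb G$; $\operatorname{Derinv}(\mathbb G)$ is the set of invariant vector fields. $e\in\mathbb G(K)$ is the identity. A functor of sets $\mathbb X$ is affine if its functor of functions $\mathbb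 A_{\mathbb X}$, $\mathbb A_{\mathbb X}(S)=\operatorname{Hom}(\mathbb X_{|S},\mathcal K_{|S})$ ($|S$ denoting restriction to commutative $S$-algebras), is reflexive and the canonical morphism $\mathbb X\to\operatorname{Spec}\mathbb A_{\mathbb X}$ is an isomorphism, where $(\operatorname{Spec}\mathbb A)(S)=\operatorname{Hom}_{\mathcal K\text{-alg}}(\mathbb A,\mathcal S)$, with $\mathcal S(S')=S\otimes_KS'$. A functor of $\mathcal K$-modules $\mathbb M$ is reflexive if $\mathbb M\to\mathbb M^{**}$ is an isomorphism, with $\mathbb M^*(S)=\operatorname{Hom}_{\mathcal S}(\mathbb M_{|S},\mathcal K_{|S})$. An affine functor of groups is an affine functor which is a functor of groups. *)

theory Defs
  imports "HOL-Algebra.UnivPoly" "HOL-Algebra.Free_Abelian_Groups"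
begin

text \<open>
  The category of commutative \<open>K\<close>-algebras is the category of all algebras (library locale
  \<^locale>\<open>algebra\<close>) whose carrier is a set of elements of a type \<open>'u\<close>, which serves as the universe.
  The universe is an arbitrary infinite type, and \<open>K\<close> is one of its rings.  Up to isomorphism the
  category is then closed under polynomial rings, dual numbers, localisations and tensor products.
  Values of functors may live in any other type.
\<close>

section \<open>Commutative algebras\<close>

definition algs :: "('u, 'm) ring_scheme \<Rightarrow> ('u, 'u) module set" where
  "algs K = {S. algebra K S}"

definition base_alg :: "('u, 'm) ring_scheme \<Rightarrow> ('u, 'u) module" where
  "base_alg K = \<lparr>carrier = carrier K, monoid.mult = monoid.mult K, one = one K,
     ring.zero = ring.zero K, add = add K, smult = monoid.mult K\<rparr>"

definition alg_hom ::
  "('k, 'm) ring_scheme \<Rightarrow> ('k, 'a, 'n) module_scheme \<Rightarrow> ('k, 'b, 'p) module_scheme \<Rightarrow> ('a \<Rightarrow> 'b) set"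
  where
  "alg_hom K S T = {\<phi> \<in> ring_hom S T \<inter> extensional (carrier S).
     \<forall>k\<in>carrier K. \<forall>s\<in>carrier S. \<phi> (k \<odot>\<^bsub>S\<^esub> s) = k \<odot>\<^bsub>T\<^esub> \<phi> s}"

text \<open>
  A commutative \<open>S\<close>-algebra is given by a commutative \<open>K\<close>-algebra \<open>T\<close> with a morphism \<open>S \<rightarrow> T\<close>.
\<close>

definition coslice ::
  "('u, 'm) ring_scheme \<Rightarrow> ('u, 'u) module \<Rightarrow> (('u, 'u) module \<times> ('u \<Rightarrow> 'u)) set" where
  "coslice K S = {(T, \<phi>). T \<in> algs K \<and> \<phi> \<in> alg_hom K S T}"

text \<open>
  Constructions such as \<open>S[\<epsilon>]\<close> and \<open>S \<otimes> T\<close> produce algebras over types other than \<open>'u\<close>; they are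
  moved back into the universe along an arbitrary injection of the carrier.
\<close>

definition emb :: "'b set \<Rightarrow> 'b \<Rightarrow> 'u" where
  "emb C = (SOME h. inj_on h C)"

definition unemb :: "'b set \<Rightarrow> 'u \<Rightarrow> 'b" where
  "unemb C = the_inv_into C (emb C)"

definition copy_alg :: "('k, 'b) module \<Rightarrow> ('k, 'u) module" where
  "copy_alg A = (let C = carrier A in
     \<lparr>carrier = emb C ` C,
      monoid.mult = (\<lambda>x y. emb C (unemb C x \<otimes>\<^bsub>A\<^esub> unemb C y)),
      one = emb C \<one>\<^bsub>A\<^esub>,
      ring.zero = emb C \<zero>\<^bsub>A\<^esub>,
      add = (\<lambda>x y. emb C (unemb C x \<oplus>\<^bsub>A\<^esub> unemb C y)),
      smult = (\<lambda>k x. emb C (k \<odot>\<^bsub>A\<^esub> unemb C x))\<rparr>)"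


section \<open>Dual numbers\<close>

text \<open>The pair \<open>(a, b)\<close> stands for \<open>a + b \<epsilon>\<close>.\<close>

definition dual_pairs :: "('k, 'u) module \<Rightarrow> ('k, 'u \<times> 'u) module" where
  "dual_pairs S =
     \<lparr>carrier = carrier S \<times> carrier S,
      monoid.mult = (\<lambda>(a, b) (c, d). (a \<otimes>\<^bsub>S\<^esub> c, a \<otimes>\<^bsub>S\<^esub> d \<oplus>\<^bsub>S\<^esub> b \<otimes>\<^bsub>S\<^esub> c)),
      one = (\<one>\<^bsub>S\<^esub>, \<zero>\<^bsub>S\<^esub>),
      ring.zero = (\<zero>\<^bsub>S\<^esub>, \<zero>\<^bsub>S\<^esub>),
      add = (\<lambda>(a, b) (c, d). (a \<oplus>\<^bsub>S\<^esub> c, b \<oplus>\<^bsub>S\<^esub> d)),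
      smult = (\<lambda>k (a, b). (k \<odot>\<^bsub>S\<^esub> a, k \<odot>\<^bsub>S\<^esub> b))\<rparr>"

definition dual_num :: "('u, 'u) module \<Rightarrow> ('u, 'u) module" where
  "dual_num S = copy_alg (dual_pairs S)"

definition mk_dual :: "('u, 'u) module \<Rightarrow> 'u \<Rightarrow> 'u \<Rightarrow> 'u" where
  "mk_dual S a b = emb (carrier (dual_pairs S)) (a, b)"

definition un_dual :: "('u, 'u) module \<Rightarrow> 'u \<Rightarrow> 'u \<times> 'u" where
  "un_dual S = unemb (carrier (dual_pairs S))"

definition eps :: "('u, 'u) module \<Rightarrow> 'u" where
  "eps S = mk_dual S \<zero>\<^bsub>S\<^esub> \<one>\<^bsub>S\<^esub>"

definition dual_incl :: "('u, 'u) module \<Rightarrow> 'u \<Rightarrow> 'u" where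
  "dual_incl S = (\<lambda>a\<in>carrier S. mk_dual S a \<zero>\<^bsub>S\<^esub>)"

definition dual_proj :: "('u, 'u) module \<Rightarrow> 'u \<Rightarrow> 'u" where
  "dual_proj S = (\<lambda>z\<in>carrier (dual_num S). fst (un_dual S z))"

definition dual_map :: "('u, 'u) module \<Rightarrow> ('u, 'u) module \<Rightarrow> ('u \<Rightarrow> 'u) \<Rightarrow> 'u \<Rightarrow> 'u" where
  "dual_map S T \<phi> = (\<lambda>z\<in>carrier (dual_num S).
     mk_dual T (\<phi> (fst (un_dual S z))) (\<phi> (snd (un_dual S z))))"


section \<open>Tensor products\<close>

text \<open>
  \<open>S \<otimes>\<^sub>K T\<close> is the quotient of the free abelian group on \<open>S \<times> T\<close> by the bilinearity relations.
\<close>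

definition tensor_relators ::
  "('u, 'm) ring_scheme \<Rightarrow> ('u, 'u) module \<Rightarrow> ('u, 'u) module \<Rightarrow> ('u \<times> 'u \<Rightarrow>\<^sub>0 int) set" where
  "tensor_relators K S T =
     {frag_of (s \<oplus>\<^bsub>S\<^esub> s', t) - frag_of (s, t) - frag_of (s', t) | s s' t.
        s \<in> carrier S \<and> s' \<in> carrier S \<and> t \<in> carrier T} \<union>
     {frag_of (s, t \<oplus>\<^bsub>T\<^esub> t') - frag_of (s, t) - frag_of (s, t') | s t t'.
        s \<in> carrier S \<and> t \<in> carrier T \<and> t' \<in> carrier T} \<union>
     {frag_of (k \<odot>\<^bsub>S\<^esub> s, t) - frag_of (s, k \<odot>\<^bsub>T\<^esub> t) | k s t.
        k \<in> carrier K \<and> s \<in> carrier S \<and> t \<in> carrier T}"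

definition tensor_free :: "('u, 'u) module \<Rightarrow> ('u, 'u) module \<Rightarrow> ('u \<times> 'u \<Rightarrow>\<^sub>0 int) monoid" where
  "tensor_free S T = free_Abelian_group (carrier S \<times> carrier T)"

definition tensor_null ::
  "('u, 'm) ring_scheme \<Rightarrow> ('u, 'u) module \<Rightarrow> ('u, 'u) module \<Rightarrow> ('u \<times> 'u \<Rightarrow>\<^sub>0 int) set" where
  "tensor_null K S T = generate (tensor_free S T) (tensor_relators K S T)"

definition tensor_class ::
  "('u, 'm) ring_scheme \<Rightarrow> ('u, 'u) module \<Rightarrow> ('u, 'u) module \<Rightarrow>
     ('u \<times> 'u \<Rightarrow>\<^sub>0 int) \<Rightarrow> ('u \<times> 'u \<Rightarrow>\<^sub>0 int) set" where
  "tensor_class K S T p = tensor_null K S T #>\<^bsub>tensor_free S T\<^esub> p"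

definition tensor_cosets ::
  "('u, 'm) ring_scheme \<Rightarrow> ('u, 'u) module \<Rightarrow> ('u, 'u) module \<Rightarrow>
     ('u, ('u \<times> 'u \<Rightarrow>\<^sub>0 int) set) module" where
  "tensor_cosets K S T =
     \<lparr>carrier = rcosets\<^bsub>tensor_free S T\<^esub> tensor_null K S T,
      monoid.mult = (\<lambda>P Q. \<Union>p\<in>P. \<Union>q\<in>Q. tensor_class K S T
        (frag_extend (\<lambda>(s, t). frag_extend (\<lambda>(s', t'). frag_of (s \<otimes>\<^bsub>S\<^esub> s', t \<otimes>\<^bsub>T\<^esub> t')) q) p)),
      one = tensor_class K S T (frag_of (\<one>\<^bsub>S\<^esub>, \<one>\<^bsub>T\<^esub>)),
      ring.zero = tensor_null K S T,
      add = (\<lambda>P Q. P <#>\<^bsub>tensor_free S T\<^esub> Q),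
      smult = (\<lambda>k P. \<Union>p\<in>P. tensor_class K S T
        (frag_extend (\<lambda>(s, t). frag_of (k \<odot>\<^bsub>S\<^esub> s, t)) p))\<rparr>"

definition tensor ::
  "('u, 'm) ring_scheme \<Rightarrow> ('u, 'u) module \<Rightarrow> ('u, 'u) module \<Rightarrow> ('u, 'u) module" where
  "tensor K S T = copy_alg (tensor_cosets K S T)"

definition tensor_emb ::
  "('u, 'm) ring_scheme \<Rightarrow> ('u, 'u) module \<Rightarrow> ('u, 'u) module \<Rightarrow> ('u \<times> 'u \<Rightarrow>\<^sub>0 int) set \<Rightarrow> 'u" where
  "tensor_emb K S T = emb (carrier (tensor_cosets K S T))"

definition tensor_in1 ::
  "('u, 'm) ring_scheme \<Rightarrow> ('u, 'u) module \<Rightarrow> ('u, 'u) module \<Rightarrow> 'u \<Rightarrow> 'u" where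
  "tensor_in1 K S T = (\<lambda>s\<in>carrier S. tensor_emb K S T (tensor_class K S T (frag_of (s, \<one>\<^bsub>T\<^esub>))))"

definition tensor_in2 ::
  "('u, 'm) ring_scheme \<Rightarrow> ('u, 'u) module \<Rightarrow> ('u, 'u) module \<Rightarrow> 'u \<Rightarrow> 'u" where
  "tensor_in2 K S T = (\<lambda>t\<in>carrier T. tensor_emb K S T (tensor_class K S T (frag_of (\<one>\<^bsub>S\<^esub>, t))))"

text \<open>The morphism \<open>S \<otimes> \<psi> : S \<otimes> T \<rightarrow> S \<otimes> T'\<close> induced by \<open>\<psi> : T \<rightarrow> T'\<close>.\<close>

definition tensor_map ::
  "('u, 'm) ring_scheme \<Rightarrow> ('u, 'u) module \<Rightarrow> ('u, 'u) module \<Rightarrow> ('u, 'u) module \<Rightarrow>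
     ('u \<Rightarrow> 'u) \<Rightarrow> 'u \<Rightarrow> 'u" where
  "tensor_map K S T T' \<psi> = (\<lambda>z\<in>carrier (tensor K S T). tensor_emb K S T'
     (\<Union>p\<in>unemb (carrier (tensor_cosets K S T)) z. tensor_class K S T'
        (frag_extend (\<lambda>(s, t). frag_of (s, \<psi> t)) p)))"


section \<open>Functors on commutative algebras\<close>

text \<open>
  The value of a functor is a set, a monoid, a module, and so on, according to \<open>'o\<close>; its elements
  are of type \<open>'x\<close>.
\<close>

record ('u, 'o, 'x) kfunctor =
  Ob :: "('u, 'u) module \<Rightarrow> 'o"
  Mor :: "('u, 'u) module \<Rightarrow> ('u, 'u) module \<Rightarrow> ('u \<Rightarrow> 'u) \<Rightarrow> 'x \<Rightarrow> 'x"

definition underlying :: "('u, ('x, 'z) partial_object_scheme, 'x) kfunctor \<Rightarrow> ('u, 'x set, 'x) kfunctor"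
  where "underlying F = \<lparr>Ob = (\<lambda>S. carrier (Ob F S)), Mor = Mor F\<rparr>"

definition set_functor :: "('u, 'm) ring_scheme \<Rightarrow> ('u, 'x set, 'x) kfunctor \<Rightarrow> bool" where
  "set_functor K X \<longleftrightarrow>
     (\<forall>S\<in>algs K. \<forall>T\<in>algs K. \<forall>\<phi>\<in>alg_hom K S T. Mor X S T \<phi> \<in> Ob X S \<rightarrow> Ob X T) \<and>
     (\<forall>S\<in>algs K. \<forall>x\<in>Ob X S. Mor X S S (\<lambda>s\<in>carrier S. s) x = x) \<and>
     (\<forall>R\<in>algs K. \<forall>S\<in>algs K. \<forall>T\<in>algs K. \<forall>\<phi>\<in>alg_hom K R S. \<forall>\<psi>\<in>alg_hom K S T. \<forall>x\<in>Ob X R.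
        Mor X R T (compose (carrier R) \<psi> \<phi>) x = Mor X S T \<psi> (Mor X R S \<phi> x))"

definition group_functor ::
  "('u, 'm) ring_scheme \<Rightarrow> ('u, ('x, 'z) monoid_scheme, 'x) kfunctor \<Rightarrow> bool" where
  "group_functor K G \<longleftrightarrow> set_functor K (underlying G) \<and>
     (\<forall>S\<in>algs K. group (Ob G S)) \<and>
     (\<forall>S\<in>algs K. \<forall>T\<in>algs K. \<forall>\<phi>\<in>alg_hom K S T. Mor G S T \<phi> \<in> hom (Ob G S) (Ob G T))"

definition hom_grp ::
  "('u, 'm) ring_scheme \<Rightarrow> ('u, ('x, 'z) monoid_scheme, 'x) kfunctor \<Rightarrow>
     ('u, ('y, 'w) monoid_scheme, 'y) kfunctor \<Rightarrow> (('u, 'u) module \<Rightarrow> 'x \<Rightarrow> 'y) set" where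
  "hom_grp K G H = {f \<in> (\<Pi>\<^sub>E S\<in>algs K. hom (Ob G S) (Ob H S) \<inter> extensional (carrier (Ob G S))).
     \<forall>S\<in>algs K. \<forall>T\<in>algs K. \<forall>\<phi>\<in>alg_hom K S T. \<forall>x\<in>carrier (Ob G S).
       f T (Mor G S T \<phi> x) = Mor H S T \<phi> (f S x)}"

definition functor_iso ::
  "('u, 'm) ring_scheme \<Rightarrow> ('u, 'x set, 'x) kfunctor \<Rightarrow> ('u, 'y set, 'y) kfunctor \<Rightarrow> bool" where
  "functor_iso K X Y \<longleftrightarrow> (\<exists>\<eta> :: ('u, 'u) module \<Rightarrow> 'x \<Rightarrow> 'y.
     (\<forall>S\<in>algs K. bij_betw (\<eta> S) (Ob X S) (Ob Y S)) \<and>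
     (\<forall>S\<in>algs K. \<forall>T\<in>algs K. \<forall>\<phi>\<in>alg_hom K S T. \<forall>x\<in>Ob X S.
        \<eta> T (Mor X S T \<phi> x) = Mor Y S T \<phi> (\<eta> S x)))"

text \<open>The functor \<open>\<K>\<close>, \<open>\<K>(S) = S\<close>, as a functor of sets.\<close>

definition scalars :: "('u, 'u set, 'u) kfunctor" where
  "scalars = \<lparr>Ob = carrier, Mor = (\<lambda>S T \<phi>. \<phi>)\<rparr>"

text \<open>The set \<open>Hom(X\<^bsub>|S\<^esub>, Y\<^bsub>|S\<^esub>)\<close>.\<close>

definition hom_over ::
  "('u, 'm) ring_scheme \<Rightarrow> ('u, 'u) module \<Rightarrow> ('u, 'x set, 'x) kfunctor \<Rightarrow>
     ('u, 'y set, 'y) kfunctor \<Rightarrow> (('u, 'u) module \<times> ('u \<Rightarrow> 'u) \<Rightarrow> 'x \<Rightarrow> 'y) set" where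
  "hom_over K S X Y = {\<eta> \<in> (\<Pi>\<^sub>E (T, \<phi>)\<in>coslice K S. Ob X T \<rightarrow>\<^sub>E Ob Y T).
     \<forall>(T, \<phi>)\<in>coslice K S. \<forall>T'\<in>algs K. \<forall>\<psi>\<in>alg_hom K T T'. \<forall>x\<in>Ob X T.
       \<eta> (T', compose (carrier S) \<psi> \<phi>) (Mor X T T' \<psi> x) = Mor Y T T' \<psi> (\<eta> (T, \<phi>) x)}"

text \<open>
  Families with values in \<open>\<K>\<close>, with pointwise operations, an element \<open>s\<close> of \<open>S\<close> acting on the
  component at \<open>\<phi> : S \<rightarrow> T\<close> through \<open>\<phi> s\<close>.
\<close>

definition pointwise ::
  "('u, 'm) ring_scheme \<Rightarrow> ('u, 'u) module \<Rightarrow> ('u, 'x set, 'x) kfunctor \<Rightarrow>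
     (('u, 'u) module \<times> ('u \<Rightarrow> 'u) \<Rightarrow> 'x \<Rightarrow> 'u) set \<Rightarrow>
     ('u, ('u, 'u) module \<times> ('u \<Rightarrow> 'u) \<Rightarrow> 'x \<Rightarrow> 'u) module" where
  "pointwise K S X C =
     \<lparr>carrier = C,
      monoid.mult = (\<lambda>a b. \<lambda>(T, \<phi>)\<in>coslice K S. \<lambda>x\<in>Ob X T. a (T, \<phi>) x \<otimes>\<^bsub>T\<^esub> b (T, \<phi>) x),
      one = (\<lambda>(T, \<phi>)\<in>coslice K S. \<lambda>x\<in>Ob X T. \<one>\<^bsub>T\<^esub>),
      ring.zero = (\<lambda>(T, \<phi>)\<in>coslice K S. \<lambda>x\<in>Ob X T. \<zero>\<^bsub>T\<^esub>),
      add = (\<lambda>a b. \<lambda>(T, \<phi>)\<in>coslice K S. \<lambda>x\<in>Ob X T. a (T, \<phi>) x \<oplus>\<^bsub>T\<^esub> b (T, \<phi>) x),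
      smult = (\<lambda>s a. \<lambda>(T, \<phi>)\<in>coslice K S. \<lambda>x\<in>Ob X T. \<phi> s \<otimes>\<^bsub>T\<^esub> a (T, \<phi>) x)\<rparr>"

definition reindex ::
  "('u, 'm) ring_scheme \<Rightarrow> ('u, 'u) module \<Rightarrow> ('u, 'u) module \<Rightarrow> ('u \<Rightarrow> 'u) \<Rightarrow>
     (('u, 'u) module \<times> ('u \<Rightarrow> 'u) \<Rightarrow> 'y) \<Rightarrow> ('u, 'u) module \<times> ('u \<Rightarrow> 'u) \<Rightarrow> 'y" where
  "reindex K S S' f \<eta> = (\<lambda>(T, \<phi>)\<in>coslice K S'. \<eta> (T, compose (carrier S) \<phi> f))"


section \<open>Affine functors\<close>

text \<open>
  In a functor of \<open>\<K>\<close>-modules the value at \<open>S\<close> is an \<open>S\<close>-module, and in a functor of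
  \<open>\<K>\<close>-algebras it is an \<open>S\<close>-algebra.
\<close>

type_synonym ('u, 'a) module_functor = "('u, ('u, 'a) module, 'a) kfunctor"

type_synonym ('u, 'x) fam = "('u, 'u) module \<times> ('u \<Rightarrow> 'u) \<Rightarrow> 'x \<Rightarrow> 'u"

definition function_algebra ::
  "('u, 'm) ring_scheme \<Rightarrow> ('u, 'x set, 'x) kfunctor \<Rightarrow> ('u, ('u, 'x) fam) module_functor" where
  "function_algebra K X =
     \<lparr>Ob = (\<lambda>S. pointwise K S X (hom_over K S X scalars)), Mor = reindex K\<rparr>"

definition dual_elems ::
  "('u, 'm) ring_scheme \<Rightarrow> ('u, 'a) module_functor \<Rightarrow> ('u, 'u) module \<Rightarrow> ('u, 'a) fam set" where
  "dual_elems K M S = {w \<in> hom_over K S (underlying M) scalars.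
     \<forall>(T, \<phi>)\<in>coslice K S.
       (\<forall>m\<in>carrier (Ob M T). \<forall>n\<in>carrier (Ob M T).
          w (T, \<phi>) (m \<oplus>\<^bsub>Ob M T\<^esub> n) = w (T, \<phi>) m \<oplus>\<^bsub>T\<^esub> w (T, \<phi>) n) \<and>
       (\<forall>t\<in>carrier T. \<forall>m\<in>carrier (Ob M T).
          w (T, \<phi>) (t \<odot>\<^bsub>Ob M T\<^esub> m) = t \<otimes>\<^bsub>T\<^esub> w (T, \<phi>) m)}"

text \<open>The multiplication and unit supplied by \<^const>\<open>pointwise\<close> play no role in the dual module.\<close>

definition dual ::
  "('u, 'm) ring_scheme \<Rightarrow> ('u, 'a) module_functor \<Rightarrow> ('u, ('u, 'a) fam) module_functor" where
  "dual K M = \<lparr>Ob = (\<lambda>S. pointwise K S (underlying M) (dual_elems K M S)), Mor = reindex K\<rparr>"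

definition bidual_map ::
  "('u, 'm) ring_scheme \<Rightarrow> ('u, 'a) module_functor \<Rightarrow> ('u, 'u) module \<Rightarrow> 'a \<Rightarrow>
     ('u, ('u, 'a) fam) fam" where
  "bidual_map K M S m = (\<lambda>(T, \<phi>)\<in>coslice K S. \<lambda>w\<in>dual_elems K M T.
     w (T, \<lambda>t\<in>carrier T. t) (Mor M S T \<phi> m))"

definition reflexive :: "('u, 'm) ring_scheme \<Rightarrow> ('u, 'a) module_functor \<Rightarrow> bool" where
  "reflexive K M \<longleftrightarrow> (\<forall>S\<in>algs K.
     bij_betw (bidual_map K M S) (carrier (Ob M S)) (carrier (Ob (dual K (dual K M)) S)))"

text \<open>The functor \<open>\<S>\<close> of \<open>\<K>\<close>-algebras, \<open>\<S>(T) = S \<otimes>\<^sub>K T\<close>, regarded as a \<open>T\<close>-algebra.\<close>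

definition quasi_coherent ::
  "('u, 'm) ring_scheme \<Rightarrow> ('u, 'u) module \<Rightarrow> ('u, 'u) module_functor" where
  "quasi_coherent K S =
     \<lparr>Ob = (\<lambda>T. (tensor K S T)\<lparr>smult := \<lambda>t z. tensor_in2 K S T t \<otimes>\<^bsub>tensor K S T\<^esub> z\<rparr>),
      Mor = tensor_map K S\<rparr>"

definition hom_alg ::
  "('u, 'm) ring_scheme \<Rightarrow> ('u, 'a) module_functor \<Rightarrow> ('u, 'b) module_functor \<Rightarrow>
     (('u, 'u) module \<Rightarrow> 'a \<Rightarrow> 'b) set" where
  "hom_alg K A B = {F \<in> (\<Pi>\<^sub>E T\<in>algs K. alg_hom T (Ob A T) (Ob B T)).
     \<forall>T\<in>algs K. \<forall>T'\<in>algs K. \<forall>\<psi>\<in>alg_hom K T T'. \<forall>a\<in>carrier (Ob A T).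
       F T' (Mor A T T' \<psi> a) = Mor B T T' \<psi> (F T a)}"

text \<open>
  The canonical map from \<open>X(S)\<close> to \<open>(Spec \<A>\<^sub>X)(S)\<close> sends \<open>x\<close> to the family
  \<open>\<A>\<^sub>X(T) \<rightarrow> S \<otimes> T\<close>, \<open>a \<mapsto> a(x)\<close>, where \<open>a\<close> and \<open>x\<close> are both transported to \<open>S \<otimes> T\<close>.
\<close>

definition spec_map ::
  "('u, 'm) ring_scheme \<Rightarrow> ('u, 'x set, 'x) kfunctor \<Rightarrow> ('u, 'u) module \<Rightarrow> 'x \<Rightarrow>
     ('u, 'u) module \<Rightarrow> ('u, 'x) fam \<Rightarrow> 'u" where
  "spec_map K X S x = (\<lambda>T\<in>algs K. \<lambda>a\<in>carrier (Ob (function_algebra K X) T).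
     a (tensor K S T, tensor_in2 K S T) (Mor X S (tensor K S T) (tensor_in1 K S T) x))"

definition affine_functor :: "('u, 'm) ring_scheme \<Rightarrow> ('u, 'x set, 'x) kfunctor \<Rightarrow> bool" where
  "affine_functor K X \<longleftrightarrow> set_functor K X \<and> reflexive K (function_algebra K X) \<and>
     (\<forall>S\<in>algs K. bij_betw (spec_map K X S) (Ob X S) (hom_alg K (function_algebra K X) (quasi_coherent K S)))"


section \<open>Schemes as functors\<close>

text \<open>
  Schemes through their functors of points, following Demazure and Gabriel: Zariski sheaves covered
  by open affine subfunctors (it suffices to cover the points with values in fields).
\<close>

definition affine_scheme :: "('u, 'm) ring_scheme \<Rightarrow> ('u, 'u) module \<Rightarrow> ('u, ('u \<Rightarrow> 'u) set, 'u \<Rightarrow> 'u) kfunctor"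
  where "affine_scheme K A = \<lparr>Ob = alg_hom K A, Mor = (\<lambda>S T \<phi>. compose (carrier A) \<phi>)\<rparr>"

definition is_localization ::
  "('u, 'm) ring_scheme \<Rightarrow> ('u, 'u) module \<Rightarrow> 'u \<Rightarrow> ('u, 'u) module \<Rightarrow> ('u \<Rightarrow> 'u) \<Rightarrow> bool" where
  "is_localization K S f L l \<longleftrightarrow> L \<in> algs K \<and> l \<in> alg_hom K S L \<and> l f \<in> Units L \<and>
     (\<forall>y\<in>carrier L. \<exists>s\<in>carrier S. \<exists>n::nat. y \<otimes>\<^bsub>L\<^esub> l f [^]\<^bsub>L\<^esub> n = l s) \<and>
     (\<forall>s\<in>carrier S. l s = \<zero>\<^bsub>L\<^esub> \<longrightarrow> (\<exists>n::nat. f [^]\<^bsub>S\<^esub> n \<otimes>\<^bsub>S\<^esub> s = \<zero>\<^bsub>S\<^esub>))"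

definition zariski_sheaf :: "('u, 'm) ring_scheme \<Rightarrow> ('u, 'x set, 'x) kfunctor \<Rightarrow> bool" where
  "zariski_sheaf K X \<longleftrightarrow> (\<forall>S\<in>algs K. \<forall>E L l x.
     finite E \<and> E \<subseteq> carrier S \<and> Idl\<^bsub>S\<^esub> E = carrier S \<and>
     (\<forall>f\<in>E. is_localization K S f (L f) (l f) \<and> x f \<in> Ob X (L f)) \<and>
     (\<forall>f\<in>E. \<forall>g\<in>E. \<forall>P. \<forall>\<alpha>\<in>alg_hom K (L f) P. \<forall>\<beta>\<in>alg_hom K (L g) P.
        compose (carrier S) \<alpha> (l f) = compose (carrier S) \<beta> (l g) \<and>
        is_localization K S (f \<otimes>\<^bsub>S\<^esub> g) P (compose (carrier S) \<alpha> (l f)) \<longrightarrow>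
        Mor X (L f) P \<alpha> (x f) = Mor X (L g) P \<beta> (x g)) \<longrightarrow>
     (\<exists>!y. y \<in> Ob X S \<and> (\<forall>f\<in>E. Mor X S (L f) (l f) y = x f)))"

definition subfunctor ::
  "('u, 'm) ring_scheme \<Rightarrow> ('u, 'x set, 'x) kfunctor \<Rightarrow> (('u, 'u) module \<Rightarrow> 'x set) \<Rightarrow> bool" where
  "subfunctor K X U \<longleftrightarrow> (\<forall>S\<in>algs K. U S \<subseteq> Ob X S) \<and>
     (\<forall>S\<in>algs K. \<forall>T\<in>algs K. \<forall>\<phi>\<in>alg_hom K S T. Mor X S T \<phi> \<in> U S \<rightarrow> U T)"

definition open_subfunctor ::
  "('u, 'm) ring_scheme \<Rightarrow> ('u, 'x set, 'x) kfunctor \<Rightarrow> (('u, 'u) module \<Rightarrow> 'x set) \<Rightarrow> bool" where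
  "open_subfunctor K X U \<longleftrightarrow> subfunctor K X U \<and>
     (\<forall>S\<in>algs K. \<forall>x\<in>Ob X S. \<exists>I. ideal I S \<and>
        (\<forall>T\<in>algs K. \<forall>\<phi>\<in>alg_hom K S T. Mor X S T \<phi> x \<in> U T \<longleftrightarrow> Idl\<^bsub>T\<^esub> (\<phi> ` I) = carrier T))"

definition is_scheme :: "('u, 'm) ring_scheme \<Rightarrow> ('u, 'x set, 'x) kfunctor \<Rightarrow> bool" where
  "is_scheme K X \<longleftrightarrow> set_functor K X \<and> zariski_sheaf K X \<and>
     (\<forall>L\<in>algs K. field L \<longrightarrow> (\<forall>x\<in>Ob X L. \<exists>U. x \<in> U L \<and> open_subfunctor K X U \<and>
        (\<exists>A\<in>algs K. functor_iso K (X\<lparr>Ob := U\<rparr>) (affine_scheme K A))))"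


section \<open>Tangent vectors and vector fields\<close>

definition tangent :: "('u, 'x set, 'x) kfunctor \<Rightarrow> ('u, 'u) module \<Rightarrow> 'x \<Rightarrow> 'x set" where
  "tangent X S x = {v \<in> Ob X (dual_num S). Mor X (dual_num S) S (dual_proj S) v = x}"

definition vector_fields ::
  "('u, 'm) ring_scheme \<Rightarrow> ('u, 'x set, 'x) kfunctor \<Rightarrow> (('u, 'u) module \<Rightarrow> 'x \<Rightarrow> 'x) set" where
  "vector_fields K X = {D \<in> (\<Pi>\<^sub>E S\<in>algs K. \<Pi>\<^sub>E x\<in>Ob X S. tangent X S x).
     \<forall>S\<in>algs K. \<forall>T\<in>algs K. \<forall>\<phi>\<in>alg_hom K S T. \<forall>x\<in>Ob X S.
       D T (Mor X S T \<phi> x) = Mor X (dual_num S) (dual_num T) (dual_map S T \<phi>) (D S x)}"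

definition Derinv ::
  "('u, 'm) ring_scheme \<Rightarrow> ('u, ('x, 'z) monoid_scheme, 'x) kfunctor \<Rightarrow>
     (('u, 'u) module \<Rightarrow> 'x \<Rightarrow> 'x) set" where
  "Derinv K G = {D \<in> vector_fields K (underlying G).
     \<forall>S\<in>algs K. \<forall>g'\<in>carrier (Ob G S). \<forall>g\<in>carrier (Ob G S).
       Mor G S (dual_num S) (dual_incl S) g' \<otimes>\<^bsub>Ob G (dual_num S)\<^esub> D S g = D S (g' \<otimes>\<^bsub>Ob G S\<^esub> g)}"


section \<open>The dual of the additive group\<close>

text \<open>
  The condition \<open>\<mu>(x + x') = \<mu>(x) \<mu>(x')\<close> is an identity in \<open>S[x][x']\<close>, obtained by evaluating \<open>\<mu>\<close> at
  \<open>x + x'\<close>, \<open>x\<close> and \<open>x'\<close>.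
\<close>

definition additive_chars :: "('u, 'm) ring_scheme \<Rightarrow> (nat \<Rightarrow> 'u) set" where
  "additive_chars S =
    (let P = UP S; Q = UP P;
         c = (\<lambda>s. monom Q (monom P s 0) 0);
         x = monom Q (monom P \<one>\<^bsub>S\<^esub> 1) 0;
         x' = monom Q \<one>\<^bsub>P\<^esub> 1
     in {\<mu> \<in> carrier P. eval S S (\<lambda>s. s) \<zero>\<^bsub>S\<^esub> \<mu> = \<one>\<^bsub>S\<^esub> \<and>
           eval S Q c (x \<oplus>\<^bsub>Q\<^esub> x') \<mu> = eval S Q c x \<mu> \<otimes>\<^bsub>Q\<^esub> eval S Q c x' \<mu>})"

definition Ga_dual :: "('u, (nat \<Rightarrow> 'u) monoid, nat \<Rightarrow> 'u) kfunctor" where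
  "Ga_dual =
     \<lparr>Ob = (\<lambda>S. \<lparr>carrier = additive_chars S, monoid.mult = monoid.mult (UP S), one = one (UP S)\<rparr>),
      Mor = (\<lambda>S T \<phi> \<mu> n. \<phi> (\<mu> n))\<rparr>"

definition one_plus_eps_x :: "('u, 'm) ring_scheme \<Rightarrow> nat \<Rightarrow> 'u" where
  "one_plus_eps_x K = (let R = dual_num (base_alg K)
     in \<one>\<^bsub>UP R\<^esub> \<oplus>\<^bsub>UP R\<^esub> monom (UP R) (eps (base_alg K)) 1)"

end

theory Submission
  imports Defs
begin

text \<open>
  An invariant field is \<open>D\<^sub>g = g \<cdot> D\<^sub>e\<close>. Through \<open>a(g \<cdot> v) = a(g) + \<epsilon> (D a)(g)\<close> a tangent vector \<open>v\<close> at
  the identity gives a derivation \<open>D\<close> of the functions on \<open>G\<close>, and the homomorphism belonging to \<open>v\<close>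
  is its exponential: it sends \<open>\<mu> = \<Sum> \<mu>\<^sub>n x\<^sup>n\<close> to the point at which \<open>a\<close> takes the value
  \<open>\<Sum> \<mu>\<^sub>n (D\<^sup>n a)(e)\<close>. Additivity of \<open>\<mu>\<close> means \<open>\<mu>\<^sub>i \<mu>\<^sub>j = (i + j choose i) \<mu>\<^sub>i\<^sub>+\<^sub>j\<close>, which together with
  the Leibniz rule makes this multiplicative in \<open>a\<close> in every characteristic. If \<open>G\<close> is affine such a
  point exists because \<open>G = Spec \<A>\<^sub>G\<close>. If \<open>G\<close> is a scheme, every \<open>\<mu>\<^sub>n\<close> with \<open>n \<ge> 1\<close> is nilpotent, so
  everything takes place in an affine neighbourhood of \<open>e\<close>.

  For uniqueness, the additive character with divided powers as coefficients is universal up to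
  truncation, so functions on \<open>G\<^sub>a\<^sup>\<vee>\<close> are the series \<open>\<Sum> c\<^sub>n \<mu>\<^sub>n\<close>, on which the invariant field
  \<open>\<mu> \<mapsto> \<mu> (1 + \<epsilon> x)\<close> acts by shifting the coefficients. A map compatible with the two fields is therefore
  determined by its value at \<open>1\<close>; a homomorphism with value \<open>v\<close> at \<open>1 + \<epsilon> x\<close> is compatible, and so are,
  for the exponential \<open>f\<close>, both \<open>\<mu> \<mapsto> f(\<nu> \<mu>)\<close> and \<open>\<mu> \<mapsto> f(\<nu>) f(\<mu>)\<close>, which shows that \<open>f\<close> is a
  homomorphism.
\<close>

section \<open>Algebras and their morphisms\<close>

text \<open>A universal additive character would have infinitely many non-zero coefficients, whereas
  a point of \<open>Ga_dual\<close> is a polynomial. No single algebra carries it; the truncations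
  \<open>gam N R\<close> of the divided power algebra do, and the coefficients read off at different
  N have to be matched.

  An affine functor need not be represented by an algebra, and its functions over S need not come
  from functions over K. So a point over S is tested by functions over every T, after both are moved
  to a common algebra T'. The initial choice of T' is S \<otimes> T, which is why the universal
  property of the tensor product enters.

  An affine neighbourhood of the identity in a scheme is not a subgroup, and translates and products
  have to be shown to stay in it. They do because an open subfunctor does not see nilpotents, and
  modulo nilpotents every point in the image of \<open>Ga_dual\<close> is the identity.

  Multiplicativity compares two maps that start at a point over S, so the uniqueness argument is run
  for maps defined over S and not only over K.

  Every auxiliary algebra must lie in the universe, hence the cardinality arguments.\<close>

lemma algsD: "S \<in> algs K \<Longrightarrow> algebra K S"
  by (simp add: algs_def)

lemma algs_cring: "S \<in> algs K \<Longrightarrow> cring S"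
  by (auto dest: algsD algebra.axioms(2))

lemma alg_homI:
  assumes "\<phi> \<in> ring_hom S T" "\<phi> \<in> extensional (carrier S)"
    and "\<And>k s. \<lbrakk>k \<in> carrier K; s \<in> carrier S\<rbrakk> \<Longrightarrow> \<phi> (k \<odot>\<^bsub>S\<^esub> s) = k \<odot>\<^bsub>T\<^esub> \<phi> s"
  shows "\<phi> \<in> alg_hom K S T"
  using assms by (auto simp: alg_hom_def)

lemma alg_hom_ring_hom: "\<phi> \<in> alg_hom K S T \<Longrightarrow> \<phi> \<in> ring_hom S T"
  by (auto simp: alg_hom_def)

lemma
  assumes "\<phi> \<in> alg_hom K S T"
  shows alg_hom_closed: "\<And>x. x \<in> carrier S \<Longrightarrow> \<phi> x \<in> carrier T"
    and alg_hom_mult: "\<And>x y. \<lbrakk>x \<in> carrier S; y \<in> carrier S\<rbrakk> \<Longrightarrow> \<phi> (x \<otimes>\<^bsub>S\<^esub> y) = \<phi> x \<otimes>\<^bsub>T\<^esub> \<phi> y"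
    and alg_hom_add: "\<And>x y. \<lbrakk>x \<in> carrier S; y \<in> carrier S\<rbrakk> \<Longrightarrow> \<phi> (x \<oplus>\<^bsub>S\<^esub> y) = \<phi> x \<oplus>\<^bsub>T\<^esub> \<phi> y"
    and alg_hom_one: "\<phi> \<one>\<^bsub>S\<^esub> = \<one>\<^bsub>T\<^esub>"
    and alg_hom_smult: "\<And>k x. \<lbrakk>k \<in> carrier K; x \<in> carrier S\<rbrakk> \<Longrightarrow> \<phi> (k \<odot>\<^bsub>S\<^esub> x) = k \<odot>\<^bsub>T\<^esub> \<phi> x"
  using assms by (auto simp: alg_hom_def ring_hom_def)

lemma alg_hom_funcset: "\<phi> \<in> alg_hom K S T \<Longrightarrow> \<phi> \<in> carrier S \<rightarrow> carrier T"
  by (auto intro: alg_hom_closed)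

lemma alg_hom_zero: "\<lbrakk>\<phi> \<in> alg_hom K S T; cring S; cring T\<rbrakk> \<Longrightarrow> \<phi> \<zero>\<^bsub>S\<^esub> = \<zero>\<^bsub>T\<^esub>"
  by (rule ring_hom_zero[OF alg_hom_ring_hom]) (auto simp: cring.axioms)

lemma alg_hom_eqI:
  assumes "\<phi> \<in> alg_hom K S T" "\<psi> \<in> alg_hom K S T'" "\<And>x. x \<in> carrier S \<Longrightarrow> \<phi> x = \<psi> x"
  shows "\<phi> = \<psi>"
  using assms by (auto simp: alg_hom_def intro: extensionalityI)

lemma alg_hom_id: "(\<lambda>s\<in>carrier S. s) \<in> alg_hom K S S" if "algebra K S"
proof -
  interpret algebra K S by (rule that)
  show ?thesis by (rule alg_homI) (auto simp: ring_hom_def)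
qed

lemma alg_hom_compose:
  assumes "\<phi> \<in> alg_hom K R S" "\<psi> \<in> alg_hom K S T" "algebra K R"
  shows "compose (carrier R) \<psi> \<phi> \<in> alg_hom K R T"
proof -
  interpret algebra K R by fact
  show ?thesis
    using assms(1,2) by (intro alg_homI) (auto simp: ring_hom_def alg_hom_def compose_def Pi_def)
qed

lemma compose_eq_on: "x \<in> A \<Longrightarrow> compose A g f x = g (f x)"
  by (simp add: compose_def)

lemma compose_id_alg_hom:
  assumes "\<phi> \<in> alg_hom K S T"
  shows "compose (carrier S) (\<lambda>t\<in>carrier T. t) \<phi> = \<phi>" "compose (carrier S) \<phi> (\<lambda>s\<in>carrier S. s) = \<phi>"
  using assms by (auto simp: alg_hom_def ring_hom_def compose_def extensional_def fun_eq_iff)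

lemma compose_alg_hom_assoc:
  assumes "\<phi> \<in> alg_hom K R S"
  shows "compose (carrier R) (compose (carrier S) \<chi> \<psi>) \<phi> = compose (carrier R) \<chi> (compose (carrier R) \<psi> \<phi>)"
  by (rule compose_assoc[symmetric]) (rule alg_hom_funcset[OF assms])

text \<open>A commutative algebra is a ring with a ring homomorphism from the base, and the module
  axioms follow from that. This replaces their verification for dual numbers, truncated divided
  powers and tensor products.\<close>

lemma algebra_of_ring_hom:
  fixes M :: "('k, 'b, 'n) module_scheme"
  assumes "cring R" "cring M" and h: "h \<in> ring_hom R M"
    and sm: "\<And>k x. \<lbrakk>k \<in> carrier R; x \<in> carrier M\<rbrakk> \<Longrightarrow> k \<odot>\<^bsub>M\<^esub> x = h k \<otimes>\<^bsub>M\<^esub> x"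
  shows "algebra R M"
proof -
  interpret R: cring R by fact
  interpret M: cring M by fact
  have hc: "h k \<in> carrier M" if "k \<in> carrier R" for k
    using h that by (rule ring_hom_closed)
  show ?thesis
    by (rule algebraI[OF assms(1,2)])
      (auto simp: sm hc ring_hom_add[OF h] ring_hom_mult[OF h] ring_hom_one[OF h]
        M.l_distr M.r_distr M.m_assoc)
qed

lemma smult_eq_mult_one:
  assumes "algebra K S" "k \<in> carrier K" "x \<in> carrier S"
  shows "k \<odot>\<^bsub>S\<^esub> x = (k \<odot>\<^bsub>S\<^esub> \<one>\<^bsub>S\<^esub>) \<otimes>\<^bsub>S\<^esub> x"
proof -
  interpret algebra K S by fact
  show ?thesis using assms(2,3) by (simp add: smult_assoc2)
qed

definition struct_map :: "('u, 'm) ring_scheme \<Rightarrow> ('u, 'u) module \<Rightarrow> 'u \<Rightarrow> 'u" where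
  "struct_map K S = (\<lambda>k\<in>carrier K. k \<odot>\<^bsub>S\<^esub> \<one>\<^bsub>S\<^esub>)"

lemma cring_base_alg: "cring (base_alg K)" if "cring K"
proof -
  interpret cring K by (rule that)
  show ?thesis
  proof (rule cringI)
    show "abelian_group (base_alg K)"
      by (rule abelian_groupI) (auto simp: base_alg_def a_ac intro: bexI[of _ "\<ominus>\<^bsub>K\<^esub> _"] l_neg)
    show "Group.comm_monoid (base_alg K)"
      by (rule comm_monoidI) (auto simp: base_alg_def m_ac)
  qed (auto simp: base_alg_def l_distr)
qed

lemma base_alg_in_algs: "base_alg K \<in> algs K" if "cring K"
proof -
  have "algebra K (base_alg K)"
    by (rule algebra_of_ring_hom[of _ _ "\<lambda>k. k"]) (use that cring_base_alg[OF that] in \<open>auto simp: base_alg_def ring_hom_def\<close>)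
  then show ?thesis by (simp add: algs_def)
qed

lemma carrier_base_alg [simp]: "carrier (base_alg K) = carrier K"
  by (simp add: base_alg_def)

lemma struct_map_alg_hom: "struct_map K S \<in> alg_hom K (base_alg K) S" if "S \<in> algs K"
proof -
  interpret algebra K S using algsD[OF that] .
  show ?thesis
    by (rule alg_homI) (auto simp: base_alg_def struct_map_def ring_hom_def smult_l_distr smult_assoc1 smult_assoc2)
qed

text \<open>Linearity forces the value at k to be k times the unit. So \<open>base_alg K\<close> is
  the initial object, and a family over K is in effect indexed by algebras alone.\<close>

lemma alg_hom_base_unique:
  assumes "\<phi> \<in> alg_hom K (base_alg K) S" "S \<in> algs K" "cring K"
  shows "\<phi> = struct_map K S"
proof (rule alg_hom_eqI[OF assms(1) struct_map_alg_hom[OF assms(2)]])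
  interpret cring K by fact
  fix x assume x: "x \<in> carrier (base_alg K)"
  have "\<phi> (x \<odot>\<^bsub>base_alg K\<^esub> \<one>\<^bsub>base_alg K\<^esub>) = x \<odot>\<^bsub>S\<^esub> \<phi> \<one>\<^bsub>base_alg K\<^esub>"
    by (rule alg_hom_smult[OF assms(1)]) (use x in \<open>auto simp: base_alg_def\<close>)
  then show "\<phi> x = struct_map K S x"
    using x by (simp add: alg_hom_one[OF assms(1)] struct_map_def) (simp add: base_alg_def)
qed

lemma coslice_iff: "(T, \<phi>) \<in> coslice K S \<longleftrightarrow> T \<in> algs K \<and> \<phi> \<in> alg_hom K S T"
  by (simp add: coslice_def)

section \<open>Copies in the universe\<close>

text \<open>The axioms are equations together with the existence of negatives, so they pass to the
  image of any h that respects the operations, injective or not. This covers quotients as well as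
  copies.\<close>

lemma cring_hom_image:
  fixes A :: "('a, 'n) ring_scheme" and B :: "('b, 'p) ring_scheme"
  assumes "cring A" and 1: "carrier B = h ` carrier A"
    and m: "\<And>x y. \<lbrakk>x \<in> carrier A; y \<in> carrier A\<rbrakk> \<Longrightarrow> h x \<otimes>\<^bsub>B\<^esub> h y = h (x \<otimes>\<^bsub>A\<^esub> y)"
    and a: "\<And>x y. \<lbrakk>x \<in> carrier A; y \<in> carrier A\<rbrakk> \<Longrightarrow> h x \<oplus>\<^bsub>B\<^esub> h y = h (x \<oplus>\<^bsub>A\<^esub> y)"
    and o: "\<one>\<^bsub>B\<^esub> = h \<one>\<^bsub>A\<^esub>" and z: "\<zero>\<^bsub>B\<^esub> = h \<zero>\<^bsub>A\<^esub>"
  shows "cring B"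
proof -
  interpret A: cring A by fact
  show ?thesis
  proof (rule cringI)
    show "abelian_group B"
    proof (rule abelian_groupI)
      fix x assume "x \<in> carrier B"
      then obtain x' where "x' \<in> carrier A" "x = h x'" by (auto simp: 1)
      then show "\<exists>y\<in>carrier B. y \<oplus>\<^bsub>B\<^esub> x = \<zero>\<^bsub>B\<^esub>"
        by (intro bexI[of _ "h (\<ominus>\<^bsub>A\<^esub> x')"]) (auto simp: 1 a z A.l_neg)
    qed (auto simp: 1 a z A.a_ac)
    show "Group.comm_monoid B"
      by (rule comm_monoidI) (auto simp: 1 m o A.m_ac)
  qed (auto simp: 1 m a A.l_distr)
qed

lemma algebra_hom_image:
  fixes A :: "('k, 'a, 'n) module_scheme" and B :: "('k, 'b, 'p) module_scheme"
  assumes A: "algebra K A" and 1: "carrier B = h ` carrier A"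
    and m: "\<And>x y. \<lbrakk>x \<in> carrier A; y \<in> carrier A\<rbrakk> \<Longrightarrow> h x \<otimes>\<^bsub>B\<^esub> h y = h (x \<otimes>\<^bsub>A\<^esub> y)"
    and a: "\<And>x y. \<lbrakk>x \<in> carrier A; y \<in> carrier A\<rbrakk> \<Longrightarrow> h x \<oplus>\<^bsub>B\<^esub> h y = h (x \<oplus>\<^bsub>A\<^esub> y)"
    and o: "\<one>\<^bsub>B\<^esub> = h \<one>\<^bsub>A\<^esub>" and z: "\<zero>\<^bsub>B\<^esub> = h \<zero>\<^bsub>A\<^esub>"
    and s: "\<And>k x. \<lbrakk>k \<in> carrier K; x \<in> carrier A\<rbrakk> \<Longrightarrow> k \<odot>\<^bsub>B\<^esub> h x = h (k \<odot>\<^bsub>A\<^esub> x)"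
  shows "algebra K B"
proof -
  interpret A: algebra K A by fact
  have B: "cring B"
    by (rule cring_hom_image[OF A.is_cring 1 m a o z])
  show "algebra K B"
    by (rule algebra_of_ring_hom[OF A.R.cring_axioms B, of "\<lambda>k. h (k \<odot>\<^bsub>A\<^esub> \<one>\<^bsub>A\<^esub>)"])
      (auto simp: ring_hom_def 1 m a o s A.smult_l_distr A.smult_assoc1 A.smult_assoc2)
qed

lemma emb_inj: "inj_on (emb C :: 'b \<Rightarrow> 'u) C" if "\<exists>h :: 'b \<Rightarrow> 'u. inj_on h C"
  unfolding emb_def using that by (rule someI_ex)

lemma
  fixes C :: "'b set"
  assumes "\<exists>h :: 'b \<Rightarrow> 'u. inj_on h C"
  shows unemb_emb: "\<And>x. x \<in> C \<Longrightarrow> unemb C (emb C x :: 'u) = x"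
  by (simp add: unemb_def the_inv_into_f_f[OF emb_inj[OF assms]])

lemma
  fixes A :: "('k, 'b) module"
  assumes "\<exists>h :: 'b \<Rightarrow> 'u. inj_on h (carrier A)" and A: "algebra K A"
  defines "B \<equiv> copy_alg A :: ('k, 'u) module" and "h \<equiv> emb (carrier A) :: 'b \<Rightarrow> 'u"
  shows copy_alg_algebra: "algebra K B"
    and copy_alg_hom: "h \<in> ring_hom A B"
    and copy_alg_zero: "\<zero>\<^bsub>B\<^esub> = h \<zero>\<^bsub>A\<^esub>"
    and copy_alg_smult: "\<And>k x. x \<in> carrier A \<Longrightarrow> k \<odot>\<^bsub>B\<^esub> h x = h (k \<odot>\<^bsub>A\<^esub> x)"
    and copy_alg_carrier: "carrier B = h ` carrier A"
proof -
  interpret A: algebra K A by fact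
  note un = unemb_emb[OF assms(1)]
  show 1: "carrier B = h ` carrier A"
    by (simp add: B_def copy_alg_def h_def Let_def)
  have m: "h x \<otimes>\<^bsub>B\<^esub> h y = h (x \<otimes>\<^bsub>A\<^esub> y)" if "x \<in> carrier A" "y \<in> carrier A" for x y
    using that by (simp add: B_def copy_alg_def h_def Let_def un)
  have a: "h x \<oplus>\<^bsub>B\<^esub> h y = h (x \<oplus>\<^bsub>A\<^esub> y)" if "x \<in> carrier A" "y \<in> carrier A" for x y
    using that by (simp add: B_def copy_alg_def h_def Let_def un)
  show s: "k \<odot>\<^bsub>B\<^esub> h x = h (k \<odot>\<^bsub>A\<^esub> x)" if "x \<in> carrier A" for k x
    using that by (simp add: B_def copy_alg_def h_def Let_def un)
  have o: "\<one>\<^bsub>B\<^esub> = h \<one>\<^bsub>A\<^esub>"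
    by (simp add: B_def copy_alg_def h_def Let_def)
  show z: "\<zero>\<^bsub>B\<^esub> = h \<zero>\<^bsub>A\<^esub>"
    by (simp add: B_def copy_alg_def h_def Let_def)
  show "h \<in> ring_hom A B"
    by (auto simp: ring_hom_def 1 m a o)
  show "algebra K B"
    using 1 m a o z s by (rule algebra_hom_image[OF A])
qed

section \<open>Codes for pairs, lists and formal sums in the universe\<close>

lemma infinite_pair_inj:
  assumes "infinite (UNIV :: 'u set)"
  shows "\<exists>p :: 'u \<times> 'u \<Rightarrow> 'u. inj p"
proof -
  have "|UNIV :: ('u \<times> 'u) set| \<le>o |UNIV :: 'u set|"
    using card_of_Times_same_infinite[OF assms] by (simp add: ordIso_imp_ordLeq)
  then show ?thesis
    by (simp add: card_of_ordLeq[symmetric])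
qed

lemma infinite_list_inj:
  assumes "infinite (UNIV :: 'u set)"
  shows "\<exists>h :: 'u list \<Rightarrow> 'u. inj h"
proof -
  obtain p :: "'u \<times> 'u \<Rightarrow> 'u" where p: "inj p"
    using infinite_pair_inj[OF assms] by blast
  obtain q :: "nat \<Rightarrow> 'u" where q: "inj q"
    using infinite_countable_subset[OF assms] by blast
  \<comment> \<open>Folding with the pairing function is injective only on lists of equal length,
    since the start value \<open>undefined\<close> may itself be the code of a pair. Therefore the
    length is coded separately through \<open>q\<close>.\<close>
  define e where "e xs = foldr (\<lambda>x a. p (x, a)) xs undefined" for xs
  have e: "xs = ys" if "length xs = length ys" "e xs = e ys" for xs ys
    using that by (induction xs ys rule: list_induct2) (auto simp: e_def dest: injD[OF p])
  have "inj (\<lambda>xs. p (q (length xs), e xs))"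
    by (rule injI) (auto dest!: injD[OF p] injD[OF q] intro: e)
  then show ?thesis by blast
qed

text \<open>The free abelian group on an infinite set has the cardinality of that set. Needed to
  place tensor products in the universe.\<close>

lemma infinite_frag_inj:
  assumes "infinite (UNIV :: 'u set)"
  shows "\<exists>h :: ('u \<times> 'u \<Rightarrow>\<^sub>0 int) \<Rightarrow> 'u. inj h"
proof -
  have "infinite (UNIV :: ('u \<times> 'u) set)"
    using assms finite_prod by blast
  then have "carrier (free_Abelian_group (UNIV :: ('u \<times> 'u) set)) \<approx> (UNIV :: ('u \<times> 'u) set)"
    by (rule eqpoll_free_Abelian_group_infinite)
  moreover have "carrier (free_Abelian_group (UNIV :: ('u \<times> 'u) set)) = UNIV"
    by auto
  ultimately obtain f :: "('u \<times> 'u \<Rightarrow>\<^sub>0 int) \<Rightarrow> 'u \<times> 'u" where "inj f"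
    by (auto simp: eqpoll_def bij_betw_def)
  moreover obtain p :: "'u \<times> 'u \<Rightarrow> 'u" where "inj p"
    using infinite_pair_inj[OF assms] by blast
  ultimately show ?thesis
    using inj_compose by blast
qed

section \<open>The reduced quotient\<close>

definition (in cring) nilpotents :: "'a set" where
  "nilpotents = {s \<in> carrier R. \<exists>n::nat. s [^] n = \<zero>}"

context cring
begin

lemma nilpotents_closed: "s \<in> nilpotents \<Longrightarrow> s \<in> carrier R"
  by (simp add: nilpotents_def)

lemma nilpotents_mult: assumes s: "s \<in> nilpotents" and t: "t \<in> carrier R" shows "s \<otimes> t \<in> nilpotents"
proof -
  obtain n :: nat where "s \<in> carrier R" "s [^] n = \<zero>"
    using s by (auto simp: nilpotents_def)
  then have "(s \<otimes> t) [^] n = \<zero>"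
    using t by (simp add: nat_pow_distrib)
  then show ?thesis
    using \<open>s \<in> carrier R\<close> t by (auto simp: nilpotents_def)
qed

text \<open>Modulo s the powers of s + t are the powers of t. Once such a power of t vanishes, the
  same power of s + t is a multiple of s and hence nilpotent; no binomial expansion is
  required.\<close>

lemma nilpotents_add: assumes s: "s \<in> nilpotents" and t: "t \<in> nilpotents" shows "s \<oplus> t \<in> nilpotents"
proof -
  have c: "s \<in> carrier R" "t \<in> carrier R"
    using s t by (auto simp: nilpotents_def)
  have "\<exists>u\<in>carrier R. (s \<oplus> t) [^] n = s \<otimes> u \<oplus> t [^] n" for n :: nat
  proof (induction n)
    case 0
    show ?case using c by (intro bexI[of _ \<zero>]) auto
  next
    case (Suc n)
    then obtain u where u: "u \<in> carrier R" "(s \<oplus> t) [^] n = s \<otimes> u \<oplus> t [^] n" by blast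
    have "(s \<oplus> t) [^] Suc n = s \<otimes> (u \<otimes> (s \<oplus> t) \<oplus> t [^] n) \<oplus> t [^] Suc n"
      using u c by (simp add: l_distr r_distr m_ac a_ac)
    then show ?case
      using u c by (intro bexI[of _ "u \<otimes> (s \<oplus> t) \<oplus> t [^] n"]) auto
  qed
  moreover obtain n :: nat where n: "t [^] n = \<zero>"
    using t by (auto simp: nilpotents_def)
  ultimately obtain u where u: "u \<in> carrier R" "(s \<oplus> t) [^] n = s \<otimes> u"
    using c by (metis m_closed r_zero)
  have "s \<otimes> u \<in> nilpotents"
    using s u(1) by (rule nilpotents_mult)
  then obtain m :: nat where "(s \<otimes> u) [^] m = \<zero>"
    by (auto simp: nilpotents_def)
  then have "(s \<oplus> t) [^] (n * m) = \<zero>"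
    using c u by (simp add: nat_pow_pow[symmetric])
  then show ?thesis
    using c by (auto simp: nilpotents_def)
qed

lemma nilpotents_minus: assumes "s \<in> nilpotents" shows "\<ominus> s \<in> nilpotents"
proof -
  have "s \<otimes> \<ominus> \<one> = \<ominus> s"
    using nilpotents_closed[OF assms] by (simp add: r_minus)
  then show ?thesis
    using nilpotents_mult[OF assms, of "\<ominus> \<one>"] by simp
qed

lemma nilpotents_zero: "\<zero> \<in> nilpotents"
proof -
  have "\<zero> [^] (1::nat) = \<zero>" by simp
  then show ?thesis unfolding nilpotents_def by blast
qed

text \<open>A choice of one representative in each class modulo the nilradical. The quotient ring
  can then be carried by a subset of the ring itself and stays in the universe without being
  copied.\<close>

definition nil_rep :: "'a \<Rightarrow> 'a" where
  "nil_rep x = (SOME y. y \<in> carrier R \<and> x \<ominus> y \<in> nilpotents)"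

lemma nil_rep: assumes "x \<in> carrier R" shows "nil_rep x \<in> carrier R" "x \<ominus> nil_rep x \<in> nilpotents"
proof -
  have "x \<in> carrier R \<and> x \<ominus> x \<in> nilpotents"
    using assms nilpotents_zero by (simp add: a_minus_def r_neg)
  then have "nil_rep x \<in> carrier R \<and> x \<ominus> nil_rep x \<in> nilpotents"
    unfolding nil_rep_def by (rule someI)
  then show "nil_rep x \<in> carrier R" "x \<ominus> nil_rep x \<in> nilpotents"
    by auto
qed

lemma nil_rep_eq_iff:
  assumes x: "x \<in> carrier R" and y: "y \<in> carrier R"
  shows "nil_rep x = nil_rep y \<longleftrightarrow> x \<ominus> y \<in> nilpotents"
proof
  have *: "u \<ominus> w \<in> nilpotents" if "u \<in> carrier R" "t \<in> carrier R" "w \<in> carrier R" "u \<ominus> t \<in> nilpotents" "t \<ominus> w \<in> nilpotents" for u t w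
  proof -
    have "u \<ominus> w = (u \<ominus> t) \<oplus> (t \<ominus> w)"
    proof -
      have "(u \<ominus> t) \<oplus> (t \<ominus> w) = u \<oplus> (\<ominus> t \<oplus> (t \<oplus> \<ominus> w))"
        using that(1-3) by (simp add: a_minus_def a_assoc)
      also have "\<ominus> t \<oplus> (t \<oplus> \<ominus> w) = \<ominus> w"
        using that(1-3) by (simp add: r_neg1)
      finally show ?thesis by (simp add: a_minus_def)
    qed
    then show ?thesis using nilpotents_add[OF that(4,5)] by simp
  qed
  have sym: "t \<ominus> u \<in> nilpotents" if "u \<in> carrier R" "t \<in> carrier R" "u \<ominus> t \<in> nilpotents" for u t
  proof -
    have "\<ominus> (u \<ominus> t) = t \<ominus> u"
      using that(1,2) by (simp add: a_minus_def minus_add a_comm)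
    then show ?thesis using nilpotents_minus[OF that(3)] by simp
  qed
  show "nil_rep x = nil_rep y" if "x \<ominus> y \<in> nilpotents"
  proof -
    \<comment> \<open>Both representatives are chosen from the same set, so they are the same
      element.\<close>
    have "z \<in> carrier R \<and> x \<ominus> z \<in> nilpotents \<longleftrightarrow> z \<in> carrier R \<and> y \<ominus> z \<in> nilpotents" for z
      using *[OF x y] *[OF y x] sym[OF x y that] that by blast
    then show ?thesis by (simp add: nil_rep_def)
  qed
  show "x \<ominus> y \<in> nilpotents" if "nil_rep x = nil_rep y"
    using *[OF x nil_rep(1)[OF x] y nil_rep(2)[OF x]] sym[OF y nil_rep(1)[OF y] nil_rep(2)[OF y]] that by simp
qed

lemma nil_rep_mult:
  assumes "x \<in> carrier R" "x' \<in> carrier R" "t \<in> carrier R" "x \<ominus> x' \<in> nilpotents"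
  shows "nil_rep (x \<otimes> t) = nil_rep (x' \<otimes> t)"
proof -
  have "x \<otimes> t \<ominus> x' \<otimes> t = (x \<ominus> x') \<otimes> t"
    using assms(1-3) by (simp add: a_minus_def l_distr l_minus)
  then show ?thesis
    using nilpotents_mult[OF assms(4,3)] assms(1-3) by (simp add: nil_rep_eq_iff)
qed

lemma nil_rep_add:
  assumes "x \<in> carrier R" "x' \<in> carrier R" "t \<in> carrier R" "x \<ominus> x' \<in> nilpotents"
  shows "nil_rep (x \<oplus> t) = nil_rep (x' \<oplus> t)"
proof -
  have "\<ominus> (x' \<oplus> t) = \<ominus> t \<oplus> \<ominus> x'"
    using assms(1-3) by (subst minus_add) (auto intro: a_comm)
  then have "(x \<oplus> t) \<ominus> (x' \<oplus> t) = x \<oplus> (t \<oplus> (\<ominus> t \<oplus> \<ominus> x'))"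
    using assms(1-3) by (simp only: a_minus_def a_assoc a_closed a_inv_closed)
  also have "\<dots> = x \<ominus> x'"
    using assms(1-3) by (simp only: a_minus_def r_neg2 a_inv_closed)
  finally show ?thesis
    using assms by (simp add: nil_rep_eq_iff)
qed

end

text \<open>The quotient by the nilradical serves as a test algebra: additive characters become
  trivial over it, while membership in an open subfunctor can be checked there. The operations are
  those of S followed by the choice of representatives.\<close>

lemma reduced_quotient:
  fixes K :: "('u, 'm) ring_scheme"
  assumes S: "S \<in> algs K"
  obtains S' \<rho> where "S' \<in> algs K" "\<rho> \<in> alg_hom K S S'" "\<rho> ` carrier S = carrier S'"
    "\<And>s. s \<in> carrier S \<Longrightarrow> \<rho> s = \<zero>\<^bsub>S'\<^esub> \<longleftrightarrow> s \<in> cring.nilpotents S"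
proof -
  interpret S: algebra K S using algsD[OF S] .
  let ?r = "S.nil_rep"
  define B :: "('u, 'u) module" where "B = \<lparr>carrier = ?r ` carrier S, monoid.mult = (\<lambda>x y. ?r (x \<otimes>\<^bsub>S\<^esub> y)), one = ?r \<one>\<^bsub>S\<^esub>,
    ring.zero = ?r \<zero>\<^bsub>S\<^esub>, add = (\<lambda>x y. ?r (x \<oplus>\<^bsub>S\<^esub> y)), smult = (\<lambda>k x. ?r (k \<odot>\<^bsub>S\<^esub> x))\<rparr>"
  note r = S.nil_rep and n = S.nilpotents_closed
  have m: "?r (?r x \<otimes>\<^bsub>S\<^esub> ?r y) = ?r (x \<otimes>\<^bsub>S\<^esub> y)" if "x \<in> carrier S" "y \<in> carrier S" for x y
    using S.nil_rep_mult[OF that(1) r(1)[OF that(1)] that(2) r(2)[OF that(1)]]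
      S.nil_rep_mult[OF that(2) r(1)[OF that(2)] r(1)[OF that(1)] r(2)[OF that(2)]] that r(1)
    by (simp add: S.m_comm)
  have a: "?r (?r x \<oplus>\<^bsub>S\<^esub> ?r y) = ?r (x \<oplus>\<^bsub>S\<^esub> y)" if "x \<in> carrier S" "y \<in> carrier S" for x y
    using S.nil_rep_add[OF that(1) r(1)[OF that(1)] that(2) r(2)[OF that(1)]]
      S.nil_rep_add[OF that(2) r(1)[OF that(2)] r(1)[OF that(1)] r(2)[OF that(2)]] that r(1)
    by (simp add: S.a_comm)
  have s: "?r (k \<odot>\<^bsub>S\<^esub> ?r x) = ?r (k \<odot>\<^bsub>S\<^esub> x)" if "k \<in> carrier K" "x \<in> carrier S" for k x
    using S.nil_rep_mult[OF that(2) r(1)[OF that(2)] S.smult_closed[OF that(1) S.one_closed] r(2)[OF that(2)]]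
      that r(1)[OF that(2)] by (simp add: S.smult_assoc2 S.m_comm[of _ "k \<odot>\<^bsub>S\<^esub> \<one>\<^bsub>S\<^esub>"])
  have B: "B \<in> algs K"
    unfolding algs_def mem_Collect_eq
    by (rule algebra_hom_image[OF S.algebra_axioms, of _ ?r]) (auto simp: B_def m a s)
  have h: "(\<lambda>x\<in>carrier S. ?r x) \<in> alg_hom K S B"
    by (rule alg_homI) (auto simp: B_def ring_hom_def m a s)
  show thesis
  proof (rule that[OF B h])
    fix x assume x: "x \<in> carrier S"
    then show "(\<lambda>x\<in>carrier S. ?r x) x = \<zero>\<^bsub>B\<^esub> \<longleftrightarrow> x \<in> S.nilpotents"
      using S.nil_rep_eq_iff[OF x S.zero_closed] by (simp add: B_def a_minus_def)
  qed (auto simp: B_def)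
qed

section \<open>Dual numbers\<close>

lemma dual_pairs_cring:
  assumes "cring S" shows "cring (dual_pairs S)"
proof -
  interpret cring S by fact
  show ?thesis
  proof (rule cringI)
    show "abelian_group (dual_pairs S)"
    proof (rule abelian_groupI)
      fix x assume "x \<in> carrier (dual_pairs S)"
      then show "\<exists>y\<in>carrier (dual_pairs S). y \<oplus>\<^bsub>dual_pairs S\<^esub> x = \<zero>\<^bsub>dual_pairs S\<^esub>"
        by (intro bexI[of _ "(\<ominus>\<^bsub>S\<^esub> fst x, \<ominus>\<^bsub>S\<^esub> snd x)"]) (auto simp: dual_pairs_def l_neg)
    qed (auto simp: dual_pairs_def a_ac)
    show "Group.comm_monoid (dual_pairs S)"
      by (rule comm_monoidI) (auto simp: dual_pairs_def m_ac a_ac l_distr r_distr)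
  qed (auto simp: dual_pairs_def l_distr a_ac)
qed

lemma dual_pairs_algebra: "algebra K (dual_pairs S)" if "algebra K S"
proof -
  interpret algebra K S by (rule that)
  show ?thesis
    by (rule algebra_of_ring_hom[OF R.cring_axioms dual_pairs_cring[OF cring_axioms],
          of "\<lambda>k. (k \<odot>\<^bsub>S\<^esub> \<one>\<^bsub>S\<^esub>, \<zero>\<^bsub>S\<^esub>)"])
      (auto simp: dual_pairs_def ring_hom_def smult_l_distr smult_assoc1 smult_assoc2)
qed

locale universe =
  fixes K :: "('u, 'm) ring_scheme"
  assumes inf: "infinite (UNIV :: 'u set)" and K: "cring K"
begin

lemma pair_emb: "\<exists>h :: 'u \<times> 'u \<Rightarrow> 'u. inj_on h C"
  using infinite_pair_inj[OF inf] inj_on_subset by blast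

lemma un_mk_dual [simp]:
  "\<lbrakk>a \<in> carrier S; b \<in> carrier S\<rbrakk> \<Longrightarrow> un_dual S (mk_dual S a b) = (a, b :: 'u)"
  unfolding un_dual_def mk_dual_def by (rule unemb_emb[OF pair_emb]) (simp add: dual_pairs_def)

context
  fixes S :: "('u, 'u) module"
  assumes S: "S \<in> algs K"
begin

lemma dual_num_algs: "dual_num S \<in> algs K"
  using copy_alg_algebra[OF pair_emb dual_pairs_algebra[OF algsD[OF S]]]
  by (simp add: algs_def dual_num_def)

lemma dual_num_carrier: "z \<in> carrier (dual_num S) \<longleftrightarrow> (\<exists>a\<in>carrier S. \<exists>b\<in>carrier S. z = mk_dual S a b)"
  using copy_alg_carrier[OF pair_emb dual_pairs_algebra[OF algsD[OF S]]]
  by (auto simp: dual_num_def mk_dual_def dual_pairs_def)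

lemma mk_dual_closed: "\<lbrakk>a \<in> carrier S; b \<in> carrier S\<rbrakk> \<Longrightarrow> mk_dual S a b \<in> carrier (dual_num S)"
  by (auto simp: dual_num_carrier)

lemma un_dual_closed:
  "z \<in> carrier (dual_num S) \<Longrightarrow> fst (un_dual S z) \<in> carrier S"
  "z \<in> carrier (dual_num S) \<Longrightarrow> snd (un_dual S z) \<in> carrier S"
  by (auto simp: dual_num_carrier)

lemma mk_un_dual: "z \<in> carrier (dual_num S) \<Longrightarrow> mk_dual S (fst (un_dual S z)) (snd (un_dual S z)) = z"
  by (auto simp: dual_num_carrier)

lemma dual_num_mult:
  "\<lbrakk>a \<in> carrier S; b \<in> carrier S; c \<in> carrier S; d \<in> carrier S\<rbrakk> \<Longrightarrow>
    mk_dual S a b \<otimes>\<^bsub>dual_num S\<^esub> mk_dual S c d = mk_dual S (a \<otimes>\<^bsub>S\<^esub> c) (a \<otimes>\<^bsub>S\<^esub> d \<oplus>\<^bsub>S\<^esub> b \<otimes>\<^bsub>S\<^esub> c)"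
  unfolding mk_dual_def dual_num_def
  by (subst ring_hom_mult[OF copy_alg_hom[OF pair_emb dual_pairs_algebra[OF algsD[OF S]]], symmetric])
    (auto simp: dual_pairs_def)

lemma dual_num_add:
  "\<lbrakk>a \<in> carrier S; b \<in> carrier S; c \<in> carrier S; d \<in> carrier S\<rbrakk> \<Longrightarrow>
    mk_dual S a b \<oplus>\<^bsub>dual_num S\<^esub> mk_dual S c d = mk_dual S (a \<oplus>\<^bsub>S\<^esub> c) (b \<oplus>\<^bsub>S\<^esub> d)"
  unfolding mk_dual_def dual_num_def
  by (subst ring_hom_add[OF copy_alg_hom[OF pair_emb dual_pairs_algebra[OF algsD[OF S]]], symmetric])
    (auto simp: dual_pairs_def)

lemma dual_num_one: "\<one>\<^bsub>dual_num S\<^esub> = mk_dual S \<one>\<^bsub>S\<^esub> \<zero>\<^bsub>S\<^esub>"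
  unfolding mk_dual_def dual_num_def
  by (subst ring_hom_one[OF copy_alg_hom[OF pair_emb dual_pairs_algebra[OF algsD[OF S]]], symmetric])
    (auto simp: dual_pairs_def)

lemma dual_num_zero: "\<zero>\<^bsub>dual_num S\<^esub> = mk_dual S \<zero>\<^bsub>S\<^esub> \<zero>\<^bsub>S\<^esub>"
  unfolding mk_dual_def dual_num_def
  by (subst copy_alg_zero[OF pair_emb dual_pairs_algebra[OF algsD[OF S]]]) (auto simp: dual_pairs_def)

lemma dual_num_smult:
  "\<lbrakk>a \<in> carrier S; b \<in> carrier S\<rbrakk> \<Longrightarrow>
    k \<odot>\<^bsub>dual_num S\<^esub> mk_dual S a b = mk_dual S (k \<odot>\<^bsub>S\<^esub> a) (k \<odot>\<^bsub>S\<^esub> b)"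
  unfolding mk_dual_def dual_num_def
  by (subst copy_alg_smult[OF pair_emb dual_pairs_algebra[OF algsD[OF S]]]) (auto simp: dual_pairs_def)

lemmas dual_num_simps = dual_num_mult dual_num_add dual_num_one dual_num_zero dual_num_smult

lemma dual_incl_alg_hom: "dual_incl S \<in> alg_hom K S (dual_num S)"
proof -
  interpret algebra K S using algsD[OF S] .
  show ?thesis
    by (rule alg_homI) (auto simp: dual_incl_def ring_hom_def dual_num_simps mk_dual_closed)
qed

lemma dual_proj_mk: "\<lbrakk>a \<in> carrier S; b \<in> carrier S\<rbrakk> \<Longrightarrow> dual_proj S (mk_dual S a b) = a"
  by (simp add: dual_proj_def mk_dual_closed)

lemma dual_proj_alg_hom: "dual_proj S \<in> alg_hom K (dual_num S) S"
proof -
  interpret algebra K S using algsD[OF S] .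
  show ?thesis
  proof (rule alg_homI)
    show "dual_proj S \<in> ring_hom (dual_num S) S"
      by (rule ring_hom_memI) (auto simp: dual_num_carrier dual_num_simps dual_proj_mk)
  qed (simp add: dual_proj_def, auto simp: dual_num_carrier dual_num_simps dual_proj_mk)
qed

lemma eps_closed: "eps S \<in> carrier (dual_num S)"
proof -
  interpret algebra K S using algsD[OF S] .
  show ?thesis by (simp add: eps_def mk_dual_closed)
qed

lemma eps_square: "eps S \<otimes>\<^bsub>dual_num S\<^esub> eps S = \<zero>\<^bsub>dual_num S\<^esub>"
proof -
  interpret algebra K S using algsD[OF S] .
  show ?thesis by (simp add: eps_def dual_num_simps)
qed

lemma dual_map_mk:
  "\<lbrakk>a \<in> carrier S; b \<in> carrier S\<rbrakk> \<Longrightarrow> dual_map S T \<phi> (mk_dual S a b) = mk_dual T (\<phi> a) (\<phi> b)"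
  by (simp add: dual_map_def mk_dual_closed)

text \<open>The universal property of dual numbers: the morphism that restricts to \<phi> on S and
  sends \<open>eps S\<close> to u.\<close>

definition dual_eval :: "('u, 'u) module \<Rightarrow> ('u \<Rightarrow> 'u) \<Rightarrow> 'u \<Rightarrow> 'u \<Rightarrow> 'u" where
  "dual_eval T \<phi> u = (\<lambda>z\<in>carrier (dual_num S). \<phi> (fst (un_dual S z)) \<oplus>\<^bsub>T\<^esub> \<phi> (snd (un_dual S z)) \<otimes>\<^bsub>T\<^esub> u)"

lemma dual_eval_mk:
  "\<lbrakk>a \<in> carrier S; b \<in> carrier S\<rbrakk> \<Longrightarrow> dual_eval T \<phi> u (mk_dual S a b) = \<phi> a \<oplus>\<^bsub>T\<^esub> \<phi> b \<otimes>\<^bsub>T\<^esub> u"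
  by (simp add: dual_eval_def mk_dual_closed)

lemma dual_eval_alg_hom:
  assumes T: "T \<in> algs K" and \<phi>: "\<phi> \<in> alg_hom K S T" and u: "u \<in> carrier T" "u \<otimes>\<^bsub>T\<^esub> u = \<zero>\<^bsub>T\<^esub>"
  shows "dual_eval T \<phi> u \<in> alg_hom K (dual_num S) T"
proof -
  interpret S: algebra K S using algsD[OF S] .
  interpret T: algebra K T using algsD[OF T] .
  have z: "\<phi> \<zero>\<^bsub>S\<^esub> = \<zero>\<^bsub>T\<^esub>"
    using alg_hom_zero[OF \<phi> S.cring_axioms T.cring_axioms] .
  note \<phi>s = alg_hom_add[OF \<phi>] alg_hom_mult[OF \<phi>] alg_hom_one[OF \<phi>] alg_hom_closed[OF \<phi>] alg_hom_smult[OF \<phi>] z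
  show ?thesis
  proof (rule alg_homI)
    show "dual_eval T \<phi> u \<in> ring_hom (dual_num S) T"
    proof (rule ring_hom_memI)
      fix x y assume "x \<in> carrier (dual_num S)" "y \<in> carrier (dual_num S)"
      then obtain a b c d where ab: "a \<in> carrier S" "b \<in> carrier S" "c \<in> carrier S" "d \<in> carrier S"
        and xy: "x = mk_dual S a b" "y = mk_dual S c d"
        by (auto simp: dual_num_carrier)
      \<comment> \<open>The term with u times u is kept as a separate last summand, to be deleted by
        the hypothesis on u.\<close>
      have "(\<phi> a \<oplus>\<^bsub>T\<^esub> \<phi> b \<otimes>\<^bsub>T\<^esub> u) \<otimes>\<^bsub>T\<^esub> (\<phi> c \<oplus>\<^bsub>T\<^esub> \<phi> d \<otimes>\<^bsub>T\<^esub> u) =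
         \<phi> a \<otimes>\<^bsub>T\<^esub> \<phi> c \<oplus>\<^bsub>T\<^esub> (\<phi> a \<otimes>\<^bsub>T\<^esub> \<phi> d \<oplus>\<^bsub>T\<^esub> \<phi> b \<otimes>\<^bsub>T\<^esub> \<phi> c) \<otimes>\<^bsub>T\<^esub> u \<oplus>\<^bsub>T\<^esub> \<phi> b \<otimes>\<^bsub>T\<^esub> \<phi> d \<otimes>\<^bsub>T\<^esub> (u \<otimes>\<^bsub>T\<^esub> u)"
        using ab u(1) by (simp add: \<phi>s T.l_distr T.r_distr T.a_ac T.m_ac del: T.r_null)
      then show "dual_eval T \<phi> u (x \<otimes>\<^bsub>dual_num S\<^esub> y) = dual_eval T \<phi> u x \<otimes>\<^bsub>T\<^esub> dual_eval T \<phi> u y"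
        using ab u by (simp add: xy dual_num_simps dual_eval_mk \<phi>s)
      show "dual_eval T \<phi> u (x \<oplus>\<^bsub>dual_num S\<^esub> y) = dual_eval T \<phi> u x \<oplus>\<^bsub>T\<^esub> dual_eval T \<phi> u y"
        using ab u by (simp add: xy dual_num_simps dual_eval_mk \<phi>s T.l_distr T.a_ac)
    qed (use u in \<open>auto simp: dual_num_carrier dual_num_simps dual_eval_mk \<phi>s\<close>)
  next
    show "dual_eval T \<phi> u \<in> extensional (carrier (dual_num S))"
      by (simp add: dual_eval_def)
    fix k z assume k: "k \<in> carrier K" and "z \<in> carrier (dual_num S)"
    then obtain a b where ab: "a \<in> carrier S" "b \<in> carrier S" "z = mk_dual S a b"
      by (auto simp: dual_num_carrier)
    then show "dual_eval T \<phi> u (k \<odot>\<^bsub>dual_num S\<^esub> z) = k \<odot>\<^bsub>T\<^esub> dual_eval T \<phi> u z"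
      using u k by (simp add: dual_num_simps dual_eval_mk \<phi>s T.smult_r_distr T.smult_assoc2)
  qed
qed

lemma dual_proj_incl: "compose (carrier S) (dual_proj S) (dual_incl S) = (\<lambda>s\<in>carrier S. s)"
proof -
  interpret algebra K S using algsD[OF S] .
  show ?thesis by (auto simp: compose_def fun_eq_iff dual_incl_def dual_proj_mk)
qed

end

lemma dual_map_alg_hom:
  assumes S: "S \<in> algs K" and T: "T \<in> algs K" and \<phi>: "\<phi> \<in> alg_hom K S T"
  shows "dual_map S T \<phi> \<in> alg_hom K (dual_num S) (dual_num T)"
proof -
  interpret S: algebra K S using algsD[OF S] .
  interpret T: algebra K T using algsD[OF T] .
  have z: "\<phi> \<zero>\<^bsub>S\<^esub> = \<zero>\<^bsub>T\<^esub>"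
    using alg_hom_zero[OF \<phi> S.cring_axioms T.cring_axioms] .
  note \<phi>s = alg_hom_add[OF \<phi>] alg_hom_mult[OF \<phi>] alg_hom_one[OF \<phi>] alg_hom_closed[OF \<phi>] alg_hom_smult[OF \<phi>] z
  show ?thesis
  proof (rule alg_homI)
    show "dual_map S T \<phi> \<in> ring_hom (dual_num S) (dual_num T)"
      by (rule ring_hom_memI)
        (auto simp: dual_num_carrier[OF S] dual_num_simps[OF S] dual_num_simps[OF T] dual_map_mk[OF S] mk_dual_closed[OF T] \<phi>s)
  qed (simp add: dual_map_def, auto simp: dual_num_carrier[OF S] dual_num_simps[OF S] dual_num_simps[OF T] dual_map_mk[OF S] \<phi>s)
qed

lemma dual_map_incl:
  assumes S: "S \<in> algs K" and T: "T \<in> algs K" and \<phi>: "\<phi> \<in> alg_hom K S T"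
  shows "compose (carrier S) (dual_map S T \<phi>) (dual_incl S) = compose (carrier S) (dual_incl T) \<phi>"
proof -
  interpret S: algebra K S using algsD[OF S] .
  interpret T: algebra K T using algsD[OF T] .
  have "\<phi> \<zero>\<^bsub>S\<^esub> = \<zero>\<^bsub>T\<^esub>"
    using alg_hom_zero[OF \<phi> S.cring_axioms T.cring_axioms] .
  then show ?thesis
    using alg_hom_closed[OF \<phi>] by (auto simp: compose_def fun_eq_iff dual_incl_def dual_map_mk[OF S])
qed

lemma dual_map_proj:
  assumes S: "S \<in> algs K" and T: "T \<in> algs K" and \<phi>: "\<phi> \<in> alg_hom K S T"
  shows "compose (carrier (dual_num S)) (dual_proj T) (dual_map S T \<phi>) = compose (carrier (dual_num S)) \<phi> (dual_proj S)"
  using alg_hom_closed[OF \<phi>]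
  by (auto simp: compose_def fun_eq_iff dual_num_carrier[OF S] dual_map_mk[OF S] dual_proj_mk[OF S] dual_proj_mk[OF T])

end

section \<open>Divided power products of sequences\<close>

text \<open>
  With \<open>f\<close> and \<open>g\<close> read as \<open>\<Sum> f\<^sub>n z\<^sub>n\<close> and \<open>\<Sum> g\<^sub>n z\<^sub>n\<close> for divided powers \<open>z\<^sub>n\<close>, this is the product; the
  recursion is the Leibniz rule for the derivation \<open>z\<^sub>n\<^sub>+\<^sub>1 \<mapsto> z\<^sub>n\<close>, and makes the ring axioms
  inductions without binomial identities.
\<close>

fun dp_mult :: "('a, 'm) ring_scheme \<Rightarrow> (nat \<Rightarrow> 'a) \<Rightarrow> (nat \<Rightarrow> 'a) \<Rightarrow> nat \<Rightarrow> 'a" where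
  "dp_mult R f g 0 = f 0 \<otimes>\<^bsub>R\<^esub> g 0"
| "dp_mult R f g (Suc n) = dp_mult R (\<lambda>i. f (Suc i)) g n \<oplus>\<^bsub>R\<^esub> dp_mult R f (\<lambda>i. g (Suc i)) n"

context cring
begin

lemma dp_mult_closed:
  "\<lbrakk>\<And>n. f n \<in> carrier R; \<And>n. g n \<in> carrier R\<rbrakk> \<Longrightarrow> dp_mult R f g n \<in> carrier R"
  by (induction n arbitrary: f g) auto

lemma dp_mult_comm:
  "\<lbrakk>\<And>n. f n \<in> carrier R; \<And>n. g n \<in> carrier R\<rbrakk> \<Longrightarrow> dp_mult R f g n = dp_mult R g f n"
proof (induction n arbitrary: f g)
  case (Suc n)
  let ?f = "\<lambda>i. f (Suc i)" and ?g = "\<lambda>i. g (Suc i)"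
  have "dp_mult R f g (Suc n) = dp_mult R ?f g n \<oplus> dp_mult R f ?g n"
    by simp
  also have "dp_mult R ?f g n = dp_mult R g ?f n"
    using Suc.prems by (intro Suc.IH) auto
  also have "dp_mult R f ?g n = dp_mult R ?g f n"
    using Suc.prems by (intro Suc.IH) auto
  also have "dp_mult R g ?f n \<oplus> dp_mult R ?g f n = dp_mult R ?g f n \<oplus> dp_mult R g ?f n"
    using Suc.prems by (intro a_comm dp_mult_closed) auto
  finally show ?case by simp
qed (simp add: m_comm)

lemma dp_mult_add:
  "\<lbrakk>\<And>n. f n \<in> carrier R; \<And>n. g n \<in> carrier R; \<And>n. h n \<in> carrier R\<rbrakk> \<Longrightarrow>
    dp_mult R (\<lambda>n. f n \<oplus> g n) h n = dp_mult R f h n \<oplus> dp_mult R g h n"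
proof (induction n arbitrary: f g h)
  case (Suc n)
  let ?f = "\<lambda>i. f (Suc i)" and ?g = "\<lambda>i. g (Suc i)" and ?h = "\<lambda>i. h (Suc i)"
  have c: "dp_mult R ?f h n \<in> carrier R" "dp_mult R ?g h n \<in> carrier R"
    "dp_mult R f ?h n \<in> carrier R" "dp_mult R g ?h n \<in> carrier R"
    using Suc.prems by (intro dp_mult_closed; simp)+
  have "dp_mult R (\<lambda>n. f n \<oplus> g n) h (Suc n) =
      dp_mult R (\<lambda>i. ?f i \<oplus> ?g i) h n \<oplus> dp_mult R (\<lambda>i. f i \<oplus> g i) ?h n"
    by simp
  also have "dp_mult R (\<lambda>i. ?f i \<oplus> ?g i) h n = dp_mult R ?f h n \<oplus> dp_mult R ?g h n"
    using Suc.prems by (intro Suc.IH) auto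
  also have "dp_mult R (\<lambda>i. f i \<oplus> g i) ?h n = dp_mult R f ?h n \<oplus> dp_mult R g ?h n"
    using Suc.prems by (intro Suc.IH) auto
  finally show ?case
    using c by (simp add: a_ac)
qed (simp add: l_distr)

lemma dp_mult_add':
  assumes "\<And>n. f n \<in> carrier R" "\<And>n. g n \<in> carrier R" "\<And>n. h n \<in> carrier R"
  shows "dp_mult R h (\<lambda>n. f n \<oplus> g n) n = dp_mult R h f n \<oplus> dp_mult R h g n"
proof -
  have "dp_mult R h (\<lambda>n. f n \<oplus> g n) n = dp_mult R (\<lambda>n. f n \<oplus> g n) h n"
    "dp_mult R h f n = dp_mult R f h n" "dp_mult R h g n = dp_mult R g h n"
    using assms by (intro dp_mult_comm; simp)+
  then show ?thesis
    using dp_mult_add[of f g h n] assms by simp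
qed

text \<open>By the Leibniz rule both sides at \<open>Suc n\<close> are the sum of the three products
  in which one factor is shifted, and the induction hypothesis applies to each of them.\<close>

lemma dp_mult_assoc:
  "\<lbrakk>\<And>n. f n \<in> carrier R; \<And>n. g n \<in> carrier R; \<And>n. h n \<in> carrier R\<rbrakk> \<Longrightarrow>
    dp_mult R (dp_mult R f g) h n = dp_mult R f (dp_mult R g h) n"
proof (induction n arbitrary: f g h)
  case (Suc n)
  let ?f = "\<lambda>i. f (Suc i)" and ?g = "\<lambda>i. g (Suc i)" and ?h = "\<lambda>i. h (Suc i)"
  let ?A = "dp_mult R ?f (dp_mult R g h) n" and ?B = "dp_mult R f (dp_mult R ?g h) n"
    and ?C = "dp_mult R f (dp_mult R g ?h) n"
  have c: "?A \<in> carrier R" "?B \<in> carrier R" "?C \<in> carrier R"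
    using Suc.prems by (intro dp_mult_closed; simp)+
  have "dp_mult R (dp_mult R f g) h (Suc n) =
      dp_mult R (\<lambda>i. dp_mult R ?f g i \<oplus> dp_mult R f ?g i) h n \<oplus> dp_mult R (dp_mult R f g) ?h n"
    by simp
  also have "dp_mult R (\<lambda>i. dp_mult R ?f g i \<oplus> dp_mult R f ?g i) h n =
      dp_mult R (dp_mult R ?f g) h n \<oplus> dp_mult R (dp_mult R f ?g) h n"
    using Suc.prems by (intro dp_mult_add dp_mult_closed) auto
  also have "dp_mult R (dp_mult R ?f g) h n = ?A"
    using Suc.prems by (intro Suc.IH) auto
  also have "dp_mult R (dp_mult R f ?g) h n = ?B"
    using Suc.prems by (intro Suc.IH) auto
  also have "dp_mult R (dp_mult R f g) ?h n = ?C"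
    using Suc.prems by (intro Suc.IH) auto
  also have "?A \<oplus> ?B \<oplus> ?C = ?A \<oplus> (?B \<oplus> ?C)"
    using c by (rule a_assoc)
  also have "?B \<oplus> ?C = dp_mult R f (\<lambda>i. dp_mult R ?g h i \<oplus> dp_mult R g ?h i) n"
    using Suc.prems by (intro dp_mult_add'[symmetric] dp_mult_closed) auto
  finally show ?case by simp
qed (simp add: m_assoc)

lemma dp_mult_zero:
  "(\<And>n. g n \<in> carrier R) \<Longrightarrow> dp_mult R (\<lambda>n. \<zero>) g n = \<zero>"
proof (induction n arbitrary: g)
  case (Suc n)
  have "dp_mult R (\<lambda>n. \<zero>) g n = \<zero>" "dp_mult R (\<lambda>n. \<zero>) (\<lambda>i. g (Suc i)) n = \<zero>"
    using Suc.prems by (intro Suc.IH; simp)+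
  then show ?case by simp
qed simp

lemma dp_mult_scalar:
  assumes a: "a \<in> carrier R"
  shows "(\<And>n. g n \<in> carrier R) \<Longrightarrow> dp_mult R (\<lambda>n. if n = 0 then a else \<zero>) g n = a \<otimes> g n"
proof (induction n arbitrary: g)
  case (Suc n)
  have "dp_mult R (\<lambda>n. if n = 0 then a else \<zero>) (\<lambda>i. g (Suc i)) n = a \<otimes> g (Suc n)"
    using Suc.prems by (intro Suc.IH) simp
  moreover have "dp_mult R (\<lambda>n. \<zero>) g n = \<zero>"
    using Suc.prems by (rule dp_mult_zero)
  ultimately show ?case
    using Suc.prems a by simp
qed simp

text \<open>That only indices up to n enter is what makes truncation compatible with products, and
  thus \<open>trunc_dp\<close> associative.\<close>

lemma dp_mult_cong:
  "\<lbrakk>\<And>i. i \<le> n \<Longrightarrow> f i = f' i; \<And>i. i \<le> n \<Longrightarrow> g i = g' i\<rbrakk> \<Longrightarrow> dp_mult R f g n = dp_mult R f' g' n"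
proof (induction n arbitrary: f g f' g')
  case (Suc n)
  have "dp_mult R (\<lambda>i. f (Suc i)) g n = dp_mult R (\<lambda>i. f' (Suc i)) g' n"
    "dp_mult R f (\<lambda>i. g (Suc i)) n = dp_mult R f' (\<lambda>i. g' (Suc i)) n"
    using Suc.prems by (intro Suc.IH; simp)+
  then show ?case by simp
qed simp

lemma pascal_sum:
  assumes t: "\<And>i. t i \<in> carrier R"
  shows "(\<Oplus>i\<in>{..Suc n}. [(Suc n choose i)] \<cdot> t i) =
    (\<Oplus>i\<in>{..n}. [(n choose i)] \<cdot> t (Suc i)) \<oplus> (\<Oplus>i\<in>{..n}. [(n choose i)] \<cdot> t i)"
proof -
  have "(\<Oplus>i\<in>{..Suc n}. [(Suc n choose i)] \<cdot> t i) = (\<Oplus>i\<in>{..n}. [(Suc n choose Suc i)] \<cdot> t (Suc i)) \<oplus> t 0"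
    using t by (subst finsum_Suc2) auto
  also have "(\<Oplus>i\<in>{..n}. [(Suc n choose Suc i)] \<cdot> t (Suc i)) =
      (\<Oplus>i\<in>{..n}. [(n choose i)] \<cdot> t (Suc i)) \<oplus> (\<Oplus>i\<in>{..n}. [(n choose Suc i)] \<cdot> t (Suc i))"
    using t by (simp add: add.nat_pow_mult[symmetric] finsum_addf Pi_def)
  also have "\<dots> \<oplus> t 0 = (\<Oplus>i\<in>{..n}. [(n choose i)] \<cdot> t (Suc i)) \<oplus> ((\<Oplus>i\<in>{..n}. [(n choose Suc i)] \<cdot> t (Suc i)) \<oplus> t 0)"
    using t by (simp add: a_assoc)
  also have "(\<Oplus>i\<in>{..n}. [(n choose Suc i)] \<cdot> t (Suc i)) \<oplus> t 0 = (\<Oplus>i\<in>{..Suc n}. [(n choose i)] \<cdot> t i)"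
    using t by (subst finsum_Suc2) auto
  \<comment> \<open>The top summand carries \<open>n choose Suc n\<close>, which is zero.\<close>
  also have "\<dots> = (\<Oplus>i\<in>{..n}. [(n choose i)] \<cdot> t i)"
    using t by (subst finsum_Suc) (auto simp: binomial_eq_0)
  finally show ?thesis .
qed

text \<open>The closed form connects the recursion with the relation that defines
  \<open>dp_seq\<close>. The induction step is Pascal's rule.\<close>

lemma dp_mult_binomial:
  "\<lbrakk>\<And>n. f n \<in> carrier R; \<And>n. g n \<in> carrier R\<rbrakk> \<Longrightarrow>
    dp_mult R f g n = (\<Oplus>i\<in>{..n}. [(n choose i)] \<cdot> (f i \<otimes> g (n - i)))"
proof (induction n arbitrary: f g)
  case (Suc n)
  have "dp_mult R f g (Suc n) = (\<Oplus>i\<in>{..n}. [(n choose i)] \<cdot> (f (Suc i) \<otimes> g (n - i))) \<oplus>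
      (\<Oplus>i\<in>{..n}. [(n choose i)] \<cdot> (f i \<otimes> g (Suc (n - i))))"
    using Suc by simp
  also have "(\<Oplus>i\<in>{..n}. [(n choose i)] \<cdot> (f i \<otimes> g (Suc (n - i)))) = (\<Oplus>i\<in>{..n}. [(n choose i)] \<cdot> (f i \<otimes> g (Suc n - i)))"
    using Suc.prems by (intro finsum_cong') (auto simp: Suc_diff_le)
  finally show ?case
    using Suc.prems by (subst pascal_sum) auto
qed simp

text \<open>Finite sequences of divided powers: the coefficient form of \<open>\<mu>(x + x') = \<mu>(x) \<mu>(x')\<close>.\<close>

definition dp_seq :: "(nat \<Rightarrow> 'a) \<Rightarrow> bool" where
  "dp_seq \<mu> \<longleftrightarrow> \<mu> \<in> carrier (UP R) \<and> \<mu> 0 = \<one> \<and> (\<forall>i j. \<mu> i \<otimes> \<mu> j = [((i + j) choose i)] \<cdot> \<mu> (i + j))"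

lemma carrier_UP_iff: "\<mu> \<in> carrier (UP R) \<longleftrightarrow> (\<forall>n. \<mu> n \<in> carrier R) \<and> (\<exists>N. \<forall>n>N. \<mu> n = \<zero>)"
  by (auto simp: UP_def up_def bound_def)

lemma finsum_extend_zero:
  assumes "finite B" "A \<subseteq> B" "\<And>i. i \<in> A \<Longrightarrow> f i \<in> carrier R" "\<And>i. i \<in> B - A \<Longrightarrow> f i = \<zero>"
  shows "finsum R f B = finsum R f A"
proof (intro add.finprod_mono_neutral_cong_right)
  show "f \<in> B \<rightarrow> carrier R"
    using assms(3,4) by (intro Pi_I) (metis DiffI zero_closed)
qed (use assms in auto)

text \<open>The relation of \<open>dp_seq\<close> absorbs the binomial coefficient: it turns
  \<open>n choose i\<close> times \<mu>_n into \<mu>_i \<mu>_(n-i), and what remains is a Cauchy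
  product. Nothing is divided by factorials, so the characteristic does not matter.\<close>

lemma dp_pairing_mult:
  assumes \<mu>: "dp_seq \<mu>" "\<And>n. n > N \<Longrightarrow> \<mu> n = \<zero>"
    and \<alpha>: "\<And>n. \<alpha> n \<in> carrier R" and \<beta>: "\<And>n. \<beta> n \<in> carrier R"
  shows "(\<Oplus>n\<in>{..N}. dp_mult R \<alpha> \<beta> n \<otimes> \<mu> n) = (\<Oplus>n\<in>{..N}. \<alpha> n \<otimes> \<mu> n) \<otimes> (\<Oplus>n\<in>{..N}. \<beta> n \<otimes> \<mu> n)"
proof -
  have \<mu>c: "\<mu> n \<in> carrier R" for n
    using \<mu>(1) by (auto simp: dp_seq_def carrier_UP_iff)
  have *: "(\<alpha> i \<otimes> \<mu> i) \<otimes> (\<beta> (n - i) \<otimes> \<mu> (n - i)) = [(n choose i)] \<cdot> (\<alpha> i \<otimes> \<beta> (n - i)) \<otimes> \<mu> n" if "i \<le> n" for i n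
  proof -
    have "\<mu> i \<otimes> \<mu> (n - i) = [(n choose i)] \<cdot> \<mu> n"
      using \<mu>(1) that by (simp add: dp_seq_def)
    moreover have "(\<alpha> i \<otimes> \<mu> i) \<otimes> (\<beta> (n - i) \<otimes> \<mu> (n - i)) = (\<alpha> i \<otimes> \<beta> (n - i)) \<otimes> (\<mu> i \<otimes> \<mu> (n - i))"
      using \<alpha> \<beta> \<mu>c by (simp add: m_ac)
    ultimately show ?thesis
      using \<alpha> \<beta> \<mu>c by (simp add: add_pow_ldistr add_pow_rdistr)
  qed
  have **: "dp_mult R \<alpha> \<beta> n \<otimes> \<mu> n = (\<Oplus>i\<in>{..n}. (\<alpha> i \<otimes> \<mu> i) \<otimes> (\<beta> (n - i) \<otimes> \<mu> (n - i)))" for n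
  proof -
    have "dp_mult R \<alpha> \<beta> n \<otimes> \<mu> n = (\<Oplus>i\<in>{..n}. [(n choose i)] \<cdot> (\<alpha> i \<otimes> \<beta> (n - i)) \<otimes> \<mu> n)"
      using \<alpha> \<beta> \<mu>c by (subst dp_mult_binomial) (auto intro!: finsum_ldistr)
    also have "\<dots> = (\<Oplus>i\<in>{..n}. (\<alpha> i \<otimes> \<mu> i) \<otimes> (\<beta> (n - i) \<otimes> \<mu> (n - i)))"
      using \<alpha> \<beta> \<mu>c by (intro finsum_cong') (auto simp: *)
    finally show ?thesis .
  qed
  \<comment> \<open>The Cauchy product of two sums up to N runs up to N + N; the additional terms
    vanish with \<mu>.\<close>
  have "(\<Oplus>n\<in>{..N + N}. dp_mult R \<alpha> \<beta> n \<otimes> \<mu> n) = (\<Oplus>n\<in>{..N}. dp_mult R \<alpha> \<beta> n \<otimes> \<mu> n)"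
    using \<alpha> \<beta> \<mu>c \<mu>(2) by (intro finsum_extend_zero) (auto simp: dp_mult_closed)
  moreover have "(\<Oplus>n\<in>{..N + N}. dp_mult R \<alpha> \<beta> n \<otimes> \<mu> n) = (\<Oplus>n\<in>{..N}. \<alpha> n \<otimes> \<mu> n) \<otimes> (\<Oplus>n\<in>{..N}. \<beta> n \<otimes> \<mu> n)"
    unfolding ** using \<alpha> \<beta> \<mu>c \<mu>(2) by (intro cauchy_product) (auto simp: bound_def)
  ultimately show ?thesis by simp
qed

end

section \<open>Additive characters\<close>

context UP_cring
begin

text \<open>Polynomials are represented by their coefficient functions, so a character \<mu> can be
  applied to an index directly.\<close>

lemma coeff_eq: "p \<in> carrier P \<Longrightarrow> coeff P p = p"
  by (simp add: P_def UP_def)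

lemma coeff_mult_X:
  assumes "p \<in> carrier P"
  shows "coeff P (p \<otimes>\<^bsub>P\<^esub> monom P \<one> 1) k = (if k = 0 then \<zero> else coeff P p (k - 1))"
proof (cases k)
  case 0
  then show ?thesis using assms by simp
next
  case (Suc m)
  have "coeff P (p \<otimes>\<^bsub>P\<^esub> monom P \<one> 1) k = (\<Oplus>i\<in>{..k}. if m = i then coeff P p i else \<zero>)"
    using assms by (simp del: R.finsum_Suc) (rule R.finsum_cong', auto simp: Suc)
  also have "\<dots> = coeff P p m"
    using assms by (intro R.finsum_singleton) (auto simp: Suc)
  finally show ?thesis by (simp add: Suc)
qed

lemma coeff_const_mult:
  "\<lbrakk>a \<in> carrier R; p \<in> carrier P\<rbrakk> \<Longrightarrow> coeff P (monom P a 0 \<otimes>\<^bsub>P\<^esub> p) k = a \<otimes> coeff P p k"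
  by (simp add: monom_mult_is_smult del: coeff_mult)

end

section \<open>Coefficients in two variables and the functional equation\<close>

context cring
begin

interpretation P: UP_cring R "UP R"
  by (unfold_locales)

interpretation Q: UP_cring "UP R" "UP (UP R)"
  by (unfold_locales)

abbreviation (input) "PP \<equiv> UP R"
abbreviation (input) "QQ \<equiv> UP (UP R)"

definition "UP2_const = (\<lambda>s. monom QQ (monom PP s 0) 0)"
definition "UP2_x = monom QQ (monom PP \<one> 1) 0"
definition "UP2_y = monom QQ \<one>\<^bsub>PP\<^esub> 1"

text \<open>The coefficient of x^i x'^j. The outer variable of \<open>UP (UP R)\<close> is x', hence
  its exponent j comes first.\<close>

definition "coeff2 q j i = coeff PP (coeff QQ q j) i"

lemma additive_chars_alt:
  "additive_chars R = {\<mu> \<in> carrier PP. eval R R (\<lambda>s. s) \<zero> \<mu> = \<one> \<and>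
     eval R QQ UP2_const (UP2_x \<oplus>\<^bsub>QQ\<^esub> UP2_y) \<mu> = eval R QQ UP2_const UP2_x \<mu> \<otimes>\<^bsub>QQ\<^esub> eval R QQ UP2_const UP2_y \<mu>}"
  by (simp only: additive_chars_def Let_def UP2_const_def UP2_x_def UP2_y_def)

lemma xy_closed [simp]: "UP2_x \<in> carrier QQ" "UP2_y \<in> carrier QQ" "s \<in> carrier R \<Longrightarrow> UP2_const s \<in> carrier QQ"
  by (auto simp: UP2_x_def UP2_y_def UP2_const_def)

lemma coeff2_closed [simp]: "q \<in> carrier QQ \<Longrightarrow> coeff2 q j i \<in> carrier R"
  by (simp add: coeff2_def)

lemma UP2_const_hom: "ring_hom_cring R QQ UP2_const"
proof -
  have "(\<lambda>p. monom QQ p 0) \<circ> (\<lambda>s. monom PP s 0) \<in> ring_hom R QQ"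
    using P.const_ring_hom Q.const_ring_hom by (rule ring_hom_trans)
  then show ?thesis
    by (intro ring_hom_cringI) (auto simp: UP2_const_def o_def is_cring Q.UP_cring)
qed

lemma coeff2_eqI:
  assumes "p \<in> carrier QQ" "q \<in> carrier QQ" "\<And>j i. coeff2 p j i = coeff2 q j i"
  shows "p = q"
  by (rule Q.up_eqI[OF _ assms(1,2)], rule P.up_eqI) (use assms in \<open>auto simp: coeff2_def\<close>)

lemma coeff2_add: "\<lbrakk>p \<in> carrier QQ; q \<in> carrier QQ\<rbrakk> \<Longrightarrow> coeff2 (p \<oplus>\<^bsub>QQ\<^esub> q) j i = coeff2 p j i \<oplus> coeff2 q j i"
  by (simp add: coeff2_def)

lemma coeff2_sum:
  "\<lbrakk>finite A; \<And>n. n \<in> A \<Longrightarrow> f n \<in> carrier QQ\<rbrakk> \<Longrightarrow> coeff2 (finsum QQ f A) j i = (\<Oplus>n\<in>A. coeff2 (f n) j i)"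
  by (simp add: coeff2_def Q.coeff_finsum P.coeff_finsum Pi_def)

lemma coeff2_const_mult: "\<lbrakk>s \<in> carrier R; q \<in> carrier QQ\<rbrakk> \<Longrightarrow> coeff2 (UP2_const s \<otimes>\<^bsub>QQ\<^esub> q) j i = s \<otimes> coeff2 q j i"
  by (simp add: coeff2_def UP2_const_def Q.coeff_const_mult P.coeff_const_mult del: Q.coeff_mult P.coeff_mult)

lemma coeff2_one: "coeff2 \<one>\<^bsub>QQ\<^esub> j i = (if j = 0 \<and> i = 0 then \<one> else \<zero>)"
  by (simp add: coeff2_def)

lemma coeff2_mult_x: "q \<in> carrier QQ \<Longrightarrow> coeff2 (q \<otimes>\<^bsub>QQ\<^esub> UP2_x) j i = (if i = 0 then \<zero> else coeff2 q j (i - 1))"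
  unfolding coeff2_def UP2_x_def
  by (subst Q.m_comm) (simp_all add: Q.coeff_const_mult P.m_comm[of "monom _ _ _"] P.coeff_mult_X del: Q.coeff_mult P.coeff_mult One_nat_def)

lemma coeff2_mult_y: "q \<in> carrier QQ \<Longrightarrow> coeff2 (q \<otimes>\<^bsub>QQ\<^esub> UP2_y) j i = (if j = 0 then \<zero> else coeff2 q (j - 1) i)"
  unfolding coeff2_def UP2_y_def
  by (simp add: Q.coeff_mult_X del: Q.coeff_mult One_nat_def)

lemma coeff2_pow_x: "coeff2 (UP2_x [^]\<^bsub>QQ\<^esub> n) j i = (if j = 0 \<and> i = n then \<one> else \<zero>)"
  by (induction n arbitrary: i) (auto simp: coeff2_one coeff2_mult_x)

lemma coeff2_pow_y: "coeff2 (UP2_y [^]\<^bsub>QQ\<^esub> n) j i = (if j = n \<and> i = 0 then \<one> else \<zero>)"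
  by (induction n arbitrary: j) (auto simp: coeff2_one coeff2_mult_y)

text \<open>The binomial theorem. Multiplication by x shifts i and multiplication by x' shifts j, so
  the induction step is Pascal's rule.\<close>

lemma coeff2_pow_xy: "coeff2 ((UP2_x \<oplus>\<^bsub>QQ\<^esub> UP2_y) [^]\<^bsub>QQ\<^esub> n) j i = (if i + j = n then [(n choose i)] \<cdot> \<one> else \<zero>)"
proof (induction n arbitrary: i j)
  case (Suc n)
  have "coeff2 ((UP2_x \<oplus>\<^bsub>QQ\<^esub> UP2_y) [^]\<^bsub>QQ\<^esub> Suc n) j i =
      (if i = 0 then \<zero> else coeff2 ((UP2_x \<oplus>\<^bsub>QQ\<^esub> UP2_y) [^]\<^bsub>QQ\<^esub> n) j (i - 1)) \<oplus>
      (if j = 0 then \<zero> else coeff2 ((UP2_x \<oplus>\<^bsub>QQ\<^esub> UP2_y) [^]\<^bsub>QQ\<^esub> n) (j - 1) i)"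
    by (simp add: Q.r_distr coeff2_add coeff2_mult_x coeff2_mult_y)
  then show ?case
    by (cases i; cases j) (auto simp: Suc.IH add.nat_pow_mult add.m_comm)
qed (auto simp: coeff2_one)

lemma coeff2_eval:
  assumes "\<mu> \<in> carrier PP" "q \<in> carrier QQ"
  shows "coeff2 (eval R QQ UP2_const q \<mu>) j i = (\<Oplus>n\<in>{..deg R \<mu>}. \<mu> n \<otimes> coeff2 (q [^]\<^bsub>QQ\<^esub> n) j i)"
proof -
  have \<mu>: "\<mu> n \<in> carrier R" for n
    using assms(1) by (simp add: carrier_UP_iff)
  show ?thesis
    using assms \<mu> by (simp add: P.eval_on_carrier coeff2_sum P.coeff_eq coeff2_const_mult)
qed

lemma finsum_delta:
  assumes \<mu>: "\<mu> \<in> carrier PP" and c: "c \<in> carrier R"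
  shows "(\<Oplus>n\<in>{..deg R \<mu>}. \<mu> n \<otimes> (if k = n then c else \<zero>)) = \<mu> k \<otimes> c"
proof -
  have \<mu>c: "\<mu> n \<in> carrier R" for n
    using \<mu> by (simp add: carrier_UP_iff)
  have "\<mu> k = \<zero>" if "\<not> k \<le> deg R \<mu>"
    using P.deg_aboveD[of \<mu> k] that \<mu> by (simp add: P.coeff_eq)
  moreover have "(\<Oplus>n\<in>{..deg R \<mu>}. \<mu> n \<otimes> (if k = n then c else \<zero>)) = (\<Oplus>n\<in>{..deg R \<mu>}. if k = n then \<mu> n \<otimes> c else \<zero>)"
    using \<mu>c c by (intro finsum_cong') auto
  moreover have "\<dots> = (if k \<le> deg R \<mu> then \<mu> k \<otimes> c else \<zero>)"
  proof (cases "k \<le> deg R \<mu>")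
    case True
    then show ?thesis using \<mu>c c by (simp add: finsum_singleton)
  next
    case False
    then have "(\<Oplus>n\<in>{..deg R \<mu>}. if k = n then \<mu> n \<otimes> c else \<zero>) = (\<Oplus>n\<in>{..deg R \<mu>}. \<zero>)"
      by (intro finsum_cong') auto
    then show ?thesis using False by simp
  qed
  ultimately show ?thesis using c by auto
qed

text \<open>Compare coefficients of x^i x'^j. In \<mu>(x + x') only the power n = i + j contributes,
  with a binomial coefficient; in \<mu>(x) \<mu>(x') the coefficient is \<mu>_i \<mu>_j.\<close>

lemma additive_chars_iff: "\<mu> \<in> additive_chars R \<longleftrightarrow> dp_seq \<mu>"
proof (cases "\<mu> \<in> carrier PP")
  case \<mu>: True
  have \<mu>c: "\<mu> n \<in> carrier R" for n
    using \<mu> by (simp add: carrier_UP_iff)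
  note h = UP_pre_univ_prop.eval_ring_hom[OF UP_pre_univ_prop.intro[OF UP2_const_hom P.UP_cring_axioms]]
  have ev: "eval R QQ UP2_const q \<mu> \<in> carrier QQ" if "q \<in> carrier QQ" for q
    using ring_hom_closed[OF h[OF that] \<mu>] .
  have "eval R R (\<lambda>s. s) \<zero> \<mu> = (\<Oplus>n\<in>{..deg R \<mu>}. \<mu> n \<otimes> (if 0 = n then \<one> else \<zero>))"
    using \<mu> \<mu>c by (auto simp: P.eval_on_carrier P.coeff_eq nat_pow_zero intro!: finsum_cong')
  also have "\<dots> = \<mu> 0"
    using finsum_delta[OF \<mu> one_closed, of 0] \<mu>c by (simp del: finsum_0)
  finally have e0: "eval R R (\<lambda>s. s) \<zero> \<mu> = \<mu> 0" .
  have exy: "coeff2 (eval R QQ UP2_const (UP2_x \<oplus>\<^bsub>QQ\<^esub> UP2_y) \<mu>) j i = [((i + j) choose i)] \<cdot> \<mu> (i + j)" for i j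
  proof -
    have "coeff2 (eval R QQ UP2_const (UP2_x \<oplus>\<^bsub>QQ\<^esub> UP2_y) \<mu>) j i =
        (\<Oplus>n\<in>{..deg R \<mu>}. \<mu> n \<otimes> (if i + j = n then [((i + j) choose i)] \<cdot> \<one> else \<zero>))"
      using \<mu> \<mu>c by (auto simp: coeff2_eval coeff2_pow_xy intro!: finsum_cong')
    also have "\<dots> = [((i + j) choose i)] \<cdot> \<mu> (i + j)"
      using \<mu> \<mu>c by (simp add: finsum_delta add_pow_rdistr)
    finally show ?thesis .
  qed
  have ey: "coeff QQ (eval R QQ UP2_const UP2_y \<mu>) j = monom PP (\<mu> j) 0" for j
  proof (rule P.up_eqI)
    fix i
    have "coeff2 (eval R QQ UP2_const UP2_y \<mu>) j i = (\<Oplus>n\<in>{..deg R \<mu>}. \<mu> n \<otimes> (if j = n then if i = 0 then \<one> else \<zero> else \<zero>))"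
      using \<mu> \<mu>c by (auto simp: coeff2_eval coeff2_pow_y intro!: finsum_cong')
    also have "\<dots> = (if i = 0 then \<mu> j else \<zero>)"
      using \<mu> \<mu>c by (simp add: finsum_delta)
    finally show "coeff PP (coeff QQ (eval R QQ UP2_const UP2_y \<mu>) j) i = coeff PP (monom PP (\<mu> j) 0) i"
      using \<mu>c by (simp add: coeff2_def)
  qed (use ev \<mu>c in auto)
  have ex: "eval R QQ UP2_const UP2_x \<mu> = monom QQ \<mu> 0"
  proof (rule coeff2_eqI)
    fix j i
    have "coeff2 (eval R QQ UP2_const UP2_x \<mu>) j i = (\<Oplus>n\<in>{..deg R \<mu>}. \<mu> n \<otimes> (if i = n then if j = 0 then \<one> else \<zero> else \<zero>))"
      using \<mu> \<mu>c by (auto simp: coeff2_eval coeff2_pow_x intro!: finsum_cong')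
    also have "\<dots> = (if j = 0 then \<mu> i else \<zero>)"
      using \<mu> \<mu>c by (simp add: finsum_delta)
    finally show "coeff2 (eval R QQ UP2_const UP2_x \<mu>) j i = coeff2 (monom QQ \<mu> 0) j i"
      using \<mu> P.coeff_zero[of i] by (simp add: coeff2_def P.coeff_eq)
  qed (use ev \<mu> in auto)
  \<comment> \<open>\<mu>(x) is constant in the outer variable and the coefficients of \<mu>(x') are
    constant in the inner one, so no convolution arises.\<close>
  have exey: "coeff2 (eval R QQ UP2_const UP2_x \<mu> \<otimes>\<^bsub>QQ\<^esub> eval R QQ UP2_const UP2_y \<mu>) j i = \<mu> i \<otimes> \<mu> j" for i j
  proof -
    have "coeff2 (eval R QQ UP2_const UP2_x \<mu> \<otimes>\<^bsub>QQ\<^esub> eval R QQ UP2_const UP2_y \<mu>) j i = coeff PP (\<mu> \<otimes>\<^bsub>PP\<^esub> monom PP (\<mu> j) 0) i"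
      using \<mu> ev by (simp add: ex coeff2_def Q.coeff_const_mult ey del: Q.coeff_mult P.coeff_mult)
    also have "\<dots> = \<mu> j \<otimes> \<mu> i"
      using \<mu> \<mu>c P.coeff_const_mult[of "\<mu> j" \<mu> i] by (subst P.m_comm) (simp_all add: P.coeff_eq)
    finally show ?thesis using \<mu>c by (simp add: m_comm)
  qed
  have "eval R QQ UP2_const (UP2_x \<oplus>\<^bsub>QQ\<^esub> UP2_y) \<mu> = eval R QQ UP2_const UP2_x \<mu> \<otimes>\<^bsub>QQ\<^esub> eval R QQ UP2_const UP2_y \<mu> \<longleftrightarrow>
     (\<forall>i j. \<mu> i \<otimes> \<mu> j = [((i + j) choose i)] \<cdot> \<mu> (i + j))"
  proof
    assume "eval R QQ UP2_const (UP2_x \<oplus>\<^bsub>QQ\<^esub> UP2_y) \<mu> = eval R QQ UP2_const UP2_x \<mu> \<otimes>\<^bsub>QQ\<^esub> eval R QQ UP2_const UP2_y \<mu>"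
    then show "\<forall>i j. \<mu> i \<otimes> \<mu> j = [((i + j) choose i)] \<cdot> \<mu> (i + j)"
      using exy exey by metis
  next
    assume "\<forall>i j. \<mu> i \<otimes> \<mu> j = [((i + j) choose i)] \<cdot> \<mu> (i + j)"
    then show "eval R QQ UP2_const (UP2_x \<oplus>\<^bsub>QQ\<^esub> UP2_y) \<mu> = eval R QQ UP2_const UP2_x \<mu> \<otimes>\<^bsub>QQ\<^esub> eval R QQ UP2_const UP2_y \<mu>"
      by (intro coeff2_eqI) (auto simp: ev exy exey)
  qed
  then show ?thesis
    by (simp add: additive_chars_alt dp_seq_def e0 \<mu>)
qed (auto simp: additive_chars_alt dp_seq_def)

text \<open>Evaluations are ring homomorphisms, so both sides of the functional equation are
  multiplicative in \<mu>. The coefficient form would require a binomial identity here.\<close>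

lemma additive_chars_mult:
  assumes "\<mu> \<in> additive_chars R" "\<nu> \<in> additive_chars R"
  shows "\<mu> \<otimes>\<^bsub>PP\<^esub> \<nu> \<in> additive_chars R"
proof -
  note h = UP_pre_univ_prop.eval_ring_hom[OF UP_pre_univ_prop.intro[OF UP2_const_hom P.UP_cring_axioms]]
  have "ring_hom_cring R R (\<lambda>s. s)"
    by (rule ring_hom_cringI) (auto simp: is_cring ring_hom_def)
  note h0 = UP_pre_univ_prop.eval_ring_hom[OF UP_pre_univ_prop.intro[OF this P.UP_cring_axioms]]
  note m = ring_hom_mult[OF h] ring_hom_mult[OF h0]
  have c: "\<mu> \<in> carrier PP" "\<nu> \<in> carrier PP"
    using assms by (auto simp: additive_chars_alt)
  note ev = ring_hom_closed[OF h[OF xy_closed(1)]] ring_hom_closed[OF h[OF xy_closed(2)]]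
  show ?thesis
    using assms c ev by (simp add: additive_chars_alt m Q.m_ac)
qed

lemma additive_chars_one: "\<one>\<^bsub>PP\<^esub> \<in> additive_chars R"
  by (auto simp: additive_chars_iff dp_seq_def) (auto simp: UP_def)

end

section \<open>Derivatives of functions along a vector field\<close>

lemma hom_over_closed:
  assumes "a \<in> hom_over K R X Y" "T \<in> algs K" "\<phi> \<in> alg_hom K R T" "x \<in> Ob X T"
  shows "a (T, \<phi>) x \<in> Ob Y T"
proof -
  have "(T, \<phi>) \<in> coslice K R"
    using assms by (simp add: coslice_iff)
  then have "a (T, \<phi>) \<in> Ob X T \<rightarrow>\<^sub>E Ob Y T"
    using assms(1) by (force simp: hom_over_def PiE_def Pi_def)
  then show ?thesis
    using assms(4) by auto
qed

lemma hom_over_natural: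
  assumes "a \<in> hom_over K R X Y" "T \<in> algs K" "\<phi> \<in> alg_hom K R T" "x \<in> Ob X T"
    and "T' \<in> algs K" "\<psi> \<in> alg_hom K T T'"
  shows "a (T', compose (carrier R) \<psi> \<phi>) (Mor X T T' \<psi> x) = Mor Y T T' \<psi> (a (T, \<phi>) x)"
proof -
  have "(T, \<phi>) \<in> coslice K R"
    using assms by (simp add: coslice_iff)
  then show ?thesis
    using assms unfolding hom_over_def by fast
qed

lemma hom_overI:
  assumes "\<And>T \<phi> x. \<lbrakk>T \<in> algs K; \<phi> \<in> alg_hom K R T; x \<in> Ob X T\<rbrakk> \<Longrightarrow> f T \<phi> x \<in> Ob Y T"
    and "\<And>T \<phi> x T' \<psi>. \<lbrakk>T \<in> algs K; \<phi> \<in> alg_hom K R T; x \<in> Ob X T; T' \<in> algs K; \<psi> \<in> alg_hom K T T'\<rbrakk> \<Longrightarrow>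
      f T' (compose (carrier R) \<psi> \<phi>) (Mor X T T' \<psi> x) = Mor Y T T' \<psi> (f T \<phi> x)"
    and X: "set_functor K X" and R: "algebra K R"
  shows "(\<lambda>(T, \<phi>)\<in>coslice K R. \<lambda>x\<in>Ob X T. f T \<phi> x) \<in> hom_over K R X Y"
proof -
  have "Mor X T T' \<psi> x \<in> Ob X T'" if "T \<in> algs K" "T' \<in> algs K" "\<psi> \<in> alg_hom K T T'" "x \<in> Ob X T" for T T' \<psi> x
    using X that by (auto simp: set_functor_def Pi_def)
  note * = this
  have "(\<lambda>(T, \<phi>)\<in>coslice K R. \<lambda>x\<in>Ob X T. f T \<phi> x) (T', compose (carrier R) \<psi> \<phi>) (Mor X T T' \<psi> x) =
      Mor Y T T' \<psi> ((\<lambda>(T, \<phi>)\<in>coslice K R. \<lambda>x\<in>Ob X T. f T \<phi> x) (T, \<phi>) x)"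
    if "(T, \<phi>) \<in> coslice K R" "T' \<in> algs K" "\<psi> \<in> alg_hom K T T'" "x \<in> Ob X T" for T \<phi> T' \<psi> x
    using that assms(2) * alg_hom_compose[of \<phi> K R T \<psi> T', OF _ _ R] by (simp add: coslice_iff)
  then show ?thesis
    using assms(1) by (auto simp: hom_over_def coslice_iff)
qed

lemma hom_over_eqI:
  assumes "a \<in> hom_over K R X Y" "b \<in> hom_over K R X Y"
    and "\<And>T \<phi> x. \<lbrakk>T \<in> algs K; \<phi> \<in> alg_hom K R T; x \<in> Ob X T\<rbrakk> \<Longrightarrow> a (T, \<phi>) x = b (T, \<phi>) x"
  shows "a = b"
proof (rule PiE_ext)
  show "a \<in> (\<Pi>\<^sub>E (T, \<phi>)\<in>coslice K R. Ob X T \<rightarrow>\<^sub>E Ob Y T)" "b \<in> (\<Pi>\<^sub>E (T, \<phi>)\<in>coslice K R. Ob X T \<rightarrow>\<^sub>E Ob Y T)"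
    using assms(1,2) by (auto simp: hom_over_def)
  fix p assume p: "p \<in> coslice K R"
  obtain T \<phi> where [simp]: "p = (T, \<phi>)" by (cases p)
  have "a p \<in> Ob X T \<rightarrow>\<^sub>E Ob Y T" "b p \<in> Ob X T \<rightarrow>\<^sub>E Ob Y T"
    using assms(1,2) p by (force simp: hom_over_def PiE_def Pi_def)+
  then show "a p = b p"
    using assms(3) p by (auto simp: coslice_iff intro!: PiE_ext[of _ "Ob X T"])
qed

definition restr_fun ::
  "('u, 'm) ring_scheme \<Rightarrow> ('u, 'x set, 'x) kfunctor \<Rightarrow> ('u, 'u) module \<Rightarrow>
     (('u, 'u) module \<Rightarrow> ('u \<Rightarrow> 'u) \<Rightarrow> 'x \<Rightarrow> 'u) \<Rightarrow> ('u, 'x) fam" where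
  "restr_fun K X R f = (\<lambda>(T, \<phi>)\<in>coslice K R. \<lambda>x\<in>Ob X T. f T \<phi> x)"

lemma restr_fun_apply [simp]:
  "\<lbrakk>T \<in> algs K; \<phi> \<in> alg_hom K R T; x \<in> Ob X T\<rbrakk> \<Longrightarrow> restr_fun K X R f (T, \<phi>) x = f T \<phi> x"
  by (simp add: restr_fun_def coslice_iff)

lemma scalars_simps [simp]: "Ob scalars T = carrier T" "Mor scalars T T' \<psi> = \<psi>"
  by (simp_all add: scalars_def)

lemma set_functor_closed:
  "\<lbrakk>set_functor K X; S \<in> algs K; T \<in> algs K; \<phi> \<in> alg_hom K S T; x \<in> Ob X S\<rbrakk> \<Longrightarrow> Mor X S T \<phi> x \<in> Ob X T"
  by (auto simp: set_functor_def Pi_def)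

lemma set_functor_id: "\<lbrakk>set_functor K X; S \<in> algs K; x \<in> Ob X S\<rbrakk> \<Longrightarrow> Mor X S S (\<lambda>s\<in>carrier S. s) x = x"
  by (auto simp: set_functor_def)

lemma set_functor_compose:
  "\<lbrakk>set_functor K X; R \<in> algs K; S \<in> algs K; T \<in> algs K; \<phi> \<in> alg_hom K R S; \<psi> \<in> alg_hom K S T; x \<in> Ob X R\<rbrakk> \<Longrightarrow>
    Mor X S T \<psi> (Mor X R S \<phi> x) = Mor X R T (compose (carrier R) \<psi> \<phi>) x"
  by (auto simp: set_functor_def)

text \<open>The extensionality built into \<open>vector_fields\<close> is dropped, so that the
  explicit fields \<open>Ga_field\<close> and \<open>inv_field v\<close>, the latter also on a
  subfunctor, are instances.\<close>

locale vector_field = universe K for K :: "('u, 'm) ring_scheme" +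
  fixes X :: "('u, 'x set, 'x) kfunctor" and V :: "('u, 'u) module \<Rightarrow> 'x \<Rightarrow> 'x"
  assumes X: "set_functor K X"
    and V_closed: "\<And>S x. \<lbrakk>S \<in> algs K; x \<in> Ob X S\<rbrakk> \<Longrightarrow> V S x \<in> Ob X (dual_num S)"
    and V_proj: "\<And>S x. \<lbrakk>S \<in> algs K; x \<in> Ob X S\<rbrakk> \<Longrightarrow> Mor X (dual_num S) S (dual_proj S) (V S x) = x"
    and V_natural: "\<And>S T \<phi> x. \<lbrakk>S \<in> algs K; T \<in> algs K; \<phi> \<in> alg_hom K S T; x \<in> Ob X S\<rbrakk> \<Longrightarrow>
      Mor X (dual_num S) (dual_num T) (dual_map S T \<phi>) (V S x) = V T (Mor X S T \<phi> x)"
begin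

lemmas X_closed = set_functor_closed[OF X]
lemmas X_compose = set_functor_compose[OF X]

abbreviation "F R \<equiv> hom_over K R X scalars"

text \<open>The value of \<open>a\<close> at \<open>V x\<close> is \<open>a(x) + \<epsilon> (der a)(x)\<close>.\<close>

definition der :: "('u, 'u) module \<Rightarrow> ('u, 'x) fam \<Rightarrow> ('u, 'x) fam" where
  "der R a = restr_fun K X R
     (\<lambda>T \<phi> x. snd (un_dual T (a (dual_num T, compose (carrier R) (dual_incl T) \<phi>) (V T x))))"

context
  fixes R :: "('u, 'u) module"
  assumes R: "R \<in> algs K"
begin

lemma F_closed: "\<lbrakk>a \<in> F R; T \<in> algs K; \<phi> \<in> alg_hom K R T; x \<in> Ob X T\<rbrakk> \<Longrightarrow> a (T, \<phi>) x \<in> carrier T"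
  using hom_over_closed[of a K R X scalars] by simp

lemma F_natural:
  "\<lbrakk>a \<in> F R; T \<in> algs K; \<phi> \<in> alg_hom K R T; x \<in> Ob X T; T' \<in> algs K; \<psi> \<in> alg_hom K T T'\<rbrakk> \<Longrightarrow>
    a (T', compose (carrier R) \<psi> \<phi>) (Mor X T T' \<psi> x) = \<psi> (a (T, \<phi>) x)"
  using hom_over_natural[of a K R X scalars] by simp

lemma restr_fun_F:
  assumes "\<And>T \<phi> x. \<lbrakk>T \<in> algs K; \<phi> \<in> alg_hom K R T; x \<in> Ob X T\<rbrakk> \<Longrightarrow> f T \<phi> x \<in> carrier T"
    and "\<And>T \<phi> x T' \<psi>. \<lbrakk>T \<in> algs K; \<phi> \<in> alg_hom K R T; x \<in> Ob X T; T' \<in> algs K; \<psi> \<in> alg_hom K T T'\<rbrakk> \<Longrightarrow>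
      f T' (compose (carrier R) \<psi> \<phi>) (Mor X T T' \<psi> x) = \<psi> (f T \<phi> x)"
  shows "restr_fun K X R f \<in> F R"
  unfolding restr_fun_def using assms by (intro hom_overI) (auto simp: X algsD[OF R])

lemma compose_incl:
  assumes T: "T \<in> algs K" and \<phi>: "\<phi> \<in> alg_hom K R T"
  shows "compose (carrier R) (dual_incl T) \<phi> \<in> alg_hom K R (dual_num T)"
    and "compose (carrier R) (dual_proj T) (compose (carrier R) (dual_incl T) \<phi>) = \<phi>"
proof -
  show "compose (carrier R) (dual_incl T) \<phi> \<in> alg_hom K R (dual_num T)"
    by (rule alg_hom_compose[OF \<phi> dual_incl_alg_hom[OF T] algsD[OF R]])
  show "compose (carrier R) (dual_proj T) (compose (carrier R) (dual_incl T) \<phi>) = \<phi>"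
    by (simp add: compose_alg_hom_assoc[OF \<phi>, symmetric] dual_proj_incl[OF T] compose_id_alg_hom[OF \<phi>])
qed

text \<open>The projection \<epsilon> \<mapsto> 0 brings V x back to x, so naturality of a fixes the
  first component. The second is \<open>der\<close> by definition.\<close>

lemma apply_V:
  assumes a: "a \<in> F R" and T: "T \<in> algs K" and \<phi>: "\<phi> \<in> alg_hom K R T" and x: "x \<in> Ob X T"
  shows "a (dual_num T, compose (carrier R) (dual_incl T) \<phi>) (V T x) = mk_dual T (a (T, \<phi>) x) (der R a (T, \<phi>) x)"
    and "der R a (T, \<phi>) x \<in> carrier T"
proof -
  let ?z = "a (dual_num T, compose (carrier R) (dual_incl T) \<phi>) (V T x)"
  have z: "?z \<in> carrier (dual_num T)"
    by (rule F_closed[OF a dual_num_algs[OF T] compose_incl(1)[OF T \<phi>] V_closed[OF T x]])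
  have "dual_proj T ?z = a (T, \<phi>) x"
    using F_natural[OF a dual_num_algs[OF T] compose_incl(1)[OF T \<phi>] V_closed[OF T x] T dual_proj_alg_hom[OF T]]
    by (simp add: compose_incl(2)[OF T \<phi>] V_proj[OF T x])
  then have "fst (un_dual T ?z) = a (T, \<phi>) x"
    using z by (simp add: dual_proj_def)
  then show "?z = mk_dual T (a (T, \<phi>) x) (der R a (T, \<phi>) x)"
    using mk_un_dual[OF T z] T \<phi> x by (simp add: der_def)
  show "der R a (T, \<phi>) x \<in> carrier T"
    using un_dual_closed[OF T z] T \<phi> x by (simp add: der_def)
qed

text \<open>A morphism \<psi> extended to dual numbers commutes with the inclusions of coefficients
  and carries V x to V of the image of x; naturality of a does the rest.\<close>

lemma der_closed: assumes a: "a \<in> F R" shows "der R a \<in> F R"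
  unfolding der_def
proof (rule restr_fun_F)
  fix T \<phi> x
  assume T: "T \<in> algs K" and \<phi>: "\<phi> \<in> alg_hom K R T" and x: "x \<in> Ob X T"
  have z: "a (dual_num T, compose (carrier R) (dual_incl T) \<phi>) (V T x) \<in> carrier (dual_num T)"
    by (rule F_closed[OF a dual_num_algs[OF T] compose_incl(1)[OF T \<phi>] V_closed[OF T x]])
  then show "snd (un_dual T (a (dual_num T, compose (carrier R) (dual_incl T) \<phi>) (V T x))) \<in> carrier T"
    by (rule un_dual_closed[OF T])
  fix T' \<psi> assume T': "T' \<in> algs K" and \<psi>: "\<psi> \<in> alg_hom K T T'"
  have "compose (carrier R) (dual_map T T' \<psi>) (compose (carrier R) (dual_incl T) \<phi>) =
      compose (carrier R) (dual_incl T') (compose (carrier R) \<psi> \<phi>)"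
    by (simp add: compose_alg_hom_assoc[OF \<phi>, symmetric] dual_map_incl[OF T T' \<psi>])
  then have "a (dual_num T', compose (carrier R) (dual_incl T') (compose (carrier R) \<psi> \<phi>)) (V T' (Mor X T T' \<psi> x)) =
      dual_map T T' \<psi> (a (dual_num T, compose (carrier R) (dual_incl T) \<phi>) (V T x))"
    using F_natural[OF a dual_num_algs[OF T] compose_incl(1)[OF T \<phi>] V_closed[OF T x] dual_num_algs[OF T']
        dual_map_alg_hom[OF T T' \<psi>]]
    by (simp add: V_natural[OF T T' \<psi> x])
  then show "snd (un_dual T' (a (dual_num T', compose (carrier R) (dual_incl T') (compose (carrier R) \<psi> \<phi>)) (V T' (Mor X T T' \<psi> x)))) =
      \<psi> (snd (un_dual T (a (dual_num T, compose (carrier R) (dual_incl T) \<phi>) (V T x))))"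
    using z un_dual_closed[OF T z] by (simp add: dual_map_def alg_hom_closed[OF \<psi>])
qed

lemma der_pow_closed: "a \<in> F R \<Longrightarrow> (der R ^^ n) a \<in> F R"
  by (induction n) (auto simp: der_closed)

text \<open>First order Taylor expansion along an arbitrary morphism \<psi> out of the dual numbers.
  Such a \<psi> is the dual map of its restriction to S followed by the evaluation of \<epsilon> at
  \<psi>(\<epsilon>), an element of square zero, and the dual map only moves the base point.\<close>

lemma eval_V:
  assumes a: "a \<in> F R" and S: "S \<in> algs K" and x: "x \<in> Ob X S"
    and T: "T \<in> algs K" and \<phi>: "\<phi> \<in> alg_hom K R T" and \<psi>: "\<psi> \<in> alg_hom K (dual_num S) T"
  defines "\<psi>0 \<equiv> compose (carrier S) \<psi> (dual_incl S)"
  shows "a (T, \<phi>) (Mor X (dual_num S) T \<psi> (V S x)) =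
    a (T, \<phi>) (Mor X S T \<psi>0 x) \<oplus>\<^bsub>T\<^esub> der R a (T, \<phi>) (Mor X S T \<psi>0 x) \<otimes>\<^bsub>T\<^esub> \<psi> (eps S)"
proof -
  interpret S: algebra K S using algsD[OF S] .
  interpret T: algebra K T using algsD[OF T] .
  interpret D: algebra K "dual_num S" using algsD[OF dual_num_algs[OF S]] .
  have \<psi>0: "\<psi>0 \<in> alg_hom K S T"
    unfolding \<psi>0_def by (rule alg_hom_compose[OF dual_incl_alg_hom[OF S] \<psi> S.algebra_axioms])
  let ?u = "\<psi> (eps S)"
  have u: "?u \<in> carrier T" "?u \<otimes>\<^bsub>T\<^esub> ?u = \<zero>\<^bsub>T\<^esub>"
    using alg_hom_closed[OF \<psi> eps_closed[OF S]] alg_hom_mult[OF \<psi> eps_closed[OF S] eps_closed[OF S]]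
      alg_hom_zero[OF \<psi>] by (auto simp: eps_square[OF S] D.is_cring T.is_cring)
  let ?id = "\<lambda>t\<in>carrier T. t"
  have id: "?id \<in> alg_hom K T T" by (rule alg_hom_id[OF T.algebra_axioms])
  let ?\<theta> = "dual_eval T T ?id ?u"
  have \<theta>: "?\<theta> \<in> alg_hom K (dual_num T) T"
    by (rule dual_eval_alg_hom[OF T T id u])
  have "compose (carrier (dual_num S)) ?\<theta> (dual_map S T \<psi>0) = \<psi>"
  proof (rule alg_hom_eqI[OF _ \<psi>])
    show "compose (carrier (dual_num S)) ?\<theta> (dual_map S T \<psi>0) \<in> alg_hom K (dual_num S) T"
      by (rule alg_hom_compose[OF dual_map_alg_hom[OF S T \<psi>0] \<theta> D.algebra_axioms])
    fix z assume z: "z \<in> carrier (dual_num S)"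
    then obtain p q where pq: "p \<in> carrier S" "q \<in> carrier S" "z = mk_dual S p q"
      by (auto simp: dual_num_carrier[OF S])
    have "z = dual_incl S p \<oplus>\<^bsub>dual_num S\<^esub> dual_incl S q \<otimes>\<^bsub>dual_num S\<^esub> eps S"
      using pq by (simp add: dual_incl_def eps_def dual_num_simps[OF S])
    then have "\<psi> z = \<psi> (dual_incl S p) \<oplus>\<^bsub>T\<^esub> \<psi> (dual_incl S q) \<otimes>\<^bsub>T\<^esub> ?u"
      using pq eps_closed[OF S] alg_hom_closed[OF dual_incl_alg_hom[OF S]]
      by (simp add: alg_hom_add[OF \<psi>] alg_hom_mult[OF \<psi>])
    then show "compose (carrier (dual_num S)) ?\<theta> (dual_map S T \<psi>0) z = \<psi> z"
      using z pq alg_hom_closed[OF \<psi>0]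
      by (simp add: compose_def dual_map_mk[OF S] dual_eval_mk[OF T]) (simp add: \<psi>0_def compose_def)
  qed
  then have "Mor X (dual_num S) T \<psi> (V S x) = Mor X (dual_num T) T ?\<theta> (V T (Mor X S T \<psi>0 x))"
    by (simp add: V_natural[OF S T \<psi>0 x, symmetric]
        X_compose[OF dual_num_algs[OF S] dual_num_algs[OF T] T dual_map_alg_hom[OF S T \<psi>0] \<theta> V_closed[OF S x]])
  \<comment> \<open>\<open>?\<theta>\<close> restricts to the identity of T, so the structure map
    \<phi> is recovered.\<close>
  moreover have "compose (carrier R) ?\<theta> (compose (carrier R) (dual_incl T) \<phi>) = \<phi>"
  proof (rule alg_hom_eqI[OF _ \<phi>])
    show "compose (carrier R) ?\<theta> (compose (carrier R) (dual_incl T) \<phi>) \<in> alg_hom K R T"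
      by (rule alg_hom_compose[OF compose_incl(1)[OF T \<phi>] \<theta> algsD[OF R]])
    fix z assume "z \<in> carrier R"
    then show "compose (carrier R) ?\<theta> (compose (carrier R) (dual_incl T) \<phi>) z = \<phi> z"
      using alg_hom_closed[OF \<phi>] u by (simp add: compose_def dual_incl_def dual_eval_mk[OF T])
  qed
  moreover have x0: "Mor X S T \<psi>0 x \<in> Ob X T"
    by (rule X_closed[OF S T \<psi>0 x])
  ultimately have "a (T, \<phi>) (Mor X (dual_num S) T \<psi> (V S x)) =
      ?\<theta> (a (dual_num T, compose (carrier R) (dual_incl T) \<phi>) (V T (Mor X S T \<psi>0 x)))"
    using F_natural[OF a dual_num_algs[OF T] compose_incl(1)[OF T \<phi>] V_closed[OF T x0] T \<theta>] by simp
  then show ?thesis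
    using apply_V[OF a T \<phi> x0] F_closed[OF a T \<phi> x0] by (simp add: dual_eval_mk[OF T])
qed

section \<open>The algebra of functions and the Leibniz rule\<close>

abbreviation "FA \<equiv> pointwise K R X (F R)"

lemma FA_closed:
  assumes a: "a \<in> F R" and b: "b \<in> F R"
  shows "a \<otimes>\<^bsub>FA\<^esub> b \<in> F R" "a \<oplus>\<^bsub>FA\<^esub> b \<in> F R" "r \<in> carrier R \<Longrightarrow> r \<odot>\<^bsub>FA\<^esub> a \<in> F R"
proof -
  note c = F_closed[OF a] F_closed[OF b] and n = F_natural[OF a] F_natural[OF b]
  have m: "monoid T" "abelian_monoid T" if "T \<in> algs K" for T
    using algs_cring[OF that] by (auto simp: cring_def ring_def comm_monoid_def abelian_group_def)
  show "a \<otimes>\<^bsub>FA\<^esub> b \<in> F R"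
    unfolding pointwise_def monoid.simps restr_fun_def[symmetric]
    by (rule restr_fun_F) (simp_all add: c n alg_hom_mult monoid.m_closed m)
  show "a \<oplus>\<^bsub>FA\<^esub> b \<in> F R"
    unfolding pointwise_def ring.simps restr_fun_def[symmetric]
    by (rule restr_fun_F) (simp_all add: c n alg_hom_add abelian_monoid.a_closed m)
  assume r: "r \<in> carrier R"
  show "r \<odot>\<^bsub>FA\<^esub> a \<in> F R"
    unfolding pointwise_def module.simps restr_fun_def[symmetric]
    by (rule restr_fun_F) (simp_all add: r c n alg_hom_mult alg_hom_closed compose_eq_on monoid.m_closed m)
qed

lemma FA_one_closed: "\<one>\<^bsub>FA\<^esub> \<in> F R"
proof -
  have m: "monoid T" if "T \<in> algs K" for T
    using algs_cring[OF that] by (auto simp: cring_def comm_monoid_def)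
  show ?thesis
    unfolding pointwise_def monoid.simps restr_fun_def[symmetric]
    by (rule restr_fun_F) (simp_all add: alg_hom_one monoid.one_closed m)
qed

lemma FA_apply:
  assumes "T \<in> algs K" "\<phi> \<in> alg_hom K R T" "x \<in> Ob X T"
  shows "(a \<otimes>\<^bsub>FA\<^esub> b) (T, \<phi>) x = a (T, \<phi>) x \<otimes>\<^bsub>T\<^esub> b (T, \<phi>) x"
    and "(a \<oplus>\<^bsub>FA\<^esub> b) (T, \<phi>) x = a (T, \<phi>) x \<oplus>\<^bsub>T\<^esub> b (T, \<phi>) x"
    and "(r \<odot>\<^bsub>FA\<^esub> a) (T, \<phi>) x = \<phi> r \<otimes>\<^bsub>T\<^esub> a (T, \<phi>) x"
    and "\<one>\<^bsub>FA\<^esub> (T, \<phi>) x = \<one>\<^bsub>T\<^esub>"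
  using assms by (auto simp: pointwise_def coslice_iff)

text \<open>These are the \<epsilon>-components of sums, products and scalar multiples in the dual
  numbers. A scalar r enters through the inclusion of coefficients and so has no
  \<epsilon>-component.\<close>

lemma
  assumes a: "a \<in> F R" and b: "b \<in> F R"
  shows der_mult: "der R (a \<otimes>\<^bsub>FA\<^esub> b) = (der R a \<otimes>\<^bsub>FA\<^esub> b) \<oplus>\<^bsub>FA\<^esub> (a \<otimes>\<^bsub>FA\<^esub> der R b)"
    and der_add: "der R (a \<oplus>\<^bsub>FA\<^esub> b) = der R a \<oplus>\<^bsub>FA\<^esub> der R b"
    and der_smult: "r \<in> carrier R \<Longrightarrow> der R (r \<odot>\<^bsub>FA\<^esub> a) = r \<odot>\<^bsub>FA\<^esub> der R a"
proof -
  have *: "der R c (T, \<phi>) x = snd (un_dual T (c (dual_num T, compose (carrier R) (dual_incl T) \<phi>) (V T x)))"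
    if "T \<in> algs K" "\<phi> \<in> alg_hom K R T" "x \<in> Ob X T" for c T \<phi> x
    using that by (simp add: der_def)
  note cl = FA_closed der_closed a b
  note ap = FA_apply[OF dual_num_algs compose_incl(1) V_closed] FA_apply apply_V[OF a] apply_V[OF b]
    F_closed[OF a] F_closed[OF b]
  show "der R (a \<otimes>\<^bsub>FA\<^esub> b) = (der R a \<otimes>\<^bsub>FA\<^esub> b) \<oplus>\<^bsub>FA\<^esub> (a \<otimes>\<^bsub>FA\<^esub> der R b)"
  proof (rule hom_over_eqI)
    fix T \<phi> x assume T: "T \<in> algs K" and \<phi>: "\<phi> \<in> alg_hom K R T" and x: "x \<in> Ob X T"
    interpret T: algebra K T using algsD[OF T] .
    show "der R (a \<otimes>\<^bsub>FA\<^esub> b) (T, \<phi>) x = ((der R a \<otimes>\<^bsub>FA\<^esub> b) \<oplus>\<^bsub>FA\<^esub> (a \<otimes>\<^bsub>FA\<^esub> der R b)) (T, \<phi>) x"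
      by (subst *) (simp_all add: T \<phi> x ap dual_num_mult T.a_ac)
  qed (auto intro!: cl)
  show "der R (a \<oplus>\<^bsub>FA\<^esub> b) = der R a \<oplus>\<^bsub>FA\<^esub> der R b"
  proof (rule hom_over_eqI)
    fix T \<phi> x assume T: "T \<in> algs K" and \<phi>: "\<phi> \<in> alg_hom K R T" and x: "x \<in> Ob X T"
    interpret T: algebra K T using algsD[OF T] .
    show "der R (a \<oplus>\<^bsub>FA\<^esub> b) (T, \<phi>) x = (der R a \<oplus>\<^bsub>FA\<^esub> der R b) (T, \<phi>) x"
      by (subst *) (simp_all add: T \<phi> x ap dual_num_add)
  qed (auto intro!: cl)
  assume r: "r \<in> carrier R"
  show "der R (r \<odot>\<^bsub>FA\<^esub> a) = r \<odot>\<^bsub>FA\<^esub> der R a"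
  proof (rule hom_over_eqI)
    fix T \<phi> x assume T: "T \<in> algs K" and \<phi>: "\<phi> \<in> alg_hom K R T" and x: "x \<in> Ob X T"
    interpret T: algebra K T using algsD[OF T] .
    show "der R (r \<odot>\<^bsub>FA\<^esub> a) (T, \<phi>) x = (r \<odot>\<^bsub>FA\<^esub> der R a) (T, \<phi>) x"
    proof -
      have "dual_incl T (\<phi> r) = mk_dual T (\<phi> r) \<zero>\<^bsub>T\<^esub>"
        using alg_hom_closed[OF \<phi> r] by (simp add: dual_incl_def)
      then show ?thesis
      using alg_hom_closed[OF \<phi> r]
      by (subst *) (simp_all add: T \<phi> x ap dual_num_mult compose_eq_on r)
    qed
  qed (auto intro!: cl r)
qed

lemma der_pow_add:
  assumes "a \<in> F R" "b \<in> F R" shows "(der R ^^ n) (a \<oplus>\<^bsub>FA\<^esub> b) = (der R ^^ n) a \<oplus>\<^bsub>FA\<^esub> (der R ^^ n) b"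
  using assms by (induction n) (simp_all add: der_add der_pow_closed)

lemma der_pow_smult:
  assumes "a \<in> F R" "r \<in> carrier R" shows "(der R ^^ n) (r \<odot>\<^bsub>FA\<^esub> a) = r \<odot>\<^bsub>FA\<^esub> (der R ^^ n) a"
  using assms by (induction n) (simp_all add: der_smult der_pow_closed)

lemma der_one: "der R \<one>\<^bsub>FA\<^esub> (T, \<phi>) x = \<zero>\<^bsub>T\<^esub>"
  if "T \<in> algs K" "\<phi> \<in> alg_hom K R T" "x \<in> Ob X T"
proof -
  interpret T: algebra K T using algsD[OF that(1)] .
  show ?thesis
    using that by (simp add: der_def FA_apply[OF dual_num_algs compose_incl(1) V_closed] dual_num_one)
qed

lemma der_vanish:
  assumes a: "a \<in> F R" and 0: "\<And>T \<phi> x. \<lbrakk>T \<in> algs K; \<phi> \<in> alg_hom K R T; x \<in> Ob X T\<rbrakk> \<Longrightarrow> a (T, \<phi>) x = \<zero>\<^bsub>T\<^esub>"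
    and x: "T \<in> algs K" "\<phi> \<in> alg_hom K R T" "x \<in> Ob X T"
  shows "der R a (T, \<phi>) x = \<zero>\<^bsub>T\<^esub>"
proof -
  interpret T: algebra K T using algsD[OF x(1)] .
  show ?thesis
    using x by (simp add: der_def 0[OF dual_num_algs compose_incl(1) V_closed] dual_num_zero)
qed

lemma der_pow_one: "(der R ^^ n) \<one>\<^bsub>FA\<^esub> (T, \<phi>) x = (if n = 0 then \<one>\<^bsub>T\<^esub> else \<zero>\<^bsub>T\<^esub>)"
  if "T \<in> algs K" "\<phi> \<in> alg_hom K R T" "x \<in> Ob X T"
proof -
  have "(der R ^^ Suc n) \<one>\<^bsub>FA\<^esub> (T, \<phi>) x = \<zero>\<^bsub>T\<^esub>"
    if "T \<in> algs K" "\<phi> \<in> alg_hom K R T" "x \<in> Ob X T" for n T \<phi> x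
    using that
  proof (induction n arbitrary: T \<phi> x)
    case (Suc n)
    show ?case
      using der_vanish[OF der_pow_closed[OF FA_one_closed, of "Suc n"] Suc.IH Suc.prems] by simp
  qed (simp add: der_one)
  then show ?thesis
    using that by (cases n) (auto simp: FA_apply)
qed

text \<open>If the innermost derivative is split off, D^(n+1)(a b) = D^n(Da b) + D^n(a Db), which is
  the recursion of \<open>dp_mult\<close>.\<close>

lemma der_pow_mult:
  assumes "a \<in> F R" "b \<in> F R" "T \<in> algs K" "\<phi> \<in> alg_hom K R T" "x \<in> Ob X T"
  shows "(der R ^^ n) (a \<otimes>\<^bsub>FA\<^esub> b) (T, \<phi>) x =
    dp_mult T (\<lambda>i. (der R ^^ i) a (T, \<phi>) x) (\<lambda>i. (der R ^^ i) b (T, \<phi>) x) n"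
  using assms(1,2)
proof (induction n arbitrary: a b)
  case 0
  then show ?case using assms(3-5) by (simp add: FA_apply)
next
  case (Suc n)
  have "(der R ^^ Suc n) (a \<otimes>\<^bsub>FA\<^esub> b) = (der R ^^ n) (der R (a \<otimes>\<^bsub>FA\<^esub> b))"
    by (simp add: funpow_swap1)
  also have "\<dots> = (der R ^^ n) (der R a \<otimes>\<^bsub>FA\<^esub> b) \<oplus>\<^bsub>FA\<^esub> (der R ^^ n) (a \<otimes>\<^bsub>FA\<^esub> der R b)"
    using Suc.prems by (simp add: der_mult der_pow_add FA_closed der_closed)
  finally show ?case
    using Suc.prems Suc.IH[of "der R a" b] Suc.IH[of a "der R b"] assms(3-5)
    by (simp add: FA_apply der_closed funpow_swap1)
qed

end

text \<open>Derivatives use the base algebra only through the structure map of the test algebra. In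
  the affine case this makes the values of the exponential on functions over varying T a natural
  family.\<close>

lemma der_reindex:
  assumes R: "R \<in> algs K" and R': "R' \<in> algs K" and f: "f \<in> alg_hom K R R'" and a: "a \<in> F R"
  shows "reindex K R R' f a \<in> F R'" and "der R' (reindex K R R' f a) = reindex K R R' f (der R a)"
proof -
  have c: "compose (carrier R) \<phi> f \<in> alg_hom K R T" if "\<phi> \<in> alg_hom K R' T" for \<phi> T
    by (rule alg_hom_compose[OF f that algsD[OF R]])
  have cl: "reindex K R R' f b \<in> F R'" if b: "b \<in> F R" for b
  proof -
    \<comment> \<open>\<open>reindex\<close> leaves the inner functions alone while
      \<open>restr_fun\<close> restricts them to the points; they agree because the components of b
      are already extensional.\<close>
    have "reindex K R R' f b = restr_fun K X R' (\<lambda>T \<phi> x. b (T, compose (carrier R) \<phi> f) x)"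
    proof (rule ext, clarify)
      fix T \<phi>
      show "reindex K R R' f b (T, \<phi>) = restr_fun K X R' (\<lambda>T \<phi> x. b (T, compose (carrier R) \<phi> f) x) (T, \<phi>)"
      proof (cases "(T, \<phi>) \<in> coslice K R'")
        case True
        then have "(T, compose (carrier R) \<phi> f) \<in> coslice K R"
          using c[of \<phi> T] by (simp add: coslice_iff)
        then have "b (T, compose (carrier R) \<phi> f) \<in> Ob X T \<rightarrow>\<^sub>E carrier T"
          using b by (force simp: hom_over_def PiE_def Pi_def)
        then show ?thesis
          using True by (auto simp: reindex_def restr_fun_def PiE_def extensional_def fun_eq_iff)
      qed (simp add: reindex_def restr_fun_def)
    qed
    also have "\<dots> \<in> F R'"
      by (rule restr_fun_F[OF R'])
        (auto simp: F_closed[OF R b] c compose_alg_hom_assoc[OF f] F_natural[OF R b])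
    finally show ?thesis .
  qed
  show "reindex K R R' f a \<in> F R'" by (rule cl[OF a])
  have ap: "reindex K R R' f b (T, \<phi>) x = b (T, compose (carrier R) \<phi> f) x"
    if "T \<in> algs K" "\<phi> \<in> alg_hom K R' T" for b :: "('u, 'x) fam" and T \<phi> x
    using that by (simp add: reindex_def coslice_iff)
  show "der R' (reindex K R R' f a) = reindex K R R' f (der R a)"
  proof (rule hom_over_eqI[OF der_closed[OF R' cl[OF a]] cl[OF der_closed[OF R a]]])
    fix T \<phi> x assume T: "T \<in> algs K" and \<phi>: "\<phi> \<in> alg_hom K R' T" and x: "x \<in> Ob X T"
    show "der R' (reindex K R R' f a) (T, \<phi>) x = reindex K R R' f (der R a) (T, \<phi>) x"
      using T \<phi> x by (simp add: ap der_def c dual_num_algs compose_incl(1)[OF R'] compose_alg_hom_assoc[OF f])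
  qed
qed

lemma der_pow_reindex:
  assumes "R \<in> algs K" "R' \<in> algs K" "f \<in> alg_hom K R R'" "a \<in> F R"
  shows "(der R' ^^ n) (reindex K R R' f a) = reindex K R R' f ((der R ^^ n) a)"
  using assms by (induction n) (simp_all add: der_reindex der_pow_closed)

end

section \<open>The dual of the additive group\<close>

lemma ring_hom_add_pow:
  fixes n :: nat
  assumes "h \<in> ring_hom R S" "cring R" "cring S" "x \<in> carrier R"
  shows "h ([n] \<cdot>\<^bsub>R\<^esub> x) = [n] \<cdot>\<^bsub>S\<^esub> h x"
proof -
  interpret R: cring R by fact
  interpret S: cring S by fact
  have "h \<zero>\<^bsub>R\<^esub> = \<zero>\<^bsub>S\<^esub>"
    using assms(1) R.ring_axioms S.ring_axioms by (rule ring_hom_zero)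
  then show ?thesis
    using assms(4) by (induction n) (auto simp: ring_hom_add[OF assms(1)])
qed

lemma ring_hom_finsum:
  assumes "h \<in> ring_hom R S" "cring R" "cring S" "\<And>i. i \<in> A \<Longrightarrow> f i \<in> carrier R"
  shows "h (finsum R f A) = (\<Oplus>\<^bsub>S\<^esub>i\<in>A. h (f i))"
proof -
  interpret ring_hom_cring R S h
    using assms by (simp add: ring_hom_cringI)
  show ?thesis
    using assms(4) by (subst hom_finsum) (auto simp: o_def)
qed

context universe
begin

lemmas alg_hom_finsum = ring_hom_finsum[OF alg_hom_ring_hom algs_cring algs_cring]

lemma dp_seq_map:
  assumes S: "S \<in> algs K" and T: "T \<in> algs K" and \<phi>: "\<phi> \<in> alg_hom K S T" and \<mu>: "cring.dp_seq S \<mu>"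
  shows "cring.dp_seq T (\<lambda>n. \<phi> (\<mu> n))"
proof -
  interpret S: algebra K S using algsD[OF S] .
  interpret T: algebra K T using algsD[OF T] .
  have \<mu>c: "\<mu> n \<in> carrier S" for n
    using \<mu> by (simp add: S.dp_seq_def S.carrier_UP_iff)
  have z: "\<phi> \<zero>\<^bsub>S\<^esub> = \<zero>\<^bsub>T\<^esub>"
    using alg_hom_zero[OF \<phi> S.is_cring T.is_cring] .
  have "\<phi> (\<mu> i) \<otimes>\<^bsub>T\<^esub> \<phi> (\<mu> j) = [((i + j) choose i)] \<cdot>\<^bsub>T\<^esub> \<phi> (\<mu> (i + j))" for i j
  proof -
    have "\<phi> (\<mu> i) \<otimes>\<^bsub>T\<^esub> \<phi> (\<mu> j) = \<phi> (\<mu> i \<otimes>\<^bsub>S\<^esub> \<mu> j)"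
      by (simp add: alg_hom_mult[OF \<phi>] \<mu>c)
    also have "\<mu> i \<otimes>\<^bsub>S\<^esub> \<mu> j = [((i + j) choose i)] \<cdot>\<^bsub>S\<^esub> \<mu> (i + j)"
      using \<mu> by (simp add: S.dp_seq_def)
    finally show ?thesis
      by (simp add: ring_hom_add_pow[OF alg_hom_ring_hom[OF \<phi>] S.is_cring T.is_cring] \<mu>c)
  qed
  moreover have "\<exists>N. \<forall>n>N. \<phi> (\<mu> n) = \<zero>\<^bsub>T\<^esub>"
    using \<mu> z by (auto simp: S.dp_seq_def S.carrier_UP_iff) metis
  ultimately show ?thesis
    using \<mu> by (simp add: T.dp_seq_def T.carrier_UP_iff S.dp_seq_def alg_hom_one[OF \<phi>] alg_hom_closed[OF \<phi>] \<mu>c)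
qed

abbreviation "Ga \<equiv> underlying (Ga_dual :: ('u, (nat \<Rightarrow> 'u) monoid, nat \<Rightarrow> 'u) kfunctor)"

lemma Ga_simps:
  "Ob Ga S = additive_chars S" "Mor Ga S T \<phi> = (\<lambda>\<mu> n. \<phi> (\<mu> n))"
  "carrier (Ob Ga_dual S) = additive_chars S" "Mor Ga_dual S T \<phi> = (\<lambda>\<mu> n. \<phi> (\<mu> n))"
  "monoid.mult (Ob Ga_dual S) = monoid.mult (UP S)" "one (Ob Ga_dual S) = one (UP S)"
  by (simp_all add: underlying_def Ga_dual_def)

lemma additive_chars_dp_seq: "S \<in> algs K \<Longrightarrow> \<mu> \<in> additive_chars S \<longleftrightarrow> cring.dp_seq S \<mu>"
  by (rule cring.additive_chars_iff) (rule algs_cring)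

lemma additive_chars_UP: "\<lbrakk>S \<in> algs K; \<mu> \<in> additive_chars S\<rbrakk> \<Longrightarrow> \<mu> \<in> carrier (UP S)"
  using cring.dp_seq_def[OF algs_cring] by (auto simp: additive_chars_dp_seq)

lemma additive_chars_closed: "\<lbrakk>S \<in> algs K; \<mu> \<in> additive_chars S\<rbrakk> \<Longrightarrow> \<mu> n \<in> carrier S"
  using additive_chars_UP cring.carrier_UP_iff[OF algs_cring] by blast

lemma additive_chars_finite: "\<lbrakk>S \<in> algs K; \<mu> \<in> additive_chars S\<rbrakk> \<Longrightarrow> \<exists>N. \<forall>n>N. \<mu> n = \<zero>\<^bsub>S\<^esub>"
  using additive_chars_UP cring.carrier_UP_iff[OF algs_cring] by blast

lemma additive_chars_0: "\<lbrakk>S \<in> algs K; \<mu> \<in> additive_chars S\<rbrakk> \<Longrightarrow> \<mu> 0 = \<one>\<^bsub>S\<^esub>"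
  using cring.dp_seq_def[OF algs_cring] by (auto simp: additive_chars_dp_seq)

lemma Ga_set_functor: "set_functor K Ga"
proof -
  have "(\<lambda>n. \<phi> (\<mu> n)) \<in> additive_chars T"
    if "S \<in> algs K" "T \<in> algs K" "\<phi> \<in> alg_hom K S T" "\<mu> \<in> additive_chars S" for S T \<phi> \<mu>
    using dp_seq_map[OF that(1-3)] that by (simp add: additive_chars_dp_seq)
  then show ?thesis
    by (auto simp: set_functor_def Ga_simps additive_chars_closed compose_eq_on)
qed

lemma UP_mult_eq:
  "\<lbrakk>p \<in> carrier (UP S); q \<in> carrier (UP S)\<rbrakk> \<Longrightarrow> (p \<otimes>\<^bsub>UP S\<^esub> q) n = (\<Oplus>\<^bsub>S\<^esub>i\<in>{..n}. p i \<otimes>\<^bsub>S\<^esub> q (n - i))"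
  by (simp add: UP_def)

lemma Ga_mult_natural:
  assumes S: "S \<in> algs K" and T: "T \<in> algs K" and \<phi>: "\<phi> \<in> alg_hom K S T"
    and \<mu>: "\<mu> \<in> additive_chars S" and \<nu>: "\<nu> \<in> additive_chars S"
  shows "(\<lambda>n. \<phi> ((\<mu> \<otimes>\<^bsub>UP S\<^esub> \<nu>) n)) = (\<lambda>n. \<phi> (\<mu> n)) \<otimes>\<^bsub>UP T\<^esub> (\<lambda>n. \<phi> (\<nu> n))"
proof
  fix n
  interpret S: cring S using algs_cring[OF S] .
  interpret T: cring T using algs_cring[OF T] .
  note c = additive_chars_closed[OF S \<mu>] additive_chars_closed[OF S \<nu>]
  have "(\<lambda>n. \<phi> (\<mu> n)) \<in> additive_chars T" "(\<lambda>n. \<phi> (\<nu> n)) \<in> additive_chars T"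
    using set_functor_closed[OF Ga_set_functor S T \<phi>] \<mu> \<nu> by (simp_all add: Ga_simps)
  then show "\<phi> ((\<mu> \<otimes>\<^bsub>UP S\<^esub> \<nu>) n) = ((\<lambda>n. \<phi> (\<mu> n)) \<otimes>\<^bsub>UP T\<^esub> (\<lambda>n. \<phi> (\<nu> n))) n"
    using S T \<mu> \<nu> c
    by (auto simp: UP_mult_eq additive_chars_UP alg_hom_finsum[OF \<phi>] alg_hom_mult[OF \<phi>] alg_hom_closed[OF \<phi>]
        intro!: T.finsum_cong')
qed

section \<open>The distinguished invariant field on the dual of the additive group\<close>

definition one_plus_eps :: "('u, 'u) module \<Rightarrow> nat \<Rightarrow> 'u" where
  "one_plus_eps S n = (if n = 0 then \<one>\<^bsub>dual_num S\<^esub> else if n = 1 then eps S else \<zero>\<^bsub>dual_num S\<^esub>)"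

lemma one_plus_eps_x_eq: "one_plus_eps_x K = one_plus_eps (base_alg K)"
proof -
  let ?D = "dual_num (base_alg K)"
  note B = base_alg_in_algs[OF K]
  interpret D: cring ?D using algs_cring[OF dual_num_algs[OF B]] .
  interpret P: UP_cring ?D "UP ?D" by unfold_locales
  have c: "one_plus_eps_x K \<in> carrier (UP ?D)"
    unfolding one_plus_eps_x_def Let_def using eps_closed[OF B] by simp
  have "coeff (UP ?D) (one_plus_eps_x K) n = one_plus_eps (base_alg K) n" for n
    unfolding one_plus_eps_x_def Let_def using eps_closed[OF B] by (simp add: one_plus_eps_def)
  then show ?thesis
    using c by (auto simp: P.coeff_eq)
qed

text \<open>If i or j is 0 the relation is trivial. Otherwise i + j is at least 2, where the
  coefficient is zero, and on the left \<epsilon> \<epsilon> = 0 settles i = j = 1.\<close>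

lemma one_plus_eps_char: assumes S: "S \<in> algs K" shows "one_plus_eps S \<in> additive_chars (dual_num S)"
proof -
  interpret D: cring "dual_num S" using algs_cring[OF dual_num_algs[OF S]] .
  have "one_plus_eps S i \<otimes>\<^bsub>dual_num S\<^esub> one_plus_eps S j = [((i + j) choose i)] \<cdot>\<^bsub>dual_num S\<^esub> one_plus_eps S (i + j)" for i j
    using eps_closed[OF S] eps_square[OF S]
    by (cases i; cases j) (auto simp: one_plus_eps_def)
  then show ?thesis
    using eps_closed[OF S]
    by (auto simp: D.additive_chars_iff D.dp_seq_def D.carrier_UP_iff one_plus_eps_def intro!: exI[of _ 1])
qed

definition Ga_field :: "('u, 'u) module \<Rightarrow> (nat \<Rightarrow> 'u) \<Rightarrow> nat \<Rightarrow> 'u" where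
  "Ga_field S \<mu> = (\<lambda>n. dual_incl S (\<mu> n)) \<otimes>\<^bsub>UP (dual_num S)\<^esub> one_plus_eps S"

lemma Ga_field_char: "\<lbrakk>S \<in> algs K; \<mu> \<in> additive_chars S\<rbrakk> \<Longrightarrow> Ga_field S \<mu> \<in> additive_chars (dual_num S)"
  unfolding Ga_field_def
  using set_functor_closed[OF Ga_set_functor _ dual_num_algs dual_incl_alg_hom]
  by (intro cring.additive_chars_mult algs_cring[OF dual_num_algs] one_plus_eps_char) (auto simp: Ga_simps)

lemma Ga_field_eq:
  assumes S: "S \<in> algs K" and \<mu>: "\<mu> \<in> additive_chars S"
  shows "Ga_field S \<mu> n = mk_dual S (\<mu> n) (if n = 0 then \<zero>\<^bsub>S\<^esub> else \<mu> (n - 1))"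
proof -
  interpret S: cring S using algs_cring[OF S] .
  interpret D: cring "dual_num S" using algs_cring[OF dual_num_algs[OF S]] .
  note c = additive_chars_closed[OF S \<mu>] eps_closed[OF S]
  have i: "dual_incl S (\<mu> k) = mk_dual S (\<mu> k) \<zero>\<^bsub>S\<^esub>" for k
    by (simp add: dual_incl_def c)
  have "(\<lambda>n. dual_incl S (\<mu> n)) \<in> additive_chars (dual_num S)"
    using set_functor_closed[OF Ga_set_functor S dual_num_algs[OF S] dual_incl_alg_hom[OF S]] \<mu> by (simp add: Ga_simps)
  then have *: "Ga_field S \<mu> n = (\<Oplus>\<^bsub>dual_num S\<^esub>i\<in>{..n}. mk_dual S (\<mu> i) \<zero>\<^bsub>S\<^esub> \<otimes>\<^bsub>dual_num S\<^esub> one_plus_eps S (n - i))" for n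
    using one_plus_eps_char[OF S] S by (simp add: Ga_field_def UP_mult_eq additive_chars_UP dual_num_algs i)
  have m: "mk_dual S (\<mu> k) \<zero>\<^bsub>S\<^esub> \<in> carrier (dual_num S)" for k
    by (simp add: mk_dual_closed[OF S] c)
  show ?thesis
  proof (cases n)
    case 0
    then show ?thesis using m by (simp add: * one_plus_eps_def)
  next
    case (Suc k)
    have "(\<Oplus>\<^bsub>dual_num S\<^esub>i\<in>{..k}. mk_dual S (\<mu> i) \<zero>\<^bsub>S\<^esub> \<otimes>\<^bsub>dual_num S\<^esub> one_plus_eps S (Suc k - i)) =
        (\<Oplus>\<^bsub>dual_num S\<^esub>i\<in>{..k}. if k = i then mk_dual S (\<mu> i) \<zero>\<^bsub>S\<^esub> \<otimes>\<^bsub>dual_num S\<^esub> eps S else \<zero>\<^bsub>dual_num S\<^esub>)"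
      using m c by (intro D.finsum_cong') (auto simp: one_plus_eps_def)
    also have "\<dots> = mk_dual S (\<mu> k) \<zero>\<^bsub>S\<^esub> \<otimes>\<^bsub>dual_num S\<^esub> eps S"
      using m c by (intro D.finsum_singleton) auto
    also have "\<dots> = mk_dual S \<zero>\<^bsub>S\<^esub> (\<mu> k)"
      using c by (simp add: eps_def dual_num_simps[OF S])
    finally have "Ga_field S \<mu> (Suc k) = mk_dual S \<zero>\<^bsub>S\<^esub> (\<mu> k) \<oplus>\<^bsub>dual_num S\<^esub> mk_dual S (\<mu> (Suc k)) \<zero>\<^bsub>S\<^esub>"
      using m c one_plus_eps_char[OF S]
      by (simp add: * D.finsum_Suc Pi_def additive_chars_closed[OF dual_num_algs[OF S]])
        (simp add: one_plus_eps_def D.a_comm mk_dual_closed[OF S])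
    then show ?thesis
      using c by (simp add: Suc dual_num_simps[OF S])
  qed
qed

sublocale Ga: vector_field K Ga Ga_field
proof
  fix S T \<phi> and \<mu> :: "nat \<Rightarrow> 'u"
  assume S: "S \<in> algs K" and "\<mu> \<in> Ob Ga S"
  then have \<mu>: "\<mu> \<in> additive_chars S" by (simp add: Ga_simps)
  interpret S: cring S using algs_cring[OF S] .
  note c = additive_chars_closed[OF S \<mu>]
  show "Ga_field S \<mu> \<in> Ob Ga (dual_num S)"
    using Ga_field_char[OF S \<mu>] by (simp add: Ga_simps)
  show "Mor Ga (dual_num S) S (dual_proj S) (Ga_field S \<mu>) = \<mu>"
    using c by (simp add: Ga_simps Ga_field_eq[OF S \<mu>] dual_proj_mk[OF S])
  assume T: "T \<in> algs K" and \<phi>: "\<phi> \<in> alg_hom K S T"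
  have "Mor Ga S T \<phi> \<mu> \<in> additive_chars T"
    using set_functor_closed[OF Ga_set_functor S T \<phi>] \<mu> by (simp add: Ga_simps)
  then show "Mor Ga (dual_num S) (dual_num T) (dual_map S T \<phi>) (Ga_field S \<mu>) = Ga_field T (Mor Ga S T \<phi> \<mu>)"
    using c alg_hom_zero[OF \<phi> S.is_cring algs_cring[OF T]]
    by (auto simp: Ga_simps Ga_field_eq[OF S \<mu>] Ga_field_eq[OF T] dual_map_mk[OF S] fun_eq_iff)
qed (rule Ga_set_functor)

end

section \<open>Truncated divided power algebras\<close>

text \<open>The divided power algebra on one generator over R, modulo all z_n with n > N; the
  sequence f stands for the sum of f_n z_n. Entries beyond N are fixed to zero so that equal
  elements are equal functions.\<close>

definition trunc_dp :: "nat \<Rightarrow> ('k, 'u) module \<Rightarrow> ('k, nat \<Rightarrow> 'u) module" where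
  "trunc_dp N R =
     \<lparr>carrier = {f. (\<forall>n. f n \<in> carrier R) \<and> (\<forall>n>N. f n = \<zero>\<^bsub>R\<^esub>)},
      monoid.mult = (\<lambda>f g n. if n \<le> N then dp_mult R f g n else \<zero>\<^bsub>R\<^esub>),
      one = (\<lambda>n. if n = 0 then \<one>\<^bsub>R\<^esub> else \<zero>\<^bsub>R\<^esub>),
      ring.zero = (\<lambda>_. \<zero>\<^bsub>R\<^esub>),
      add = (\<lambda>f g n. f n \<oplus>\<^bsub>R\<^esub> g n),
      smult = (\<lambda>k f n. k \<odot>\<^bsub>R\<^esub> f n)\<rparr>"

lemma trunc_dp_cring: assumes "cring R" shows "cring (trunc_dp N R)"
proof -
  interpret cring R by fact
  show ?thesis
  proof (rule cringI)
    show "abelian_group (trunc_dp N R)"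
    proof (rule abelian_groupI)
      fix x assume "x \<in> carrier (trunc_dp N R)"
      then show "\<exists>y\<in>carrier (trunc_dp N R). y \<oplus>\<^bsub>trunc_dp N R\<^esub> x = \<zero>\<^bsub>trunc_dp N R\<^esub>"
        by (intro bexI[of _ "\<lambda>n. \<ominus>\<^bsub>R\<^esub> x n"]) (auto simp: trunc_dp_def l_neg)
    qed (auto simp: trunc_dp_def a_ac)
    show "Group.comm_monoid (trunc_dp N R)"
    proof (rule comm_monoidI)
      fix x y z assume c: "x \<in> carrier (trunc_dp N R)" "y \<in> carrier (trunc_dp N R)" "z \<in> carrier (trunc_dp N R)"
      then have *: "\<And>n. x n \<in> carrier R" "\<And>n. y n \<in> carrier R" "\<And>n. z n \<in> carrier R"
        by (auto simp: trunc_dp_def)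
      have "dp_mult R (\<lambda>n. if n \<le> N then dp_mult R x y n else \<zero>\<^bsub>R\<^esub>) z n = dp_mult R (dp_mult R x y) z n"
        "dp_mult R x (\<lambda>n. if n \<le> N then dp_mult R y z n else \<zero>\<^bsub>R\<^esub>) n = dp_mult R x (dp_mult R y z) n"
        if "n \<le> N" for n
        using that by (auto intro!: dp_mult_cong)
      then show "x \<otimes>\<^bsub>trunc_dp N R\<^esub> y \<otimes>\<^bsub>trunc_dp N R\<^esub> z = x \<otimes>\<^bsub>trunc_dp N R\<^esub> (y \<otimes>\<^bsub>trunc_dp N R\<^esub> z)"
        using dp_mult_assoc[OF *] by (auto simp: trunc_dp_def)
      show "x \<otimes>\<^bsub>trunc_dp N R\<^esub> y = y \<otimes>\<^bsub>trunc_dp N R\<^esub> x"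
        using dp_mult_comm[OF *(1,2)] by (auto simp: trunc_dp_def)
    qed (auto simp: trunc_dp_def dp_mult_closed dp_mult_scalar)
  qed (auto simp: trunc_dp_def dp_mult_add)
qed

lemma trunc_dp_algebra: assumes "algebra K R" shows "algebra K (trunc_dp N R)"
proof -
  interpret algebra K R by fact
  show ?thesis
    by (rule algebra_of_ring_hom[OF R.cring_axioms trunc_dp_cring[OF cring_axioms],
          of "\<lambda>k n. if n = 0 then k \<odot>\<^bsub>R\<^esub> \<one>\<^bsub>R\<^esub> else \<zero>\<^bsub>R\<^esub>"])
      (auto simp: trunc_dp_def ring_hom_def smult_l_distr smult_assoc1 smult_assoc2 dp_mult_scalar fun_eq_iff)
qed

section \<open>The universal truncated character\<close>

context universe
begin

text \<open>An element is determined by the list of its first N + 1 coefficients, and lists have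
  codes in the universe.\<close>

lemma trunc_dp_emb: "\<exists>h :: (nat \<Rightarrow> 'u) \<Rightarrow> 'u. inj_on h (carrier (trunc_dp N R))"
proof -
  obtain l :: "'u list \<Rightarrow> 'u" where l: "inj l"
    using infinite_list_inj[OF inf] by blast
  have "inj_on (\<lambda>f. l (map f [0..<Suc N])) (carrier (trunc_dp N R))"
  proof (rule inj_onI)
    fix f g assume fg: "f \<in> carrier (trunc_dp N R)" "g \<in> carrier (trunc_dp N R)"
      and "l (map f [0..<Suc N]) = l (map g [0..<Suc N])"
    then have "map f [0..<Suc N] = map g [0..<Suc N]"
      by (auto dest: injD[OF l])
    then have "\<forall>n\<in>set [0..<Suc N]. f n = g n"
      by (simp only: map_eq_conv)
    then have *: "f n = g n" if "n \<le> N" for n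
      using that by auto
    show "f = g"
    proof
      fix n show "f n = g n"
        using fg * by (cases "n \<le> N") (auto simp: trunc_dp_def)
    qed
  qed
  then show ?thesis by blast
qed

definition gam :: "nat \<Rightarrow> ('u, 'u) module \<Rightarrow> ('u, 'u) module" where
  "gam N R = copy_alg (trunc_dp N R)"

definition gam_mk :: "nat \<Rightarrow> ('u, 'u) module \<Rightarrow> (nat \<Rightarrow> 'u) \<Rightarrow> 'u" where
  "gam_mk N R = emb (carrier (trunc_dp N R))"

definition gam_un :: "nat \<Rightarrow> ('u, 'u) module \<Rightarrow> 'u \<Rightarrow> nat \<Rightarrow> 'u" where
  "gam_un N R = unemb (carrier (trunc_dp N R))"

definition gam_incl :: "nat \<Rightarrow> ('u, 'u) module \<Rightarrow> 'u \<Rightarrow> 'u" where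
  "gam_incl N R = (\<lambda>r\<in>carrier R. gam_mk N R (\<lambda>n. if n = 0 then r else \<zero>\<^bsub>R\<^esub>))"

text \<open>The divided powers z_n themselves, read as the coefficients of a polynomial in x. The
  value zero beyond N makes it a polynomial, and this is the reason for truncating.\<close>

definition gam_univ :: "nat \<Rightarrow> ('u, 'u) module \<Rightarrow> nat \<Rightarrow> 'u" where
  "gam_univ N R n = (if n \<le> N then gam_mk N R (\<lambda>i. if i = n then \<one>\<^bsub>R\<^esub> else \<zero>\<^bsub>R\<^esub>) else \<zero>\<^bsub>gam N R\<^esub>)"

definition gam_eval :: "nat \<Rightarrow> ('u, 'u) module \<Rightarrow> ('u, 'u) module \<Rightarrow> ('u \<Rightarrow> 'u) \<Rightarrow> (nat \<Rightarrow> 'u) \<Rightarrow> 'u \<Rightarrow> 'u" where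
  "gam_eval N R T \<phi> \<mu> = (\<lambda>z\<in>carrier (gam N R). \<Oplus>\<^bsub>T\<^esub>n\<in>{..N}. \<phi> (gam_un N R z n) \<otimes>\<^bsub>T\<^esub> \<mu> n)"

context
  fixes N :: nat and R :: "('u, 'u) module"
  assumes R: "R \<in> algs K"
begin

interpretation R: algebra K R using algsD[OF R] .

abbreviation "seqs \<equiv> carrier (trunc_dp N R)"

lemmas gam_copy = trunc_dp_emb trunc_dp_algebra[OF R.algebra_axioms]

lemma seqs_iff: "f \<in> seqs \<longleftrightarrow> (\<forall>n. f n \<in> carrier R) \<and> (\<forall>n>N. f n = \<zero>\<^bsub>R\<^esub>)"
  by (simp add: trunc_dp_def)

lemma gam_algs: "gam N R \<in> algs K"
  using copy_alg_algebra[OF gam_copy] by (simp add: algs_def gam_def)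

interpretation \<Gamma>: algebra K "gam N R" using algsD[OF gam_algs] .

lemma gam_mk_hom: "gam_mk N R \<in> ring_hom (trunc_dp N R) (gam N R)"
  using copy_alg_hom[OF gam_copy] by (simp add: gam_def gam_mk_def)

lemma gam_carrier: "carrier (gam N R) = gam_mk N R ` seqs"
  using copy_alg_carrier[OF gam_copy] by (simp add: gam_def gam_mk_def)

lemma gam_smult: "f \<in> seqs \<Longrightarrow> k \<odot>\<^bsub>gam N R\<^esub> gam_mk N R f = gam_mk N R (\<lambda>n. k \<odot>\<^bsub>R\<^esub> f n)"
  using copy_alg_smult[OF gam_copy] by (simp add: gam_def gam_mk_def) (simp add: trunc_dp_def)

lemma gam_zero: "\<zero>\<^bsub>gam N R\<^esub> = gam_mk N R (\<lambda>n. \<zero>\<^bsub>R\<^esub>)"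
  using copy_alg_zero[OF gam_copy] by (simp add: gam_def gam_mk_def) (simp add: trunc_dp_def)

lemma gam_one: "\<one>\<^bsub>gam N R\<^esub> = gam_mk N R (\<lambda>n. if n = 0 then \<one>\<^bsub>R\<^esub> else \<zero>\<^bsub>R\<^esub>)"
  using ring_hom_one[OF gam_mk_hom] by (simp add: trunc_dp_def)

lemma gam_mult:
  "\<lbrakk>f \<in> seqs; g \<in> seqs\<rbrakk> \<Longrightarrow>
    gam_mk N R f \<otimes>\<^bsub>gam N R\<^esub> gam_mk N R g = gam_mk N R (\<lambda>n. if n \<le> N then dp_mult R f g n else \<zero>\<^bsub>R\<^esub>)"
  using ring_hom_mult[OF gam_mk_hom] by (simp add: trunc_dp_def)

lemma gam_add:
  "\<lbrakk>f \<in> seqs; g \<in> seqs\<rbrakk> \<Longrightarrow> gam_mk N R f \<oplus>\<^bsub>gam N R\<^esub> gam_mk N R g = gam_mk N R (\<lambda>n. f n \<oplus>\<^bsub>R\<^esub> g n)"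
  using ring_hom_add[OF gam_mk_hom] by (simp add: trunc_dp_def)

lemma gam_un_mk: "f \<in> seqs \<Longrightarrow> gam_un N R (gam_mk N R f) = f"
  unfolding gam_un_def gam_mk_def by (rule unemb_emb[OF trunc_dp_emb])

lemma gam_mk_closed: "f \<in> seqs \<Longrightarrow> gam_mk N R f \<in> carrier (gam N R)"
  by (simp add: gam_carrier)

lemma gam_un_closed: "z \<in> carrier (gam N R) \<Longrightarrow> gam_un N R z n \<in> carrier R"
  by (auto simp: gam_carrier gam_un_mk) (auto simp: seqs_iff)

lemma delta_seqs: "\<lbrakk>n \<le> N; r \<in> carrier R\<rbrakk> \<Longrightarrow> (\<lambda>i. if i = n then r else \<zero>\<^bsub>R\<^esub>) \<in> seqs"
  by (auto simp: seqs_iff)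

lemma gam_incl_alg_hom: "gam_incl N R \<in> alg_hom K R (gam N R)"
proof (rule alg_homI)
  show "gam_incl N R \<in> ring_hom R (gam N R)"
  proof (rule ring_hom_memI)
    fix x y assume x: "x \<in> carrier R" and y: "y \<in> carrier R"
    have "(\<lambda>n. if n \<le> N then dp_mult R (\<lambda>n. if n = 0 then x else \<zero>\<^bsub>R\<^esub>) (\<lambda>n. if n = 0 then y else \<zero>\<^bsub>R\<^esub>) n else \<zero>\<^bsub>R\<^esub>) =
        (\<lambda>n. if n = 0 then x \<otimes>\<^bsub>R\<^esub> y else \<zero>\<^bsub>R\<^esub>)"
      using x y by (auto simp: R.dp_mult_scalar fun_eq_iff)
    then show "gam_incl N R (x \<otimes>\<^bsub>R\<^esub> y) = gam_incl N R x \<otimes>\<^bsub>gam N R\<^esub> gam_incl N R y"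
      using x y by (simp add: gam_incl_def gam_mult delta_seqs)
    show "gam_incl N R (x \<oplus>\<^bsub>R\<^esub> y) = gam_incl N R x \<oplus>\<^bsub>gam N R\<^esub> gam_incl N R y"
      using x y by (auto simp: gam_incl_def gam_add delta_seqs intro!: arg_cong[of _ _ "gam_mk N R"])
  qed (auto simp: gam_incl_def gam_mk_closed delta_seqs gam_one)
  fix k x assume k: "k \<in> carrier K" and x: "x \<in> carrier R"
  show "gam_incl N R (k \<odot>\<^bsub>R\<^esub> x) = k \<odot>\<^bsub>gam N R\<^esub> gam_incl N R x"
    using k x by (auto simp: gam_incl_def gam_smult delta_seqs intro!: arg_cong[of _ _ "gam_mk N R"])
qed (simp add: gam_incl_def)

lemma gam_univ_closed: "gam_univ N R n \<in> carrier (gam N R)"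
  by (simp add: gam_univ_def gam_mk_closed delta_seqs)

text \<open>The multiplication table of divided powers. In the binomial formula only the summand k =
  i survives, and only for n = i + j.\<close>

lemma dp_mult_delta:
  "dp_mult R (\<lambda>k. if k = i then \<one>\<^bsub>R\<^esub> else \<zero>\<^bsub>R\<^esub>) (\<lambda>k. if k = j then \<one>\<^bsub>R\<^esub> else \<zero>\<^bsub>R\<^esub>) n =
    (if n = i + j then [((i + j) choose i)] \<cdot>\<^bsub>R\<^esub> \<one>\<^bsub>R\<^esub> else \<zero>\<^bsub>R\<^esub>)"
proof -
  have "dp_mult R (\<lambda>k. if k = i then \<one>\<^bsub>R\<^esub> else \<zero>\<^bsub>R\<^esub>) (\<lambda>k. if k = j then \<one>\<^bsub>R\<^esub> else \<zero>\<^bsub>R\<^esub>) n =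
      (\<Oplus>\<^bsub>R\<^esub>k\<in>{..n}. if i = k then (if n = i + j then [(n choose k)] \<cdot>\<^bsub>R\<^esub> \<one>\<^bsub>R\<^esub> else \<zero>\<^bsub>R\<^esub>) else \<zero>\<^bsub>R\<^esub>)"
    by (subst R.dp_mult_binomial) (auto intro!: R.finsum_cong')
  also have "\<dots> = (if n = i + j then [((i + j) choose i)] \<cdot>\<^bsub>R\<^esub> \<one>\<^bsub>R\<^esub> else \<zero>\<^bsub>R\<^esub>)"
  proof (cases "n = i + j")
    case True
    then show ?thesis by (simp add: R.finsum_singleton)
  next
    case False
    then have "(\<Oplus>\<^bsub>R\<^esub>k\<in>{..n}. if i = k then (if n = i + j then [(n choose k)] \<cdot>\<^bsub>R\<^esub> \<one>\<^bsub>R\<^esub> else \<zero>\<^bsub>R\<^esub>) else \<zero>\<^bsub>R\<^esub>) = (\<Oplus>\<^bsub>R\<^esub>k\<in>{..n}. \<zero>\<^bsub>R\<^esub>)"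
      by (intro R.finsum_cong') auto
    with False show ?thesis by simp
  qed
  finally show ?thesis .
qed

lemma gam_add_pow: "f \<in> seqs \<Longrightarrow> [(m::nat)] \<cdot>\<^bsub>gam N R\<^esub> gam_mk N R f = gam_mk N R (\<lambda>n. [m] \<cdot>\<^bsub>R\<^esub> f n)"
proof (induction m)
  case (Suc m)
  have "(\<lambda>n. [m] \<cdot>\<^bsub>R\<^esub> f n) \<in> seqs"
    using Suc.prems by (auto simp: seqs_iff)
  then show ?case using Suc by (simp add: gam_add)
qed (simp add: gam_zero)

lemma gam_univ_char: "gam_univ N R \<in> additive_chars (gam N R)"
proof -
  have "gam_univ N R i \<otimes>\<^bsub>gam N R\<^esub> gam_univ N R j = [((i + j) choose i)] \<cdot>\<^bsub>gam N R\<^esub> gam_univ N R (i + j)" for i j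
  proof (cases "i \<le> N \<and> j \<le> N")
    case True
    have "gam_univ N R i \<otimes>\<^bsub>gam N R\<^esub> gam_univ N R j =
        gam_mk N R (\<lambda>n. if n \<le> N then if n = i + j then [((i + j) choose i)] \<cdot>\<^bsub>R\<^esub> \<one>\<^bsub>R\<^esub> else \<zero>\<^bsub>R\<^esub> else \<zero>\<^bsub>R\<^esub>)"
      using True by (auto simp: gam_univ_def gam_mult delta_seqs dp_mult_delta intro!: arg_cong[of _ _ "gam_mk N R"])
    also have "\<dots> = [((i + j) choose i)] \<cdot>\<^bsub>gam N R\<^esub> gam_univ N R (i + j)"
    proof (cases "i + j \<le> N")
      case True
      then show ?thesis
        by (auto simp: gam_univ_def gam_add_pow delta_seqs intro!: arg_cong[of _ _ "gam_mk N R"])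
    next
      \<comment> \<open>Both factors survive the truncation but their product does not, in agreement
        with the value zero of \<open>gam_univ\<close> at i + j.\<close>
      case False
      then have "[((i + j) choose i)] \<cdot>\<^bsub>gam N R\<^esub> gam_univ N R (i + j) = gam_mk N R (\<lambda>n. \<zero>\<^bsub>R\<^esub>)"
        by (simp add: gam_univ_def gam_zero[symmetric])
      with False show ?thesis
        by (auto intro!: arg_cong[of _ _ "gam_mk N R"])
    qed
    finally show ?thesis .
  next
    case False
    then show ?thesis
      using gam_univ_closed by (auto simp: gam_univ_def[of N R "i + j"]) (auto simp: gam_univ_def[of N R i] gam_univ_def[of N R j] gam_mk_closed delta_seqs)
  qed
  moreover have "gam_univ N R 0 = \<one>\<^bsub>gam N R\<^esub>" "\<forall>n>N. gam_univ N R n = \<zero>\<^bsub>gam N R\<^esub>"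
    by (auto simp: gam_univ_def gam_one)
  ultimately show ?thesis
    by (auto simp: \<Gamma>.additive_chars_iff \<Gamma>.dp_seq_def \<Gamma>.carrier_UP_iff gam_univ_closed)
qed

lemma gam_lincomb:
  assumes c: "\<And>n. c n \<in> carrier R"
  shows "(\<Oplus>\<^bsub>gam N R\<^esub>n\<in>{..N}. gam_incl N R (c n) \<otimes>\<^bsub>gam N R\<^esub> gam_univ N R n) = gam_mk N R (\<lambda>i. if i \<le> N then c i else \<zero>\<^bsub>R\<^esub>)"
proof -
  have t: "gam_incl N R (c n) \<otimes>\<^bsub>gam N R\<^esub> gam_univ N R n = gam_mk N R (\<lambda>i. if i = n then c n else \<zero>\<^bsub>R\<^esub>)" if "n \<le> N" for n
    using c that
    by (auto simp: gam_incl_def gam_univ_def gam_mult delta_seqs R.dp_mult_scalar intro!: arg_cong[of _ _ "gam_mk N R"])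
  \<comment> \<open>The induction is on the length m of the sum, because N determines the algebra
    and has to stay fixed.\<close>
  have "m \<le> N \<Longrightarrow> (\<Oplus>\<^bsub>gam N R\<^esub>n\<in>{..m}. gam_incl N R (c n) \<otimes>\<^bsub>gam N R\<^esub> gam_univ N R n) = gam_mk N R (\<lambda>i. if i \<le> m then c i else \<zero>\<^bsub>R\<^esub>)" for m
  proof (induction m)
    case 0
    have "(\<Oplus>\<^bsub>gam N R\<^esub>n\<in>{..0}. gam_incl N R (c n) \<otimes>\<^bsub>gam N R\<^esub> gam_univ N R n) = gam_incl N R (c 0) \<otimes>\<^bsub>gam N R\<^esub> gam_univ N R 0"
      using c by (intro \<Gamma>.finsum_0) (auto simp: alg_hom_closed[OF gam_incl_alg_hom] gam_univ_closed)
    then show ?case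
      using t[of 0] by (simp cong: if_cong)
  next
    case (Suc m)
    have s: "(\<lambda>i. if i \<le> m then c i else \<zero>\<^bsub>R\<^esub>) \<in> seqs"
      using Suc.prems c by (auto simp: seqs_iff)
    have "(\<Oplus>\<^bsub>gam N R\<^esub>n\<in>{..Suc m}. gam_incl N R (c n) \<otimes>\<^bsub>gam N R\<^esub> gam_univ N R n) =
      gam_mk N R (\<lambda>i. if i = Suc m then c (Suc m) else \<zero>\<^bsub>R\<^esub>) \<oplus>\<^bsub>gam N R\<^esub> gam_mk N R (\<lambda>i. if i \<le> m then c i else \<zero>\<^bsub>R\<^esub>)"
      using Suc c t[of "Suc m"] by (simp add: alg_hom_closed[OF gam_incl_alg_hom] gam_univ_closed)
    also have "\<dots> = gam_mk N R (\<lambda>i. if i \<le> Suc m then c i else \<zero>\<^bsub>R\<^esub>)"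
      using s Suc.prems c by (auto simp: gam_add delta_seqs le_Suc_eq intro!: arg_cong[of _ _ "gam_mk N R"])
    finally show ?case .
  qed
  then show ?thesis by simp
qed

context
  fixes T \<phi> \<mu>
  assumes T: "T \<in> algs K" and \<phi>: "\<phi> \<in> alg_hom K R T" and \<mu>: "\<mu> \<in> additive_chars T"
    and \<mu>N: "\<And>n. n > N \<Longrightarrow> \<mu> n = \<zero>\<^bsub>T\<^esub>"
begin

interpretation T: algebra K T using algsD[OF T] .

lemma gam_eval_mk: "f \<in> seqs \<Longrightarrow> gam_eval N R T \<phi> \<mu> (gam_mk N R f) = (\<Oplus>\<^bsub>T\<^esub>n\<in>{..N}. \<phi> (f n) \<otimes>\<^bsub>T\<^esub> \<mu> n)"
  by (simp add: gam_eval_def gam_mk_closed gam_un_mk)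

lemma dp_mult_map:
  "\<lbrakk>\<And>n. f n \<in> carrier R; \<And>n. g n \<in> carrier R\<rbrakk> \<Longrightarrow> \<phi> (dp_mult R f g n) = dp_mult T (\<lambda>n. \<phi> (f n)) (\<lambda>n. \<phi> (g n)) n"
  by (induction n arbitrary: f g) (simp_all add: alg_hom_mult[OF \<phi>] alg_hom_add[OF \<phi>] R.dp_mult_closed)

lemma gam_eval_delta: "\<lbrakk>m \<le> N; r \<in> carrier R\<rbrakk> \<Longrightarrow> gam_eval N R T \<phi> \<mu> (gam_mk N R (\<lambda>i. if i = m then r else \<zero>\<^bsub>R\<^esub>)) = \<phi> r \<otimes>\<^bsub>T\<^esub> \<mu> m"
proof -
  assume m: "m \<le> N" "r \<in> carrier R"
  note c = additive_chars_closed[OF T \<mu>] alg_hom_closed[OF \<phi>]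
  have "gam_eval N R T \<phi> \<mu> (gam_mk N R (\<lambda>i. if i = m then r else \<zero>\<^bsub>R\<^esub>)) =
      (\<Oplus>\<^bsub>T\<^esub>n\<in>{..N}. if m = n then \<phi> r \<otimes>\<^bsub>T\<^esub> \<mu> n else \<zero>\<^bsub>T\<^esub>)"
    using m c alg_hom_zero[OF \<phi> R.is_cring T.is_cring]
    by (auto simp: gam_eval_mk delta_seqs intro!: T.finsum_cong')
  then show ?thesis
    using m c by (simp add: T.finsum_singleton)
qed

text \<open>The substitution z_n \<mapsto> \<mu>_n. It is multiplicative by
  \<open>dp_pairing_mult\<close> and respects the truncation because \<mu> vanishes beyond N.
  Together with \<open>gam_eval_incl\<close> and \<open>gam_eval_univ\<close> it shows that a
  character of degree at most N is the image of \<open>gam_univ N R\<close>.\<close>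

lemma gam_eval_alg_hom: "gam_eval N R T \<phi> \<mu> \<in> alg_hom K (gam N R) T"
proof (rule alg_homI)
  note c = additive_chars_closed[OF T \<mu>] alg_hom_closed[OF \<phi>]
  show "gam_eval N R T \<phi> \<mu> \<in> ring_hom (gam N R) T"
  proof (rule ring_hom_memI)
    fix x y assume "x \<in> carrier (gam N R)" "y \<in> carrier (gam N R)"
    then obtain f g where f: "f \<in> seqs" "x = gam_mk N R f" and g: "g \<in> seqs" "y = gam_mk N R g"
      by (auto simp: gam_carrier)
    then have fc: "\<And>n. f n \<in> carrier R" "\<And>n. g n \<in> carrier R"
      by (auto simp: seqs_iff)
    have "(\<lambda>n. if n \<le> N then dp_mult R f g n else \<zero>\<^bsub>R\<^esub>) \<in> seqs" "(\<lambda>n. f n \<oplus>\<^bsub>R\<^esub> g n) \<in> seqs"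
      using f g fc by (auto simp: seqs_iff R.dp_mult_closed)
    note s = this
    have "gam_eval N R T \<phi> \<mu> (x \<otimes>\<^bsub>gam N R\<^esub> y) = (\<Oplus>\<^bsub>T\<^esub>n\<in>{..N}. dp_mult T (\<lambda>n. \<phi> (f n)) (\<lambda>n. \<phi> (g n)) n \<otimes>\<^bsub>T\<^esub> \<mu> n)"
      using f g s fc c by (auto simp: gam_mult gam_eval_mk dp_mult_map T.dp_mult_closed intro!: T.finsum_cong')
    also have "\<dots> = gam_eval N R T \<phi> \<mu> x \<otimes>\<^bsub>T\<^esub> gam_eval N R T \<phi> \<mu> y"
      using f g fc c \<mu> \<mu>N by (simp add: gam_eval_mk T.dp_pairing_mult additive_chars_dp_seq[OF T])
    finally show "gam_eval N R T \<phi> \<mu> (x \<otimes>\<^bsub>gam N R\<^esub> y) = gam_eval N R T \<phi> \<mu> x \<otimes>\<^bsub>T\<^esub> gam_eval N R T \<phi> \<mu> y" .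
    have "gam_eval N R T \<phi> \<mu> (x \<oplus>\<^bsub>gam N R\<^esub> y) = (\<Oplus>\<^bsub>T\<^esub>n\<in>{..N}. \<phi> (f n) \<otimes>\<^bsub>T\<^esub> \<mu> n \<oplus>\<^bsub>T\<^esub> \<phi> (g n) \<otimes>\<^bsub>T\<^esub> \<mu> n)"
      using f g s fc c by (auto simp: gam_add gam_eval_mk alg_hom_add[OF \<phi>] T.l_distr intro!: T.finsum_cong')
    then show "gam_eval N R T \<phi> \<mu> (x \<oplus>\<^bsub>gam N R\<^esub> y) = gam_eval N R T \<phi> \<mu> x \<oplus>\<^bsub>T\<^esub> gam_eval N R T \<phi> \<mu> y"
      using f g fc c by (simp add: gam_eval_mk T.finsum_addf Pi_def)
  next
    fix x assume "x \<in> carrier (gam N R)"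
    then show "gam_eval N R T \<phi> \<mu> x \<in> carrier T"
      using c by (auto simp: gam_eval_def gam_un_closed intro!: T.finsum_closed)
  next
    show "gam_eval N R T \<phi> \<mu> \<one>\<^bsub>gam N R\<^esub> = \<one>\<^bsub>T\<^esub>"
      using gam_eval_delta[of 0 "\<one>\<^bsub>R\<^esub>"] by (simp add: gam_one alg_hom_one[OF \<phi>] additive_chars_0[OF T \<mu>])
  qed
  show "gam_eval N R T \<phi> \<mu> \<in> extensional (carrier (gam N R))"
    by (simp add: gam_eval_def)
  fix k x assume k: "k \<in> carrier K" and "x \<in> carrier (gam N R)"
  then obtain f where f: "f \<in> seqs" "x = gam_mk N R f"
    by (auto simp: gam_carrier)
  then have fc: "\<And>n. f n \<in> carrier R" and s: "(\<lambda>n. k \<odot>\<^bsub>R\<^esub> f n) \<in> seqs"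
    using k by (auto simp: seqs_iff)
  have k1: "k \<odot>\<^bsub>T\<^esub> \<one>\<^bsub>T\<^esub> \<in> carrier T" using k by simp
  have "gam_eval N R T \<phi> \<mu> (k \<odot>\<^bsub>gam N R\<^esub> x) = (\<Oplus>\<^bsub>T\<^esub>n\<in>{..N}. (k \<odot>\<^bsub>T\<^esub> \<one>\<^bsub>T\<^esub>) \<otimes>\<^bsub>T\<^esub> (\<phi> (f n) \<otimes>\<^bsub>T\<^esub> \<mu> n))"
    using f s k fc c by (auto simp: gam_smult gam_eval_mk alg_hom_smult[OF \<phi>] T.smult_assoc2 intro!: T.finsum_cong')
  also have "\<dots> = (k \<odot>\<^bsub>T\<^esub> \<one>\<^bsub>T\<^esub>) \<otimes>\<^bsub>T\<^esub> (\<Oplus>\<^bsub>T\<^esub>n\<in>{..N}. \<phi> (f n) \<otimes>\<^bsub>T\<^esub> \<mu> n)"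
    using k1 fc c by (intro T.finsum_rdistr[symmetric]) auto
  also have "\<dots> = k \<odot>\<^bsub>T\<^esub> gam_eval N R T \<phi> \<mu> x"
    using f k fc c by (simp add: gam_eval_mk T.smult_assoc2 T.finsum_closed Pi_def)
  finally show "gam_eval N R T \<phi> \<mu> (k \<odot>\<^bsub>gam N R\<^esub> x) = k \<odot>\<^bsub>T\<^esub> gam_eval N R T \<phi> \<mu> x" .
qed

lemma gam_eval_incl: "compose (carrier R) (gam_eval N R T \<phi> \<mu>) (gam_incl N R) = \<phi>"
proof (rule alg_hom_eqI[OF alg_hom_compose[OF gam_incl_alg_hom gam_eval_alg_hom R.algebra_axioms] \<phi>])
  fix x assume "x \<in> carrier R"
  then show "compose (carrier R) (gam_eval N R T \<phi> \<mu>) (gam_incl N R) x = \<phi> x"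
    using gam_eval_delta[of 0 x] alg_hom_closed[OF \<phi>] by (simp add: compose_eq_on gam_incl_def additive_chars_0[OF T \<mu>])
qed

lemma gam_eval_univ: "gam_eval N R T \<phi> \<mu> (gam_univ N R n) = \<mu> n"
proof (cases "n \<le> N")
  case True
  then show ?thesis
    using gam_eval_delta[of n "\<one>\<^bsub>R\<^esub>"] additive_chars_closed[OF T \<mu>] by (simp add: gam_univ_def alg_hom_one[OF \<phi>])
next
  case False
  then show ?thesis
    using alg_hom_zero[OF gam_eval_alg_hom \<Gamma>.is_cring T.is_cring] \<mu>N by (simp add: gam_univ_def)
qed

end

end

end

section \<open>Taylor expansion on the dual of the additive group\<close>

context universe
begin

lemma dual_num_finsum:
  assumes S: "S \<in> algs K" and f: "\<And>i. i \<in> A \<Longrightarrow> f i \<in> carrier S" and g: "\<And>i. i \<in> A \<Longrightarrow> g i \<in> carrier S"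
  shows "(\<Oplus>\<^bsub>dual_num S\<^esub>i\<in>A. mk_dual S (f i) (g i)) = mk_dual S (finsum S f A) (finsum S g A)"
proof -
  interpret S: cring S using algs_cring[OF S] .
  interpret D: cring "dual_num S" using algs_cring[OF dual_num_algs[OF S]] .
  show ?thesis
    using f g
  proof (induction A rule: infinite_finite_induct)
    case (insert a A)
    then show ?case
      by (simp add: S.finsum_insert D.finsum_insert Pi_def mk_dual_closed[OF S] dual_num_add[OF S] S.finsum_closed)
  qed (simp_all add: dual_num_zero[OF S])
qed

text \<open>The coefficients c_n in the expansion of h as the sum of c_n \<mu>_n, found by
  evaluating h at the universal character of degree N. By \<open>gam_coeff_eq\<close> the choice of
  N does not matter as long as n \<le> N.\<close>

definition gam_coeff :: "('u, 'u) module \<Rightarrow> nat \<Rightarrow> ('u, nat \<Rightarrow> 'u) fam \<Rightarrow> nat \<Rightarrow> 'u" where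
  "gam_coeff R N h = gam_un N R (h (gam N R, gam_incl N R) (gam_univ N R))"

context
  fixes R :: "('u, 'u) module"
  assumes R: "R \<in> algs K"
begin

lemma gam_univ_Ob: "gam_univ N R \<in> Ob Ga (gam N R)"
  using gam_univ_char[OF R] by (simp add: Ga_simps)

lemma gam_coeff_closed: "h \<in> Ga.F R \<Longrightarrow> gam_coeff R N h n \<in> carrier R"
  unfolding gam_coeff_def
  by (rule gam_un_closed[OF R]) (rule Ga.F_closed[OF R _ gam_algs[OF R] gam_incl_alg_hom[OF R] gam_univ_Ob])

text \<open>By naturality a function on the functor is determined by its values at the universal points.\<close>

lemma Ga_function_eq:
  assumes h: "h \<in> Ga.F R" and T: "T \<in> algs K" and \<phi>: "\<phi> \<in> alg_hom K R T" and \<mu>: "\<mu> \<in> additive_chars T"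
    and \<mu>N: "\<And>n. n > N \<Longrightarrow> \<mu> n = \<zero>\<^bsub>T\<^esub>"
  shows "h (T, \<phi>) \<mu> = (\<Oplus>\<^bsub>T\<^esub>n\<in>{..N}. \<phi> (gam_coeff R N h n) \<otimes>\<^bsub>T\<^esub> \<mu> n)"
proof -
  note ev = gam_eval_alg_hom[OF R T \<phi> \<mu> \<mu>N] gam_eval_incl[OF R T \<phi> \<mu> \<mu>N] gam_eval_univ[OF R T \<phi> \<mu> \<mu>N]
  let ?u = "gam_univ N R"
  have "h (T, compose (carrier R) (gam_eval N R T \<phi> \<mu>) (gam_incl N R)) (Mor Ga (gam N R) T (gam_eval N R T \<phi> \<mu>) ?u) =
      gam_eval N R T \<phi> \<mu> (h (gam N R, gam_incl N R) ?u)"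
    by (rule Ga.F_natural[OF R h gam_algs[OF R] gam_incl_alg_hom[OF R] gam_univ_Ob T ev(1)])
  also have "Mor Ga (gam N R) T (gam_eval N R T \<phi> \<mu>) ?u = \<mu>"
    by (simp add: Ga_simps ev(3))
  finally show ?thesis
    using Ga.F_closed[OF R h gam_algs[OF R] gam_incl_alg_hom[OF R] gam_univ_Ob]
    by (simp add: ev(2)) (simp add: gam_eval_def gam_coeff_def)
qed

lemma one_char: "\<one>\<^bsub>UP R\<^esub> \<in> additive_chars R"
  by (rule cring.additive_chars_one[OF algs_cring[OF R]])

lemma gam_coeff_0:
  assumes h: "h \<in> Ga.F R" shows "gam_coeff R N h 0 = h (R, \<lambda>r\<in>carrier R. r) \<one>\<^bsub>UP R\<^esub>"
proof -
  interpret R: algebra K R using algsD[OF R] .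
  note c = gam_coeff_closed[OF h]
  have 1: "\<one>\<^bsub>UP R\<^esub> n = (if n = 0 then \<one>\<^bsub>R\<^esub> else \<zero>\<^bsub>R\<^esub>)" for n
    by (simp add: UP_def)
  have "h (R, \<lambda>r\<in>carrier R. r) \<one>\<^bsub>UP R\<^esub> =
      (\<Oplus>\<^bsub>R\<^esub>n\<in>{..N}. (\<lambda>r\<in>carrier R. r) (gam_coeff R N h n) \<otimes>\<^bsub>R\<^esub> \<one>\<^bsub>UP R\<^esub> n)"
    using one_char by (intro Ga_function_eq[OF h R alg_hom_id]) (auto simp: 1 R.algebra_axioms)
  also have "\<dots> = (\<Oplus>\<^bsub>R\<^esub>n\<in>{..N}. if 0 = n then gam_coeff R N h n else \<zero>\<^bsub>R\<^esub>)"
    using c by (intro R.finsum_cong') (auto simp: 1)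
  also have "\<dots> = gam_coeff R N h 0"
    using c by (intro R.finsum_singleton) auto
  finally show ?thesis ..
qed

text \<open>
  The vector field sends the universal point \<open>\<Sum> z\<^sub>n x\<^sup>n\<close> to the point with coefficients
  \<open>z\<^sub>n + z\<^sub>n\<^sub>-\<^sub>1 \<epsilon>\<close>, so the derivation shifts coefficients.
\<close>

lemma gam_coeff_Suc:
  assumes h: "h \<in> Ga.F R" and n: "n \<le> N"
  shows "gam_coeff R (Suc N) h (Suc n) = gam_coeff R N (Ga.der R h) n"
proof -
  interpret R: algebra K R using algsD[OF R] .
  let ?G = "gam N R" and ?u = "gam_univ N R" and ?c = "gam_coeff R (Suc N) h"
  note G = gam_algs[OF R, of N]
  interpret G: algebra K ?G using algsD[OF G] .
  note c = gam_coeff_closed[OF h] and \<iota> = gam_incl_alg_hom[OF R, of N] and u = gam_univ_char[OF R, of N]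
  note cc = c alg_hom_closed[OF \<iota>] gam_univ_closed[OF R]
  let ?z = "h (dual_num ?G, compose (carrier R) (dual_incl ?G) (gam_incl N R)) (Ga_field ?G ?u)"
  let ?v = "\<lambda>n. if n = 0 then \<zero>\<^bsub>?G\<^esub> else ?u (n - 1)"
  \<comment> \<open>The field raises the degree of the universal character from N to N + 1, so the
    coefficients of h are required up to \<open>Suc N\<close>.\<close>
  have "?z = (\<Oplus>\<^bsub>dual_num ?G\<^esub>n\<in>{..Suc N}. compose (carrier R) (dual_incl ?G) (gam_incl N R) (?c n) \<otimes>\<^bsub>dual_num ?G\<^esub> Ga_field ?G ?u n)"
  proof (rule Ga_function_eq[OF h dual_num_algs[OF G] Ga.compose_incl(1)[OF R G \<iota>] Ga_field_char[OF G u]])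
    fix n assume "n > Suc N"
    then show "Ga_field ?G ?u n = \<zero>\<^bsub>dual_num ?G\<^esub>"
      by (cases n) (auto simp: Ga_field_eq[OF G u] dual_num_zero[OF G] gam_univ_def)
  qed
  also have "\<dots> = (\<Oplus>\<^bsub>dual_num ?G\<^esub>n\<in>{..Suc N}. mk_dual ?G (gam_incl N R (?c n) \<otimes>\<^bsub>?G\<^esub> ?u n) (gam_incl N R (?c n) \<otimes>\<^bsub>?G\<^esub> ?v n))"
  proof -
    interpret D: cring "dual_num ?G" using algs_cring[OF dual_num_algs[OF G]] .
    show ?thesis
    proof (rule D.finsum_cong')
      fix n
      have "?v n \<in> carrier ?G" using cc by simp
      then show "compose (carrier R) (dual_incl ?G) (gam_incl N R) (?c n) \<otimes>\<^bsub>dual_num ?G\<^esub> Ga_field ?G ?u n =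
          mk_dual ?G (gam_incl N R (?c n) \<otimes>\<^bsub>?G\<^esub> ?u n) (gam_incl N R (?c n) \<otimes>\<^bsub>?G\<^esub> ?v n)"
        using cc by (simp only: Ga_field_eq[OF G u] compose_eq_on dual_incl_def restrict_apply' dual_num_mult[OF G] G.zero_closed)
          (simp del: One_nat_def)
    qed (use cc in \<open>auto intro!: mk_dual_closed[OF G]\<close>)
  qed
  also have "\<dots> = mk_dual ?G (\<Oplus>\<^bsub>?G\<^esub>n\<in>{..Suc N}. gam_incl N R (?c n) \<otimes>\<^bsub>?G\<^esub> ?u n) (\<Oplus>\<^bsub>?G\<^esub>n\<in>{..Suc N}. gam_incl N R (?c n) \<otimes>\<^bsub>?G\<^esub> ?v n)"
    using cc by (intro dual_num_finsum[OF G]) auto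
  finally have "snd (un_dual ?G ?z) = (\<Oplus>\<^bsub>?G\<^esub>n\<in>{..Suc N}. gam_incl N R (?c n) \<otimes>\<^bsub>?G\<^esub> ?v n)"
    using cc by (simp add: G.finsum_closed Pi_def)
  also have "\<dots> = (\<Oplus>\<^bsub>?G\<^esub>n\<in>{..N}. gam_incl N R (?c (Suc n)) \<otimes>\<^bsub>?G\<^esub> ?u n)"
    using cc by (subst G.finsum_Suc2) (auto simp: G.finsum_closed Pi_def)
  also have "\<dots> = gam_mk N R (\<lambda>i. if i \<le> N then ?c (Suc i) else \<zero>\<^bsub>R\<^esub>)"
    by (rule gam_lincomb[OF R c])
  finally have "Ga.der R h (?G, gam_incl N R) ?u = gam_mk N R (\<lambda>i. if i \<le> N then ?c (Suc i) else \<zero>\<^bsub>R\<^esub>)"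
    using G \<iota> gam_univ_Ob by (simp add: Ga.der_def)
  then have "gam_coeff R N (Ga.der R h) = (\<lambda>i. if i \<le> N then ?c (Suc i) else \<zero>\<^bsub>R\<^esub>)"
    using c by (simp add: gam_coeff_def[of R N "Ga.der R h"] gam_un_mk[OF R] seqs_iff[OF R])
  then show ?thesis using n by simp
qed

text \<open>Each derivation lowers both the index and the truncation by one. After n steps the
  coefficient of index 0 is left, which is the value at the trivial character.\<close>

lemma gam_coeff_eq:
  "\<lbrakk>h \<in> Ga.F R; n \<le> N\<rbrakk> \<Longrightarrow> gam_coeff R N h n = (Ga.der R ^^ n) h (R, \<lambda>r\<in>carrier R. r) \<one>\<^bsub>UP R\<^esub>"
proof (induction n arbitrary: h N)
  case 0
  then show ?case using gam_coeff_0 by (simp only: funpow.simps id_apply)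
next
  case (Suc n)
  then obtain M where M: "N = Suc M" "n \<le> M" by (cases N) auto
  then show ?case
    using Suc.IH[OF Ga.der_closed[OF R Suc.prems(1)] M(2)] gam_coeff_Suc[OF Suc.prems(1) M(2)]
    by (simp add: funpow_swap1)
qed

text \<open>A function on the dual of the additive group is thus known from its iterated derivatives
  at 1. Every uniqueness statement about maps out of \<open>Ga_dual\<close> is reduced to
  this.\<close>

theorem Ga_taylor:
  assumes h: "h \<in> Ga.F R" and \<mu>: "\<mu> \<in> additive_chars R" and \<mu>N: "\<And>n. n > N \<Longrightarrow> \<mu> n = \<zero>\<^bsub>R\<^esub>"
  shows "h (R, \<lambda>r\<in>carrier R. r) \<mu> =
    (\<Oplus>\<^bsub>R\<^esub>n\<in>{..N}. (Ga.der R ^^ n) h (R, \<lambda>r\<in>carrier R. r) \<one>\<^bsub>UP R\<^esub> \<otimes>\<^bsub>R\<^esub> \<mu> n)"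
proof -
  interpret R: algebra K R using algsD[OF R] .
  have "h (R, \<lambda>r\<in>carrier R. r) \<mu> = (\<Oplus>\<^bsub>R\<^esub>n\<in>{..N}. (\<lambda>r\<in>carrier R. r) (gam_coeff R N h n) \<otimes>\<^bsub>R\<^esub> \<mu> n)"
    by (rule Ga_function_eq[OF h R alg_hom_id[OF R.algebra_axioms] \<mu> \<mu>N])
  also have "\<dots> = (\<Oplus>\<^bsub>R\<^esub>n\<in>{..N}. (Ga.der R ^^ n) h (R, \<lambda>r\<in>carrier R. r) \<one>\<^bsub>UP R\<^esub> \<otimes>\<^bsub>R\<^esub> \<mu> n)"
  proof (rule R.finsum_cong')
    fix n assume "n \<in> {..N}"
    then show "(\<lambda>r\<in>carrier R. r) (gam_coeff R N h n) \<otimes>\<^bsub>R\<^esub> \<mu> n =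
        (Ga.der R ^^ n) h (R, \<lambda>r\<in>carrier R. r) \<one>\<^bsub>UP R\<^esub> \<otimes>\<^bsub>R\<^esub> \<mu> n"
      unfolding restrict_apply'[OF gam_coeff_closed[OF h]] by (simp only: gam_coeff_eq[OF h] atMost_iff)
  next
    have "(Ga.der R ^^ n) h (R, \<lambda>r\<in>carrier R. r) \<one>\<^bsub>UP R\<^esub> \<in> carrier R" for n
      using one_char by (intro Ga.F_closed[OF R Ga.der_pow_closed[OF R h] R alg_hom_id[OF R.algebra_axioms]]) (simp add: Ga_simps)
    then show "(\<lambda>n. (Ga.der R ^^ n) h (R, \<lambda>r\<in>carrier R. r) \<one>\<^bsub>UP R\<^esub> \<otimes>\<^bsub>R\<^esub> \<mu> n) \<in> {..N} \<rightarrow> carrier R"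
      using additive_chars_closed[OF R \<mu>] by auto
  qed simp
  finally show ?thesis .
qed

end

end

section \<open>Invariant vector fields\<close>

lemma (in universe) dual_map_compose:
  assumes R: "R \<in> algs K" and S: "S \<in> algs K" and T: "T \<in> algs K"
    and \<phi>: "\<phi> \<in> alg_hom K R S" and \<psi>: "\<psi> \<in> alg_hom K S T"
  shows "compose (carrier (dual_num R)) (dual_map S T \<psi>) (dual_map R S \<phi>) = dual_map R T (compose (carrier R) \<psi> \<phi>)"
  using alg_hom_closed[OF \<phi>]
  by (auto simp: compose_def fun_eq_iff dual_num_carrier[OF R] dual_map_mk[OF R] dual_map_mk[OF S])
    (auto simp: dual_map_def dual_num_carrier[OF R])

lemma (in universe) dual_map_id:
  assumes S: "S \<in> algs K" shows "dual_map S S (\<lambda>s\<in>carrier S. s) = (\<lambda>z\<in>carrier (dual_num S). z)"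
  using mk_un_dual[OF S] un_dual_closed[OF S] by (auto simp: dual_map_def fun_eq_iff)

locale group_scheme_like = universe K for K :: "('u, 'm) ring_scheme" +
  fixes G :: "('u, ('x, 'z) monoid_scheme, 'x) kfunctor"
  assumes G: "group_functor K G"
begin

abbreviation "B \<equiv> base_alg K"
abbreviation "pt S \<equiv> carrier (Ob G S)"
abbreviation "mul S \<equiv> monoid.mult (Ob G S)"
abbreviation "e S \<equiv> one (Ob G S)"

lemmas B_algs = base_alg_in_algs[OF K]

lemma underlying_simps [simp]: "Ob (underlying G) S = pt S" "Mor (underlying G) = Mor G"
  by (simp_all add: underlying_def)

lemma G_functor: "set_functor K (underlying G)"
  using G by (simp add: group_functor_def)

lemma G_group: "S \<in> algs K \<Longrightarrow> group (Ob G S)"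
  using G by (simp add: group_functor_def)

lemma G_monoid: "S \<in> algs K \<Longrightarrow> monoid (Ob G S)"
  using G_group by (simp add: group_def)

lemma G_hom: "\<lbrakk>S \<in> algs K; T \<in> algs K; \<phi> \<in> alg_hom K S T\<rbrakk> \<Longrightarrow> Mor G S T \<phi> \<in> hom (Ob G S) (Ob G T)"
  using G by (simp add: group_functor_def)

lemma G_closed: "\<lbrakk>S \<in> algs K; T \<in> algs K; \<phi> \<in> alg_hom K S T; x \<in> pt S\<rbrakk> \<Longrightarrow> Mor G S T \<phi> x \<in> pt T"
  using set_functor_closed[OF G_functor, of S T \<phi> x] by simp

lemma G_id: "\<lbrakk>S \<in> algs K; x \<in> pt S\<rbrakk> \<Longrightarrow> Mor G S S (\<lambda>s\<in>carrier S. s) x = x"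
  using set_functor_id[OF G_functor, of S x] by simp

lemma G_compose:
  "\<lbrakk>R \<in> algs K; S \<in> algs K; T \<in> algs K; \<phi> \<in> alg_hom K R S; \<psi> \<in> alg_hom K S T; x \<in> pt R\<rbrakk> \<Longrightarrow>
    Mor G S T \<psi> (Mor G R S \<phi> x) = Mor G R T (compose (carrier R) \<psi> \<phi>) x"
  using set_functor_compose[OF G_functor, of R S T \<phi> \<psi> x] by simp

lemma G_mult:
  "\<lbrakk>S \<in> algs K; T \<in> algs K; \<phi> \<in> alg_hom K S T; x \<in> pt S; y \<in> pt S\<rbrakk> \<Longrightarrow>
    Mor G S T \<phi> (mul S x y) = mul T (Mor G S T \<phi> x) (Mor G S T \<phi> y)"
  by (rule hom_mult[OF G_hom])

lemma G_one: "\<lbrakk>S \<in> algs K; T \<in> algs K; \<phi> \<in> alg_hom K S T\<rbrakk> \<Longrightarrow> Mor G S T \<phi> (e S) = e T"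
  by (rule hom_one[OF G_hom G_group G_group])

lemma mul_closed: "\<lbrakk>S \<in> algs K; x \<in> pt S; y \<in> pt S\<rbrakk> \<Longrightarrow> mul S x y \<in> pt S"
  by (rule monoid.m_closed[OF G_monoid])

lemma e_closed: "S \<in> algs K \<Longrightarrow> e S \<in> pt S"
  by (rule monoid.one_closed[OF G_monoid])

definition Te :: "'x set" where
  "Te = tangent (underlying G) B (e B)"

lemma Te_iff: "v \<in> Te \<longleftrightarrow> v \<in> pt (dual_num B) \<and> Mor G (dual_num B) B (dual_proj B) v = e B"
  by (simp add: Te_def tangent_def)

definition base_change :: "'x \<Rightarrow> ('u, 'u) module \<Rightarrow> 'x" where
  "base_change v S = Mor G (dual_num B) (dual_num S) (dual_map B S (struct_map K S)) v"

definition inv_field :: "'x \<Rightarrow> ('u, 'u) module \<Rightarrow> 'x \<Rightarrow> 'x" where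
  "inv_field v S g = mul (dual_num S) (Mor G S (dual_num S) (dual_incl S) g) (base_change v S)"

lemma struct_map_natural:
  assumes "S \<in> algs K" "T \<in> algs K" "\<phi> \<in> alg_hom K S T"
  shows "compose (carrier B) \<phi> (struct_map K S) = struct_map K T"
  using assms alg_hom_compose[OF struct_map_alg_hom[OF assms(1)] assms(3) algsD[OF B_algs]]
  by (intro alg_hom_base_unique[OF _ _ K])

context
  fixes v assumes v: "v \<in> Te"
begin

lemma v_closed: "v \<in> pt (dual_num B)"
  using v by (simp add: Te_iff)

lemma struct_dual: "S \<in> algs K \<Longrightarrow> dual_map B S (struct_map K S) \<in> alg_hom K (dual_num B) (dual_num S)"
  by (rule dual_map_alg_hom[OF B_algs _ struct_map_alg_hom])

lemma base_change_closed: "S \<in> algs K \<Longrightarrow> base_change v S \<in> pt (dual_num S)"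
  unfolding base_change_def by (rule G_closed[OF dual_num_algs[OF B_algs] dual_num_algs struct_dual v_closed])

lemma base_change_natural:
  assumes S: "S \<in> algs K" and T: "T \<in> algs K" and \<phi>: "\<phi> \<in> alg_hom K S T"
  shows "Mor G (dual_num S) (dual_num T) (dual_map S T \<phi>) (base_change v S) = base_change v T"
proof -
  have "Mor G (dual_num S) (dual_num T) (dual_map S T \<phi>) (base_change v S) =
      Mor G (dual_num B) (dual_num T) (compose (carrier (dual_num B)) (dual_map S T \<phi>) (dual_map B S (struct_map K S))) v"
    unfolding base_change_def
    by (rule G_compose[OF dual_num_algs[OF B_algs] dual_num_algs[OF S] dual_num_algs[OF T] struct_dual[OF S]
          dual_map_alg_hom[OF S T \<phi>] v_closed])
  then show ?thesis
    by (simp add: dual_map_compose[OF B_algs S T struct_map_alg_hom[OF S] \<phi>] struct_map_natural[OF S T \<phi>, unfolded carrier_base_alg] base_change_def)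
qed

lemma base_change_proj:
  assumes S: "S \<in> algs K" shows "Mor G (dual_num S) S (dual_proj S) (base_change v S) = e S"
proof -
  note s = struct_map_alg_hom[OF S]
  have "Mor G (dual_num S) S (dual_proj S) (base_change v S) =
      Mor G (dual_num B) S (compose (carrier (dual_num B)) (dual_proj S) (dual_map B S (struct_map K S))) v"
    unfolding base_change_def
    by (rule G_compose[OF dual_num_algs[OF B_algs] dual_num_algs[OF S] S struct_dual[OF S] dual_proj_alg_hom[OF S] v_closed])
  also have "\<dots> = Mor G B S (struct_map K S) (Mor G (dual_num B) B (dual_proj B) v)"
    by (simp add: dual_map_proj[OF B_algs S s]
        G_compose[OF dual_num_algs[OF B_algs] B_algs S dual_proj_alg_hom[OF B_algs] s v_closed])
  also have "\<dots> = e S"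
    using v by (simp add: Te_iff G_one[OF B_algs S s])
  finally show ?thesis .
qed

lemma base_change_base: "base_change v B = v"
proof -
  have "struct_map K B = (\<lambda>k\<in>carrier B. k)"
    by (rule alg_hom_base_unique[OF alg_hom_id[OF algsD[OF B_algs]] B_algs K, symmetric])
  then show ?thesis
    by (simp only: base_change_def dual_map_id[OF B_algs] G_id[OF dual_num_algs[OF B_algs] v_closed])
qed

lemma inv_field_closed: "\<lbrakk>S \<in> algs K; g \<in> pt S\<rbrakk> \<Longrightarrow> inv_field v S g \<in> pt (dual_num S)"
  unfolding inv_field_def
  by (intro mul_closed[OF dual_num_algs] base_change_closed G_closed[OF _ dual_num_algs dual_incl_alg_hom])

lemma inv_field_proj:
  assumes S: "S \<in> algs K" and g: "g \<in> pt S"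
  shows "Mor G (dual_num S) S (dual_proj S) (inv_field v S g) = g"
proof -
  note D = dual_num_algs[OF S] and i = dual_incl_alg_hom[OF S] and p = dual_proj_alg_hom[OF S]
  have "Mor G (dual_num S) S (dual_proj S) (Mor G S (dual_num S) (dual_incl S) g) = g"
    by (simp add: G_compose[OF S D S i p g] dual_proj_incl[OF S] G_id[OF S g])
  then show ?thesis
    unfolding inv_field_def
    by (simp add: G_mult[OF D S p G_closed[OF S D i g] base_change_closed[OF S]] base_change_proj[OF S]
        monoid.r_one[OF G_monoid[OF S] g])
qed

lemma inv_field_natural:
  assumes S: "S \<in> algs K" and T: "T \<in> algs K" and \<phi>: "\<phi> \<in> alg_hom K S T" and g: "g \<in> pt S"
  shows "Mor G (dual_num S) (dual_num T) (dual_map S T \<phi>) (inv_field v S g) = inv_field v T (Mor G S T \<phi> g)"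
proof -
  note DS = dual_num_algs[OF S] and DT = dual_num_algs[OF T] and d = dual_map_alg_hom[OF S T \<phi>]
    and iS = dual_incl_alg_hom[OF S] and iT = dual_incl_alg_hom[OF T]
  have "Mor G (dual_num S) (dual_num T) (dual_map S T \<phi>) (Mor G S (dual_num S) (dual_incl S) g) =
      Mor G T (dual_num T) (dual_incl T) (Mor G S T \<phi> g)"
    by (simp add: G_compose[OF S DS DT iS d g] G_compose[OF S T DT \<phi> iT g] dual_map_incl[OF S T \<phi>])
  then show ?thesis
    unfolding inv_field_def
    by (simp add: G_mult[OF DS DT d G_closed[OF S DS iS g] base_change_closed[OF S]] base_change_natural[OF S T \<phi>])
qed

lemma inv_field_invariant:
  assumes S: "S \<in> algs K" and g: "g \<in> pt S" and h: "h \<in> pt S"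
  shows "mul (dual_num S) (Mor G S (dual_num S) (dual_incl S) h) (inv_field v S g) = inv_field v S (mul S h g)"
proof -
  note D = dual_num_algs[OF S] and i = dual_incl_alg_hom[OF S]
  show ?thesis
    unfolding inv_field_def
    by (simp add: G_mult[OF S D i h g] monoid.m_assoc[OF G_monoid[OF D] G_closed[OF S D i h] G_closed[OF S D i g] base_change_closed[OF S]])
qed

lemma inv_field_one:
  assumes S: "S \<in> algs K" shows "inv_field v S (e S) = base_change v S"
proof -
  note D = dual_num_algs[OF S] and i = dual_incl_alg_hom[OF S]
  show ?thesis
    unfolding inv_field_def by (simp add: G_one[OF S D i] monoid.l_one[OF G_monoid[OF D] base_change_closed[OF S]])
qed

end

text \<open>Apply invariance to g = g e. The value at the identity over S is the base change of the
  value over K, by naturality along the structure map.\<close>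

lemma Derinv_eq_inv_field:
  assumes D: "D \<in> Derinv K G" and S: "S \<in> algs K" and g: "g \<in> pt S"
  shows "D S g = inv_field (D B (e B)) S g"
proof -
  note s = struct_map_alg_hom[OF S]
  have nat: "D T (Mor G R T \<phi> x) = Mor G (dual_num R) (dual_num T) (dual_map R T \<phi>) (D R x)"
    if "R \<in> algs K" "T \<in> algs K" "\<phi> \<in> alg_hom K R T" "x \<in> pt R" for R T \<phi> x
    using D that by (simp add: Derinv_def vector_fields_def)
  have "D S g = D S (mul S g (e S))"
    by (simp add: monoid.r_one[OF G_monoid[OF S] g])
  also have "\<dots> = mul (dual_num S) (Mor G S (dual_num S) (dual_incl S) g) (D S (e S))"
    using D S g e_closed[OF S] by (simp add: Derinv_def)
  also have "D S (e S) = base_change (D B (e B)) S"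
    using nat[OF B_algs S s e_closed[OF B_algs]] by (simp add: G_one[OF B_algs S s] base_change_def)
  finally show ?thesis by (simp add: inv_field_def)
qed

theorem Derinv_bij: "bij_betw (\<lambda>D. D B (e B)) (Derinv K G) Te"
proof (rule bij_betwI')
  fix D D' assume D: "D \<in> Derinv K G" and D': "D' \<in> Derinv K G"
  show "(D B (e B) = D' B (e B)) = (D = D')"
  proof
    assume eq: "D B (e B) = D' B (e B)"
    have ext: "D \<in> (\<Pi>\<^sub>E S\<in>algs K. \<Pi>\<^sub>E x\<in>pt S. tangent (underlying G) S x)" "D' \<in> (\<Pi>\<^sub>E S\<in>algs K. \<Pi>\<^sub>E x\<in>pt S. tangent (underlying G) S x)"
      using D D' by (simp_all add: Derinv_def vector_fields_def)
    show "D = D'"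
    proof (rule PiE_ext[OF ext])
      fix S assume S: "S \<in> algs K"
      show "D S = D' S"
      proof (rule PiE_ext)
        show "D S \<in> (\<Pi>\<^sub>E x\<in>pt S. tangent (underlying G) S x)" "D' S \<in> (\<Pi>\<^sub>E x\<in>pt S. tangent (underlying G) S x)"
          using ext S by (auto simp only: PiE_iff)
        fix x assume "x \<in> pt S"
        then show "D S x = D' S x"
          using Derinv_eq_inv_field[OF D S] Derinv_eq_inv_field[OF D' S] eq by simp
      qed
    qed
  qed simp
next
  fix D assume "D \<in> Derinv K G"
  then have "D \<in> (\<Pi>\<^sub>E S\<in>algs K. \<Pi>\<^sub>E x\<in>pt S. tangent (underlying G) S x)"
    by (simp add: Derinv_def vector_fields_def)
  then show "D B (e B) \<in> Te"
    unfolding Te_def using B_algs e_closed[OF B_algs] by (meson PiE_mem)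
next
  fix v assume v: "v \<in> Te"
  \<comment> \<open>The restrictions are there because vector fields are extensional
    families.\<close>
  define D where "D = (\<lambda>S\<in>algs K. \<lambda>g\<in>pt S. inv_field v S g)"
  have "D \<in> Derinv K G"
    by (auto simp: D_def Derinv_def vector_fields_def tangent_def inv_field_closed[OF v] inv_field_proj[OF v]
        inv_field_natural[OF v] inv_field_invariant[OF v] G_closed mul_closed)
  moreover have "D B (e B) = v"
    using B_algs e_closed[OF B_algs] by (simp add: D_def inv_field_one[OF v B_algs] base_change_base[OF v])
  ultimately show "\<exists>D\<in>Derinv K G. v = D B (e B)"
    by metis
qed

end

section \<open>Exponentials of tangent vectors\<close>

text \<open>Summing over the support avoids the choice of a degree bound; characters have finite
  support. With c_n = (D^n a)(e) this is the exponential series.\<close>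

definition pairing :: "('a, 'm) ring_scheme \<Rightarrow> (nat \<Rightarrow> 'a) \<Rightarrow> (nat \<Rightarrow> 'a) \<Rightarrow> 'a" where
  "pairing R c \<mu> = (\<Oplus>\<^bsub>R\<^esub>n\<in>{n. \<mu> n \<noteq> \<zero>\<^bsub>R\<^esub>}. c n \<otimes>\<^bsub>R\<^esub> \<mu> n)"

context cring
begin

lemma pairing_eq:
  assumes c: "\<And>n. c n \<in> carrier R" and \<mu>: "\<And>n. \<mu> n \<in> carrier R" "\<And>n. n > N \<Longrightarrow> \<mu> n = \<zero>"
  shows "pairing R c \<mu> = (\<Oplus>n\<in>{..N}. c n \<otimes> \<mu> n)"
  unfolding pairing_def
  by (rule finsum_extend_zero[symmetric]) (use assms in \<open>auto simp: not_le[symmetric]\<close>)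

text \<open>The new sequence consists of the coefficients of \<mu>(x) (1 + u x). Moving the index
  shift from \<mu> to c turns multiplication by 1 + u x into one more derivative on the side of the
  functions.\<close>

lemma pairing_shift:
  assumes c: "\<And>n. c n \<in> carrier R" and \<mu>: "\<And>n. \<mu> n \<in> carrier R" "\<And>n. n > N \<Longrightarrow> \<mu> n = \<zero>"
    and u: "u \<in> carrier R"
  shows "pairing R c (\<lambda>n. \<mu> n \<oplus> (if n = 0 then \<zero> else \<mu> (n - 1)) \<otimes> u) =
    pairing R c \<mu> \<oplus> pairing R (\<lambda>n. c (Suc n)) \<mu> \<otimes> u"
proof -
  let ?v = "\<lambda>n. if n = 0 then \<zero> else \<mu> (n - 1)"
  have v: "?v n \<in> carrier R" for n using \<mu> by simp
  have "pairing R c (\<lambda>n. \<mu> n \<oplus> ?v n \<otimes> u) = (\<Oplus>n\<in>{..Suc N}. c n \<otimes> (\<mu> n \<oplus> ?v n \<otimes> u))"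
    by (rule pairing_eq) (use c \<mu> u in auto)
  also have "\<dots> = (\<Oplus>n\<in>{..Suc N}. c n \<otimes> \<mu> n \<oplus> c n \<otimes> ?v n \<otimes> u)"
    using c \<mu> u v by (intro finsum_cong') (auto simp: r_distr m_assoc)
  also have "\<dots> = (\<Oplus>n\<in>{..Suc N}. c n \<otimes> \<mu> n) \<oplus> (\<Oplus>n\<in>{..Suc N}. c n \<otimes> ?v n \<otimes> u)"
    using c \<mu> u v by (intro finsum_addf) auto
  also have "(\<Oplus>n\<in>{..Suc N}. c n \<otimes> \<mu> n) = pairing R c \<mu>"
    using c \<mu> by (intro pairing_eq[symmetric]) auto
  also have "(\<Oplus>n\<in>{..Suc N}. c n \<otimes> ?v n \<otimes> u) = (\<Oplus>n\<in>{..Suc N}. c n \<otimes> ?v n) \<otimes> u"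
    using c \<mu> u v by (intro finsum_ldistr[symmetric]) auto
  also have "(\<Oplus>n\<in>{..Suc N}. c n \<otimes> ?v n) = (\<Oplus>n\<in>{..N}. c (Suc n) \<otimes> \<mu> n)"
    using c \<mu> by (subst finsum_Suc2) auto
  also have "\<dots> = pairing R (\<lambda>n. c (Suc n)) \<mu>"
    using c \<mu> by (intro pairing_eq[symmetric]) auto
  finally show ?thesis .
qed

text \<open>By repeated use of the relation the k-th power of \<mu>_n is an integral multiple of
  \<mu>_(k n), which vanishes as soon as k n exceeds the degree.\<close>

lemma dp_seq_nilpotent:
  assumes \<mu>: "dp_seq \<mu>" and n: "n > 0" shows "\<mu> n \<in> nilpotents"
proof -
  have c: "\<mu> k \<in> carrier R" for k
    using \<mu> by (simp add: dp_seq_def carrier_UP_iff)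
  obtain N where N: "\<mu> k = \<zero>" if "k > N" for k
    using \<mu> by (auto simp: dp_seq_def carrier_UP_iff)
  have "\<exists>m::nat. \<mu> n [^] k = [m] \<cdot> \<mu> (k * n)" for k :: nat
  proof (induction k)
    case 0
    show ?case using \<mu> by (intro exI[of _ 1]) (simp add: dp_seq_def)
  next
    case (Suc k)
    then obtain m :: nat where "\<mu> n [^] k = [m] \<cdot> \<mu> (k * n)" by blast
    then have "\<mu> n [^] Suc k = [m] \<cdot> (\<mu> (k * n) \<otimes> \<mu> n)"
      using c by (simp add: add_pow_ldistr)
    also have "\<mu> (k * n) \<otimes> \<mu> n = [((k * n + n) choose (k * n))] \<cdot> \<mu> (k * n + n)"
      using \<mu> by (simp add: dp_seq_def)
    finally have "\<mu> n [^] Suc k = [(((k * n + n) choose (k * n)) * m)] \<cdot> \<mu> (Suc k * n)"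
      using c by (simp add: add.nat_pow_pow add.commute)
    then show ?case by blast
  qed
  then obtain m :: nat where "\<mu> n [^] Suc N = [m] \<cdot> \<mu> (Suc N * n)" by blast
  moreover have "Suc N * n > N"
    using n by (cases n) auto
  ultimately have "\<mu> n [^] Suc N = \<zero>"
    using N by simp
  then show ?thesis
    unfolding nilpotents_def using c by blast
qed

end

section \<open>Homomorphisms of group functors\<close>

lemma hom_grp_closed:
  "\<lbrakk>f \<in> hom_grp K A A'; S \<in> algs K; x \<in> carrier (Ob A S)\<rbrakk> \<Longrightarrow> f S x \<in> carrier (Ob A' S)"
  by (auto simp: hom_grp_def hom_def)

lemma hom_grp_natural:
  "\<lbrakk>f \<in> hom_grp K A A'; S \<in> algs K; T \<in> algs K; \<phi> \<in> alg_hom K S T; x \<in> carrier (Ob A S)\<rbrakk> \<Longrightarrow>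
    f T (Mor A S T \<phi> x) = Mor A' S T \<phi> (f S x)"
  by (auto simp: hom_grp_def)

lemma hom_grp_mult:
  "\<lbrakk>f \<in> hom_grp K A A'; S \<in> algs K; x \<in> carrier (Ob A S); y \<in> carrier (Ob A S)\<rbrakk> \<Longrightarrow>
    f S (x \<otimes>\<^bsub>Ob A S\<^esub> y) = f S x \<otimes>\<^bsub>Ob A' S\<^esub> f S y"
  by (auto simp: hom_grp_def hom_def)

lemma hom_grp_eqI:
  assumes "f \<in> hom_grp K A A'" "f' \<in> hom_grp K A A'"
    and "\<And>S x. \<lbrakk>S \<in> algs K; x \<in> carrier (Ob A S)\<rbrakk> \<Longrightarrow> f S x = f' S x"
  shows "f = f'"
proof (rule PiE_ext)
  show "f \<in> (\<Pi>\<^sub>E S\<in>algs K. hom (Ob A S) (Ob A' S) \<inter> extensional (carrier (Ob A S)))"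
    "f' \<in> (\<Pi>\<^sub>E S\<in>algs K. hom (Ob A S) (Ob A' S) \<inter> extensional (carrier (Ob A S)))"
    using assms(1,2) by (simp_all add: hom_grp_def)
  fix S assume S: "S \<in> algs K"
  have "f S \<in> extensional (carrier (Ob A S))" "f' S \<in> extensional (carrier (Ob A S))"
    using assms(1,2) S by (auto simp: hom_grp_def)
  then show "f S = f' S"
    using assms(3)[OF S] by (rule extensionalityI)
qed

lemma (in universe) Ga_one_mult: "\<lbrakk>S \<in> algs K; \<mu> \<in> additive_chars S\<rbrakk> \<Longrightarrow> \<mu> \<otimes>\<^bsub>UP S\<^esub> \<one>\<^bsub>UP S\<^esub> = \<mu>"
proof -
  assume S: "S \<in> algs K" and \<mu>: "\<mu> \<in> additive_chars S"
  interpret S: cring S using algs_cring[OF S] .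
  interpret P: UP_cring S "UP S" by unfold_locales
  show ?thesis using additive_chars_UP[OF S \<mu>] by (rule P.r_one)
qed

context group_scheme_like
begin

text \<open>The image of the trivial character is idempotent, and the only idempotent of a group is
  its identity.\<close>

lemma hom_one_eq:
  assumes f: "f \<in> hom_grp K Ga_dual G" and S: "S \<in> algs K" shows "f S \<one>\<^bsub>UP S\<^esub> = e S"
proof -
  interpret group "Ob G S" by (rule G_group[OF S])
  have one: "\<one>\<^bsub>UP S\<^esub> \<in> carrier (Ob Ga_dual S)"
    using one_char[OF S] by (simp add: Ga_simps)
  have "f S \<one>\<^bsub>UP S\<^esub> \<in> pt S"
    by (rule hom_grp_closed[OF f S one])
  moreover have "mul S (f S \<one>\<^bsub>UP S\<^esub>) (f S \<one>\<^bsub>UP S\<^esub>) = f S \<one>\<^bsub>UP S\<^esub>"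
    using hom_grp_mult[OF f S one one] Ga_one_mult[OF S one_char[OF S]] by (simp add: Ga_simps)
  ultimately show ?thesis
    using l_cancel_one by blast
qed

text \<open>Under \<epsilon> \<mapsto> 0 the character 1 + \<epsilon> x becomes trivial, so by
  naturality its image reduces to the identity.\<close>

lemma hom_value_Te:
  assumes f: "f \<in> hom_grp K Ga_dual G" shows "f (dual_num B) (one_plus_eps B) \<in> Te"
proof -
  note D = dual_num_algs[OF B_algs] and p = dual_proj_alg_hom[OF B_algs] and o = one_plus_eps_char[OF B_algs]
  interpret B: cring B by (rule algs_cring[OF B_algs])
  have "(\<lambda>n. dual_proj B (one_plus_eps B n)) = \<one>\<^bsub>UP B\<^esub>"
    by (auto simp: one_plus_eps_def eps_def UP_def dual_num_one[OF B_algs] dual_num_zero[OF B_algs] dual_proj_mk[OF B_algs] fun_eq_iff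
        simp del: carrier_base_alg)
  then have "Mor G (dual_num B) B (dual_proj B) (f (dual_num B) (one_plus_eps B)) = e B"
    using hom_grp_natural[OF f D B_algs p, of "one_plus_eps B"] o by (simp add: Ga_simps hom_one_eq[OF f B_algs])
  then show ?thesis
    using hom_grp_closed[OF f D, of "one_plus_eps B"] o by (simp add: Te_iff Ga_simps)
qed

end

text \<open>U is a part of G around the identity in which functions are to be evaluated. Condition
  \<open>U_nil\<close> says that membership in U can be tested modulo nilpotents; it keeps the
  invariant field and the maps out of \<open>Ga_dual\<close> inside U.\<close>

locale exponential = group_scheme_like K G for K :: "('u, 'm) ring_scheme" and G :: "('u, ('x, 'z) monoid_scheme, 'x) kfunctor" +
  fixes v :: 'x and U :: "('u, 'u) module \<Rightarrow> 'x set"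
  assumes v: "v \<in> Te"
    and U_sub: "\<And>S x. \<lbrakk>S \<in> algs K; x \<in> U S\<rbrakk> \<Longrightarrow> x \<in> pt S"
    and U_mor: "\<And>S T \<phi> x. \<lbrakk>S \<in> algs K; T \<in> algs K; \<phi> \<in> alg_hom K S T; x \<in> U S\<rbrakk> \<Longrightarrow> Mor G S T \<phi> x \<in> U T"
    and U_one: "e B \<in> U B"
    and U_nil: "\<And>S T \<rho> x. \<lbrakk>S \<in> algs K; T \<in> algs K; \<rho> \<in> alg_hom K S T; \<rho> ` carrier S = carrier T;
      \<And>s. \<lbrakk>s \<in> carrier S; \<rho> s = \<zero>\<^bsub>T\<^esub>\<rbrakk> \<Longrightarrow> s \<in> cring.nilpotents S; x \<in> pt S; Mor G S T \<rho> x \<in> U T\<rbrakk> \<Longrightarrow> x \<in> U S"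
begin

definition X :: "('u, 'x set, 'x) kfunctor" where "X = \<lparr>Ob = U, Mor = Mor G\<rparr>"

lemma X_simps [simp]: "Ob X = U" "Mor X = Mor G"
  by (simp_all add: X_def)

lemma U_e: assumes S: "S \<in> algs K" shows "e S \<in> U S"
  using U_mor[OF B_algs S struct_map_alg_hom[OF S] U_one] by (simp add: G_one[OF B_algs S struct_map_alg_hom[OF S]])

text \<open>The field at x reduces to x under \<epsilon> \<mapsto> 0, a surjection whose kernel has
  square zero, so \<open>U_nil\<close> applies.\<close>

lemma U_field: assumes S: "S \<in> algs K" and x: "x \<in> U S" shows "inv_field v S x \<in> U (dual_num S)"
proof (rule U_nil[OF dual_num_algs[OF S] S dual_proj_alg_hom[OF S]])
  interpret S: cring S using algs_cring[OF S] .
  interpret D: cring "dual_num S" using algs_cring[OF dual_num_algs[OF S]] .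
  show "dual_proj S ` carrier (dual_num S) = carrier S"
  proof
    show "dual_proj S ` carrier (dual_num S) \<subseteq> carrier S"
      using alg_hom_closed[OF dual_proj_alg_hom[OF S]] by auto
    show "carrier S \<subseteq> dual_proj S ` carrier (dual_num S)"
    proof
      fix s assume "s \<in> carrier S"
      then show "s \<in> dual_proj S ` carrier (dual_num S)"
        by (intro image_eqI[of _ _ "mk_dual S s \<zero>\<^bsub>S\<^esub>"]) (auto simp: dual_proj_mk[OF S] mk_dual_closed[OF S])
    qed
  qed
  fix z assume z: "z \<in> carrier (dual_num S)" "dual_proj S z = \<zero>\<^bsub>S\<^esub>"
  then obtain b where b: "b \<in> carrier S" "z = mk_dual S \<zero>\<^bsub>S\<^esub> b"
    by (auto simp: dual_num_carrier[OF S] dual_proj_mk[OF S])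
  then have "z [^]\<^bsub>dual_num S\<^esub> (2::nat) = \<zero>\<^bsub>dual_num S\<^esub>"
    using z by (simp add: numeral_2_eq_2 dual_num_simps[OF S])
  then show "z \<in> D.nilpotents"
    unfolding D.nilpotents_def using z by blast
qed (use x S in \<open>simp_all add: inv_field_closed[OF v] inv_field_proj[OF v] U_sub\<close>)

sublocale X: vector_field K X "inv_field v"
proof
  show "set_functor K X"
    using G_functor U_sub U_mor by (simp add: set_functor_def Pi_iff)
qed (simp_all add: U_field inv_field_proj[OF v] inv_field_natural[OF v] U_sub)

text \<open>Points in the image of a natural map out of \<open>G\<^sub>a\<^sup>\<vee>\<close> reduce to the identity modulo nilpotents.\<close>

lemma near_one:
  assumes S: "S \<in> algs K"
  obtains S' \<rho> where "S' \<in> algs K" "\<rho> \<in> alg_hom K S S'"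
    "\<And>x. \<lbrakk>x \<in> pt S; Mor G S S' \<rho> x = e S'\<rbrakk> \<Longrightarrow> x \<in> U S"
    "\<And>\<mu>. \<mu> \<in> additive_chars S \<Longrightarrow> Mor Ga_dual S S' \<rho> \<mu> = \<one>\<^bsub>UP S'\<^esub>"
proof -
  obtain S' \<rho> where S': "S' \<in> algs K" and \<rho>: "\<rho> \<in> alg_hom K S S'" "\<rho> ` carrier S = carrier S'"
    and nil: "\<And>s. s \<in> carrier S \<Longrightarrow> \<rho> s = \<zero>\<^bsub>S'\<^esub> \<longleftrightarrow> s \<in> cring.nilpotents S"
    using reduced_quotient[OF S] by blast
  show thesis
  proof (rule that[OF S' \<rho>(1)])
    fix x assume "x \<in> pt S" "Mor G S S' \<rho> x = e S'"
    then show "x \<in> U S"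
      using U_nil[OF S S' \<rho>] nil U_e[OF S'] by simp
  next
    fix \<mu> assume \<mu>: "\<mu> \<in> additive_chars S"
    have "\<rho> (\<mu> n) = \<one>\<^bsub>UP S'\<^esub> n" for n
    proof (cases "n = 0")
      case True
      then show ?thesis
        by (simp add: additive_chars_0[OF S \<mu>] alg_hom_one[OF \<rho>(1)]) (simp add: UP_def)
    next
      case False
      then have "\<mu> n \<in> cring.nilpotents S"
        using \<mu> by (intro cring.dp_seq_nilpotent[OF algs_cring[OF S]]) (auto simp: additive_chars_dp_seq[OF S])
      then show ?thesis
        using False nil[OF additive_chars_closed[OF S \<mu>]] by (simp add: UP_def)
    qed
    then show "Mor Ga_dual S S' \<rho> \<mu> = \<one>\<^bsub>UP S'\<^esub>"
      by (auto simp: Ga_simps)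
  qed
qed

text \<open>A flow over \<open>S\<close> is a natural map \<open>G\<^sub>a\<^sup>\<vee>\<^bsub>|S\<^esub> \<rightarrow> U\<^bsub>|S\<^esub>\<close> compatible with the two vector fields.\<close>

definition flow :: "('u, 'u) module \<Rightarrow> (('u, 'u) module \<Rightarrow> ('u \<Rightarrow> 'u) \<Rightarrow> (nat \<Rightarrow> 'u) \<Rightarrow> 'x) \<Rightarrow> bool" where
  "flow S g \<longleftrightarrow> (\<forall>T\<in>algs K. \<forall>\<phi>\<in>alg_hom K S T. \<forall>\<mu>\<in>additive_chars T. g T \<phi> \<mu> \<in> U T \<and>
     g (dual_num T) (compose (carrier S) (dual_incl T) \<phi>) (Ga_field T \<mu>) = inv_field v T (g T \<phi> \<mu>) \<and>
     (\<forall>T'\<in>algs K. \<forall>\<psi>\<in>alg_hom K T T'. g T' (compose (carrier S) \<psi> \<phi>) (\<lambda>n. \<psi> (\<mu> n)) = Mor G T T' \<psi> (g T \<phi> \<mu>)))"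

text \<open>Pull the function a back along the flow to a function on \<open>Ga_dual\<close> over T'.
  Compatibility of the flow with the two fields turns derivatives of a into derivatives of the
  pullback, and \<open>Ga_taylor\<close> expands the latter. So the values of a along the flow
  depend only on the start point.\<close>

lemma flow_taylor:
  assumes S: "S \<in> algs K" and g: "flow S g" and \<mu>: "\<mu> \<in> additive_chars S"
    and T: "T \<in> algs K" and T': "T' \<in> algs K" and \<psi>: "\<psi> \<in> alg_hom K S T'" and \<phi>: "\<phi> \<in> alg_hom K T T'"
    and a: "a \<in> X.F T"
  shows "a (T', \<phi>) (Mor G S T' \<psi> (g S (\<lambda>s\<in>carrier S. s) \<mu>)) =
    pairing T' (\<lambda>n. (X.der T ^^ n) a (T', \<phi>) (Mor G S T' \<psi> (g S (\<lambda>s\<in>carrier S. s) \<one>\<^bsub>UP S\<^esub>))) (\<lambda>n. \<psi> (\<mu> n))"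
proof -
  interpret T': algebra K T' using algsD[OF T'] .
  let ?id = "\<lambda>t\<in>carrier T'. t" and ?idS = "\<lambda>s\<in>carrier S. s"
  have gU: "g R \<chi> \<nu> \<in> U R"
    and gV: "g (dual_num R) (compose (carrier S) (dual_incl R) \<chi>) (Ga_field R \<nu>) = inv_field v R (g R \<chi> \<nu>)"
    if "R \<in> algs K" "\<chi> \<in> alg_hom K S R" "\<nu> \<in> additive_chars R" for R \<chi> \<nu>
    using g that by (auto simp: flow_def)
  have gN: "g R' (compose (carrier S) \<theta> \<chi>) (\<lambda>n. \<theta> (\<nu> n)) = Mor G R R' \<theta> (g R \<chi> \<nu>)"
    if "R \<in> algs K" "\<chi> \<in> alg_hom K S R" "\<nu> \<in> additive_chars R" "R' \<in> algs K" "\<theta> \<in> alg_hom K R R'" for R \<chi> \<nu> R' \<theta>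
    using g that by (auto simp: flow_def)
  have c\<phi>: "compose (carrier T) \<chi> \<phi> \<in> alg_hom K T R" and c\<psi>: "compose (carrier S) \<chi> \<psi> \<in> alg_hom K S R"
    if "\<chi> \<in> alg_hom K T' R" for R \<chi>
    using alg_hom_compose[OF \<phi> that algsD[OF T]] alg_hom_compose[OF \<psi> that algsD[OF S]] by auto
  \<comment> \<open>The flow lives over S and the functions over T; both are restricted to T'
    through \<psi> and \<phi>, so that the pullback is a function over T'.\<close>
  define h where "h b = restr_fun K Ga T' (\<lambda>R \<chi> \<nu>. b (R, compose (carrier T) \<chi> \<phi>) (g R (compose (carrier S) \<chi> \<psi>) \<nu>))"
    for b :: "('u, 'x) fam"
  have hF: "h b \<in> Ga.F T'" if b: "b \<in> X.F T" for b
    unfolding h_def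
  proof (rule Ga.restr_fun_F[OF T'])
    fix R \<chi> \<nu> assume R: "R \<in> algs K" and \<chi>: "\<chi> \<in> alg_hom K T' R" and "\<nu> \<in> Ob Ga R"
    then have \<nu>: "\<nu> \<in> additive_chars R" by (simp add: Ga_simps)
    have gx: "g R (compose (carrier S) \<chi> \<psi>) \<nu> \<in> Ob X R"
      using gU[OF R c\<psi>[OF \<chi>] \<nu>] by simp
    show "b (R, compose (carrier T) \<chi> \<phi>) (g R (compose (carrier S) \<chi> \<psi>) \<nu>) \<in> carrier R"
      by (rule X.F_closed[OF T b R c\<phi>[OF \<chi>] gx])
    fix R' \<theta> assume R': "R' \<in> algs K" and \<theta>: "\<theta> \<in> alg_hom K R R'"
    show "b (R', compose (carrier T) (compose (carrier T') \<theta> \<chi>) \<phi>)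
        (g R' (compose (carrier S) (compose (carrier T') \<theta> \<chi>) \<psi>) (Mor Ga R R' \<theta> \<nu>)) =
      \<theta> (b (R, compose (carrier T) \<chi> \<phi>) (g R (compose (carrier S) \<chi> \<psi>) \<nu>))"
      using X.F_natural[OF T b R c\<phi>[OF \<chi>] gx R' \<theta>]
      by (simp add: compose_alg_hom_assoc[OF \<phi>] compose_alg_hom_assoc[OF \<psi>] Ga_simps gN[OF R c\<psi>[OF \<chi>] \<nu> R' \<theta>])
  qed
  have hap: "h b (R, \<chi>) \<nu> = b (R, compose (carrier T) \<chi> \<phi>) (g R (compose (carrier S) \<chi> \<psi>) \<nu>)"
    if "R \<in> algs K" "\<chi> \<in> alg_hom K T' R" "\<nu> \<in> additive_chars R" for b R \<chi> \<nu>
    using that by (simp add: h_def Ga_simps)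
  \<comment> \<open>Pulling back intertwines the two derivations. This is the only place where the
    compatibility of the flow with the fields is used.\<close>
  have hder: "Ga.der T' (h b) = h (X.der T b)" if b: "b \<in> X.F T" for b
  proof (rule hom_over_eqI[OF Ga.der_closed[OF T' hF[OF b]] hF[OF X.der_closed[OF T b]]])
    fix R \<chi> \<nu> assume R: "R \<in> algs K" and \<chi>: "\<chi> \<in> alg_hom K T' R" and "\<nu> \<in> Ob Ga R"
    then have \<nu>: "\<nu> \<in> additive_chars R" by (simp add: Ga_simps)
    show "Ga.der T' (h b) (R, \<chi>) \<nu> = h (X.der T b) (R, \<chi>) \<nu>"
      using R \<chi> \<nu> gU[OF R c\<psi>[OF \<chi>] \<nu>] c\<phi>[OF \<chi>]
      by (simp add: Ga.der_def X.der_def Ga_simps hap dual_num_algs Ga.compose_incl(1)[OF T'] Ga_field_char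
          compose_alg_hom_assoc[OF \<phi>] compose_alg_hom_assoc[OF \<psi>] gV[OF R c\<psi>[OF \<chi>] \<nu>])
  qed
  have hpow: "(Ga.der T' ^^ n) (h a) = h ((X.der T ^^ n) a)" for n
    by (induction n) (simp_all add: hder X.der_pow_closed[OF T a])
  have id: "?id \<in> alg_hom K T' T'" and idS: "?idS \<in> alg_hom K S S"
    using alg_hom_id algsD S T' by blast+
  have \<psi>\<mu>: "(\<lambda>n. \<psi> (\<mu> n)) \<in> additive_chars T'"
    using set_functor_closed[OF Ga_set_functor S T' \<psi>] \<mu> by (simp add: Ga_simps)
  have 1: "(\<lambda>n. \<psi> (\<one>\<^bsub>UP S\<^esub> n)) = \<one>\<^bsub>UP T'\<^esub>"
    using alg_hom_zero[OF \<psi> algs_cring[OF S] T'.is_cring] alg_hom_one[OF \<psi>] by (auto simp: UP_def)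
  have at: "h b (T', ?id) (\<lambda>n. \<psi> (\<nu> n)) = b (T', \<phi>) (Mor G S T' \<psi> (g S ?idS \<nu>))" if "\<nu> \<in> additive_chars S" for b \<nu>
  proof -
    have "(\<lambda>n. \<psi> (\<nu> n)) \<in> additive_chars T'"
      using set_functor_closed[OF Ga_set_functor S T' \<psi>] that by (simp add: Ga_simps)
    then show ?thesis
      using gN[OF S idS that T' \<psi>] by (simp add: hap[OF T' id] compose_id_alg_hom[OF \<phi>] compose_id_alg_hom[OF \<psi>])
  qed
  obtain N where N: "\<psi> (\<mu> n) = \<zero>\<^bsub>T'\<^esub>" if "n > N" for n
    using additive_chars_finite[OF T' \<psi>\<mu>] by auto
  note one = one_char[OF S]
  have x1: "Mor G S T' \<psi> (g S ?idS \<one>\<^bsub>UP S\<^esub>) \<in> Ob X T'"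
    using U_mor[OF S T' \<psi> gU[OF S idS one]] by simp
  have "h a (T', ?id) (\<lambda>n. \<psi> (\<mu> n)) =
      (\<Oplus>\<^bsub>T'\<^esub>n\<in>{..N}. (Ga.der T' ^^ n) (h a) (T', ?id) \<one>\<^bsub>UP T'\<^esub> \<otimes>\<^bsub>T'\<^esub> \<psi> (\<mu> n))"
    by (rule Ga_taylor[OF T' hF[OF a] \<psi>\<mu> N])
  then show ?thesis
    unfolding hpow 1[symmetric] at[OF \<mu>] at[OF one]
    using X.F_closed[OF T X.der_pow_closed[OF T a] T' \<phi> x1] additive_chars_closed[OF T' \<psi>\<mu>] N
    by (subst T'.pairing_eq[of _ _ N]) auto
qed

end

section \<open>Evaluation of functions at the exponential\<close>

context exponential
begin

lemma char_map: "\<lbrakk>S \<in> algs K; T \<in> algs K; \<phi> \<in> alg_hom K S T; \<mu> \<in> additive_chars S\<rbrakk> \<Longrightarrow> (\<lambda>n. \<phi> (\<mu> n)) \<in> additive_chars T"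
  using set_functor_closed[OF Ga_set_functor, of S T \<phi> \<mu>] by (simp add: Ga_simps)

lemma function_at_e:
  assumes R: "R \<in> algs K" and T: "T \<in> algs K" and T': "T' \<in> algs K" and \<phi>: "\<phi> \<in> alg_hom K R T"
    and \<psi>: "\<psi> \<in> alg_hom K T T'" and a: "a \<in> X.F R"
  shows "\<psi> (a (T, \<phi>) (e T)) = a (T', compose (carrier R) \<psi> \<phi>) (e T')"
  using X.F_natural[OF R a T \<phi> _ T' \<psi>, of "e T"] U_e[OF T] by (simp add: G_one[OF T T' \<psi>])

text \<open>\<open>exp_eval R T \<phi> \<mu> a = \<Sum> \<mu>\<^sub>n (D\<^sup>n a)(e)\<close>, the value of \<open>a\<close> at the exponential of \<open>\<mu>\<close>.\<close>

definition exp_eval :: "('u, 'u) module \<Rightarrow> ('u, 'u) module \<Rightarrow> ('u \<Rightarrow> 'u) \<Rightarrow> (nat \<Rightarrow> 'u) \<Rightarrow> ('u, 'x) fam \<Rightarrow> 'u" where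
  "exp_eval R T \<phi> \<mu> a = pairing T (\<lambda>n. (X.der R ^^ n) a (T, \<phi>) (e T)) \<mu>"

lemma coeff_at_e:
  assumes "R \<in> algs K" "T \<in> algs K" "\<phi> \<in> alg_hom K R T" "a \<in> X.F R"
  shows "(X.der R ^^ n) a (T, \<phi>) (e T) \<in> carrier T"
  using X.F_closed[OF assms(1) X.der_pow_closed[OF assms(1,4)] assms(2,3), of "e T" n] U_e[OF assms(2)] by simp

context
  fixes R T \<phi> \<mu>
  assumes R: "R \<in> algs K" and T: "T \<in> algs K" and \<phi>: "\<phi> \<in> alg_hom K R T" and \<mu>: "\<mu> \<in> additive_chars T"
begin

interpretation T: algebra K T using algsD[OF T] .

lemma exp_eval_eq:
  "\<lbrakk>a \<in> X.F R; \<And>n. n > N \<Longrightarrow> \<mu> n = \<zero>\<^bsub>T\<^esub>\<rbrakk> \<Longrightarrow>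
    exp_eval R T \<phi> \<mu> a = (\<Oplus>\<^bsub>T\<^esub>n\<in>{..N}. (X.der R ^^ n) a (T, \<phi>) (e T) \<otimes>\<^bsub>T\<^esub> \<mu> n)"
  unfolding exp_eval_def by (rule T.pairing_eq[OF coeff_at_e[OF R T \<phi>] additive_chars_closed[OF T \<mu>]])

lemma exp_eval_closed: "a \<in> X.F R \<Longrightarrow> exp_eval R T \<phi> \<mu> a \<in> carrier T"
  unfolding exp_eval_def pairing_def using coeff_at_e[OF R T \<phi>] additive_chars_closed[OF T \<mu>] by (intro T.finsum_closed) auto

text \<open>For products the Leibniz rule \<open>der_pow_mult\<close> produces
  \<open>dp_mult\<close>, and \<open>dp_pairing_mult\<close> splits its pairing with \<mu>. For the
  unit the higher derivatives of 1 vanish and \<mu>_0 = 1.\<close>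

lemma exp_eval_ring_hom: "exp_eval R T \<phi> \<mu> \<in> ring_hom (pointwise K R X (X.F R)) T"
proof -
  obtain N where N: "\<And>n. n > N \<Longrightarrow> \<mu> n = \<zero>\<^bsub>T\<^esub>"
    using additive_chars_finite[OF T \<mu>] by auto
  have ev: "exp_eval R T \<phi> \<mu> c = (\<Oplus>\<^bsub>T\<^esub>n\<in>{..N}. (X.der R ^^ n) c (T, \<phi>) (e T) \<otimes>\<^bsub>T\<^esub> \<mu> n)" if "c \<in> X.F R" for c
    by (rule exp_eval_eq[OF that N])
  note c = coeff_at_e[OF R T \<phi>] and m = additive_chars_closed[OF T \<mu>]
  have x: "e T \<in> Ob X T" using U_e[OF T] by simp
  show ?thesis
  proof (rule ring_hom_memI)
    fix a b assume "a \<in> carrier (pointwise K R X (X.F R))" "b \<in> carrier (pointwise K R X (X.F R))"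
    then have a: "a \<in> X.F R" and b: "b \<in> X.F R" by (simp_all add: pointwise_def)
    have "exp_eval R T \<phi> \<mu> (a \<otimes>\<^bsub>pointwise K R X (X.F R)\<^esub> b) =
        (\<Oplus>\<^bsub>T\<^esub>n\<in>{..N}. dp_mult T (\<lambda>i. (X.der R ^^ i) a (T, \<phi>) (e T)) (\<lambda>i. (X.der R ^^ i) b (T, \<phi>) (e T)) n \<otimes>\<^bsub>T\<^esub> \<mu> n)"
      by (simp only: ev[OF X.FA_closed(1)[OF R a b]] X.der_pow_mult[OF R a b T \<phi> x])
    also have "\<dots> = exp_eval R T \<phi> \<mu> a \<otimes>\<^bsub>T\<^esub> exp_eval R T \<phi> \<mu> b"
      unfolding ev[OF a] ev[OF b]
      using \<mu> by (intro T.dp_pairing_mult N c a b) (simp_all add: additive_chars_dp_seq[OF T])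
    finally show "exp_eval R T \<phi> \<mu> (a \<otimes>\<^bsub>pointwise K R X (X.F R)\<^esub> b) = exp_eval R T \<phi> \<mu> a \<otimes>\<^bsub>T\<^esub> exp_eval R T \<phi> \<mu> b" .
    have "exp_eval R T \<phi> \<mu> (a \<oplus>\<^bsub>pointwise K R X (X.F R)\<^esub> b) =
        (\<Oplus>\<^bsub>T\<^esub>n\<in>{..N}. (X.der R ^^ n) a (T, \<phi>) (e T) \<otimes>\<^bsub>T\<^esub> \<mu> n \<oplus>\<^bsub>T\<^esub> (X.der R ^^ n) b (T, \<phi>) (e T) \<otimes>\<^bsub>T\<^esub> \<mu> n)"
      unfolding ev[OF X.FA_closed(2)[OF R a b]] X.der_pow_add[OF R a b] X.FA_apply[OF R T \<phi> x]
      using c[OF a] c[OF b] m by (intro T.finsum_cong') (auto simp: T.l_distr)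
    also have "\<dots> = exp_eval R T \<phi> \<mu> a \<oplus>\<^bsub>T\<^esub> exp_eval R T \<phi> \<mu> b"
      unfolding ev[OF a] ev[OF b] using c[OF a] c[OF b] m by (intro T.finsum_addf) auto
    finally show "exp_eval R T \<phi> \<mu> (a \<oplus>\<^bsub>pointwise K R X (X.F R)\<^esub> b) = exp_eval R T \<phi> \<mu> a \<oplus>\<^bsub>T\<^esub> exp_eval R T \<phi> \<mu> b" .
  next
    fix a assume "a \<in> carrier (pointwise K R X (X.F R))"
    then show "exp_eval R T \<phi> \<mu> a \<in> carrier T"
      by (intro exp_eval_closed) (simp add: pointwise_def)
  next
    have "exp_eval R T \<phi> \<mu> \<one>\<^bsub>pointwise K R X (X.F R)\<^esub> = (\<Oplus>\<^bsub>T\<^esub>n\<in>{..N}. if 0 = n then \<mu> n else \<zero>\<^bsub>T\<^esub>)"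
      unfolding ev[OF X.FA_one_closed[OF R]] X.der_pow_one[OF R T \<phi> x]
      using m by (intro T.finsum_cong') auto
    also have "\<dots> = \<mu> 0"
      using m by (intro T.finsum_singleton) auto
    finally show "exp_eval R T \<phi> \<mu> \<one>\<^bsub>pointwise K R X (X.F R)\<^esub> = \<one>\<^bsub>T\<^esub>"
      by (simp add: additive_chars_0[OF T \<mu>])
  qed
qed

lemma exp_eval_smult:
  assumes a: "a \<in> X.F R" and r: "r \<in> carrier R"
  shows "exp_eval R T \<phi> \<mu> (r \<odot>\<^bsub>pointwise K R X (X.F R)\<^esub> a) = \<phi> r \<otimes>\<^bsub>T\<^esub> exp_eval R T \<phi> \<mu> a"
proof -
  obtain N where N: "\<And>n. n > N \<Longrightarrow> \<mu> n = \<zero>\<^bsub>T\<^esub>"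
    using additive_chars_finite[OF T \<mu>] by auto
  have ev: "exp_eval R T \<phi> \<mu> c = (\<Oplus>\<^bsub>T\<^esub>n\<in>{..N}. (X.der R ^^ n) c (T, \<phi>) (e T) \<otimes>\<^bsub>T\<^esub> \<mu> n)" if "c \<in> X.F R" for c
    by (rule exp_eval_eq[OF that N])
  note c = coeff_at_e[OF R T \<phi> a] and m = additive_chars_closed[OF T \<mu>] and r' = alg_hom_closed[OF \<phi> r]
  have x: "e T \<in> Ob X T" using U_e[OF T] by simp
  have "exp_eval R T \<phi> \<mu> (r \<odot>\<^bsub>pointwise K R X (X.F R)\<^esub> a) =
      (\<Oplus>\<^bsub>T\<^esub>n\<in>{..N}. \<phi> r \<otimes>\<^bsub>T\<^esub> ((X.der R ^^ n) a (T, \<phi>) (e T) \<otimes>\<^bsub>T\<^esub> \<mu> n))"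
    unfolding ev[OF X.FA_closed(3)[OF R a a r]] X.der_pow_smult[OF R a r] X.FA_apply[OF R T \<phi> x]
    using c m r' by (intro T.finsum_cong') (auto simp: T.m_assoc)
  also have "\<dots> = \<phi> r \<otimes>\<^bsub>T\<^esub> exp_eval R T \<phi> \<mu> a"
    unfolding ev[OF a] using c m r' by (intro T.finsum_rdistr[symmetric]) auto
  finally show ?thesis .
qed

text \<open>\<psi> is applied under the finite sum; derivatives at the identity go to derivatives at
  the identity because \<psi> preserves the identity of G.\<close>

lemma exp_eval_natural:
  assumes a: "a \<in> X.F R" and T': "T' \<in> algs K" and \<psi>: "\<psi> \<in> alg_hom K T T'"
  shows "\<psi> (exp_eval R T \<phi> \<mu> a) = exp_eval R T' (compose (carrier R) \<psi> \<phi>) (\<lambda>n. \<psi> (\<mu> n)) a"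
proof -
  interpret T': algebra K T' using algsD[OF T'] .
  obtain N where N: "\<And>n. n > N \<Longrightarrow> \<mu> n = \<zero>\<^bsub>T\<^esub>"
    using additive_chars_finite[OF T \<mu>] by auto
  have ev: "exp_eval R T \<phi> \<mu> c = (\<Oplus>\<^bsub>T\<^esub>n\<in>{..N}. (X.der R ^^ n) c (T, \<phi>) (e T) \<otimes>\<^bsub>T\<^esub> \<mu> n)" if "c \<in> X.F R" for c
    by (rule exp_eval_eq[OF that N])
  have N': "\<psi> (\<mu> n) = \<zero>\<^bsub>T'\<^esub>" if "n > N" for n
    using N[OF that] alg_hom_zero[OF \<psi> T.is_cring T'.is_cring] by simp
  note c = coeff_at_e[OF R T \<phi> a] and m = additive_chars_closed[OF T \<mu>]
  have "\<psi> (exp_eval R T \<phi> \<mu> a) = (\<Oplus>\<^bsub>T'\<^esub>n\<in>{..N}. \<psi> ((X.der R ^^ n) a (T, \<phi>) (e T) \<otimes>\<^bsub>T\<^esub> \<mu> n))"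
    unfolding ev[OF a] using c m by (intro alg_hom_finsum[OF \<psi> T T']) auto
  also have "\<dots> = pairing T' (\<lambda>n. \<psi> ((X.der R ^^ n) a (T, \<phi>) (e T))) (\<lambda>n. \<psi> (\<mu> n))"
    using c m N' by (subst T'.pairing_eq[of _ _ N]) (auto simp: alg_hom_mult[OF \<psi>] alg_hom_closed[OF \<psi>] intro!: T'.finsum_cong')
  also have "\<dots> = exp_eval R T' (compose (carrier R) \<psi> \<phi>) (\<lambda>n. \<psi> (\<mu> n)) a"
    by (simp only: exp_eval_def function_at_e[OF R T T' \<phi> \<psi> X.der_pow_closed[OF R a]])
  finally show ?thesis .
qed

end

end

text \<open>
  \<open>\<A>\<close> is a class of functions on \<open>U\<close> that is large enough to separate points and to prescribe them.
  For an affine functor \<open>U\<close> is the whole functor and \<open>\<A>\<close> consists of all functions; for a scheme \<open>U\<close>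
  is an affine neighbourhood of the identity, and \<open>\<A>\<close> consists of the functions over \<open>K\<close>.
\<close>

locale exponential_functions = exponential K G v U
  for K :: "('u, 'm) ring_scheme" and G :: "('u, ('x, 'z) monoid_scheme, 'x) kfunctor" and v U +
  fixes \<A> :: "('u, 'u) module \<Rightarrow> ('u, 'x) fam set"
  assumes A_functions: "\<And>T a. \<lbrakk>T \<in> algs K; a \<in> \<A> T\<rbrakk> \<Longrightarrow> a \<in> X.F T"
    and A_der: "\<And>T a. \<lbrakk>T \<in> algs K; a \<in> \<A> T\<rbrakk> \<Longrightarrow> X.der T a \<in> \<A> T"
    and separated: "\<And>S x y. \<lbrakk>S \<in> algs K; x \<in> U S; y \<in> U S;
      \<And>T T' \<phi> \<psi> a. \<lbrakk>T \<in> algs K; T' \<in> algs K; \<phi> \<in> alg_hom K T T'; \<psi> \<in> alg_hom K S T'; a \<in> \<A> T\<rbrakk> \<Longrightarrow>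
        a (T', \<phi>) (Mor G S T' \<psi> x) = a (T', \<phi>) (Mor G S T' \<psi> y)\<rbrakk> \<Longrightarrow> x = y"
    and exists: "\<And>S \<mu>. \<lbrakk>S \<in> algs K; \<mu> \<in> additive_chars S\<rbrakk> \<Longrightarrow> \<exists>x\<in>U S.
      \<forall>T\<in>algs K. \<forall>T'\<in>algs K. \<forall>\<phi>\<in>alg_hom K T T'. \<forall>\<psi>\<in>alg_hom K S T'. \<forall>a\<in>\<A> T.
        a (T', \<phi>) (Mor G S T' \<psi> x) = exp_eval T T' \<phi> (\<lambda>n. \<psi> (\<mu> n)) a"
begin

text \<open>By \<open>flow_taylor\<close> the values of all functions in \<open>\<A>\<close> along a
  flow depend only on where it starts, and these functions separate points.\<close>

lemma flow_unique:
  assumes S: "S \<in> algs K" and g: "flow S g" and g': "flow S g'"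
    and one: "g S (\<lambda>s\<in>carrier S. s) \<one>\<^bsub>UP S\<^esub> = g' S (\<lambda>s\<in>carrier S. s) \<one>\<^bsub>UP S\<^esub>"
    and \<mu>: "\<mu> \<in> additive_chars S"
  shows "g S (\<lambda>s\<in>carrier S. s) \<mu> = g' S (\<lambda>s\<in>carrier S. s) \<mu>"
proof (rule separated[OF S])
  have "(\<lambda>s\<in>carrier S. s) \<in> alg_hom K S S"
    by (rule alg_hom_id[OF algsD[OF S]])
  then show "g S (\<lambda>s\<in>carrier S. s) \<mu> \<in> U S" "g' S (\<lambda>s\<in>carrier S. s) \<mu> \<in> U S"
    using g g' S \<mu> by (auto simp: flow_def)
  fix T T' \<phi> \<psi> a
  assume *: "T \<in> algs K" "T' \<in> algs K" "\<phi> \<in> alg_hom K T T'" "\<psi> \<in> alg_hom K S T'" "a \<in> \<A> T"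
  show "a (T', \<phi>) (Mor G S T' \<psi> (g S (\<lambda>s\<in>carrier S. s) \<mu>)) = a (T', \<phi>) (Mor G S T' \<psi> (g' S (\<lambda>s\<in>carrier S. s) \<mu>))"
    by (simp only: one flow_taylor[OF S g \<mu> *(1,2,4,3) A_functions[OF *(1,5)]] flow_taylor[OF S g' \<mu> *(1,2,4,3) A_functions[OF *(1,5)]])
qed

text \<open>The function lives over T and the point over S, so they are compared in an algebra T'
  that receives both. Quantifying over all T' also makes the property stable under base change of
  S.\<close>

definition is_exp :: "('u, 'u) module \<Rightarrow> (nat \<Rightarrow> 'u) \<Rightarrow> 'x \<Rightarrow> bool" where
  "is_exp S \<mu> x \<longleftrightarrow> x \<in> U S \<and> (\<forall>T\<in>algs K. \<forall>T'\<in>algs K. \<forall>\<phi>\<in>alg_hom K T T'. \<forall>\<psi>\<in>alg_hom K S T'. \<forall>a\<in>\<A> T.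
     a (T', \<phi>) (Mor G S T' \<psi> x) = exp_eval T T' \<phi> (\<lambda>n. \<psi> (\<mu> n)) a)"

lemma is_exp_unique: assumes S: "S \<in> algs K" and "is_exp S \<mu> x" "is_exp S \<mu> y" shows "x = y"
proof (rule separated[OF S])
  show "x \<in> U S" "y \<in> U S" using assms by (auto simp: is_exp_def)
  fix T T' \<phi> \<psi> a
  assume *: "T \<in> algs K" "T' \<in> algs K" "\<phi> \<in> alg_hom K T T'" "\<psi> \<in> alg_hom K S T'" "a \<in> \<A> T"
  have "a (T', \<phi>) (Mor G S T' \<psi> z) = exp_eval T T' \<phi> (\<lambda>n. \<psi> (\<mu> n)) a"
    if "is_exp S \<mu> z" for z
    using that * by (auto simp: is_exp_def)
  then show "a (T', \<phi>) (Mor G S T' \<psi> x) = a (T', \<phi>) (Mor G S T' \<psi> y)"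
    using assms(2,3) by simp
qed

section \<open>The exponential homomorphism\<close>

definition expo :: "('u, 'u) module \<Rightarrow> (nat \<Rightarrow> 'u) \<Rightarrow> 'x" where
  "expo S \<mu> = (SOME x. is_exp S \<mu> x)"

lemma is_exp_expo: assumes "S \<in> algs K" "\<mu> \<in> additive_chars S" shows "is_exp S \<mu> (expo S \<mu>)"
proof -
  have "\<exists>x. is_exp S \<mu> x"
    using exists[OF assms] unfolding is_exp_def by blast
  then show ?thesis unfolding expo_def by (rule someI_ex)
qed

lemma expo_eqI: "\<lbrakk>S \<in> algs K; \<mu> \<in> additive_chars S; is_exp S \<mu> x\<rbrakk> \<Longrightarrow> expo S \<mu> = x"
  using is_exp_unique is_exp_expo by blast

lemma expo_U: "\<lbrakk>S \<in> algs K; \<mu> \<in> additive_chars S\<rbrakk> \<Longrightarrow> expo S \<mu> \<in> U S"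
  using is_exp_expo by (auto simp: is_exp_def)

lemma one_map: "\<lbrakk>S \<in> algs K; T \<in> algs K; \<phi> \<in> alg_hom K S T\<rbrakk> \<Longrightarrow> (\<lambda>n. \<phi> (\<one>\<^bsub>UP S\<^esub> n)) = \<one>\<^bsub>UP T\<^esub>"
  using alg_hom_zero[OF _ algs_cring algs_cring, of \<phi> K S T K K] alg_hom_one[of \<phi> K S T] by (auto simp: UP_def)

text \<open>\<open>is_exp\<close> is stable under base change and determines the point, so the
  chosen points form a natural family.\<close>

lemma expo_natural:
  assumes S: "S \<in> algs K" and T: "T \<in> algs K" and \<phi>: "\<phi> \<in> alg_hom K S T" and \<mu>: "\<mu> \<in> additive_chars S"
  shows "expo T (\<lambda>n. \<phi> (\<mu> n)) = Mor G S T \<phi> (expo S \<mu>)"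
proof (rule expo_eqI[OF T char_map[OF S T \<phi> \<mu>]])
  note E = is_exp_expo[OF S \<mu>]
  have x: "expo S \<mu> \<in> U S" using E by (simp add: is_exp_def)
  have "a (T'', \<chi>) (Mor G T T'' \<psi> (Mor G S T \<phi> (expo S \<mu>))) =
      exp_eval T' T'' \<chi> (\<lambda>n. \<psi> (\<phi> (\<mu> n))) a"
    if *: "T' \<in> algs K" "T'' \<in> algs K" "\<chi> \<in> alg_hom K T' T''" "\<psi> \<in> alg_hom K T T''" "a \<in> \<A> T'" for T' T'' \<chi> \<psi> a
  proof -
    have "compose (carrier S) \<psi> \<phi> \<in> alg_hom K S T''"
      by (rule alg_hom_compose[OF \<phi> *(4) algsD[OF S]])
    then have "a (T'', \<chi>) (Mor G S T'' (compose (carrier S) \<psi> \<phi>) (expo S \<mu>)) =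
        exp_eval T' T'' \<chi> (\<lambda>n. compose (carrier S) \<psi> \<phi> (\<mu> n)) a"
      using E * unfolding is_exp_def by blast
    then show ?thesis
      by (simp add: G_compose[OF S T *(2) \<phi> *(4) U_sub[OF S x]] compose_eq_on additive_chars_closed[OF S \<mu>])
  qed
  then show "is_exp T (\<lambda>n. \<phi> (\<mu> n)) (Mor G S T \<phi> (expo S \<mu>))"
    using U_mor[OF S T \<phi> x] by (simp add: is_exp_def)
qed

lemma exp_eval_one:
  assumes R: "R \<in> algs K" and T: "T \<in> algs K" and \<phi>: "\<phi> \<in> alg_hom K R T" and a: "a \<in> X.F R"
  shows "exp_eval R T \<phi> \<one>\<^bsub>UP T\<^esub> a = a (T, \<phi>) (e T)"
proof -
  interpret T: algebra K T using algsD[OF T] .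
  note c = coeff_at_e[OF R T \<phi> a]
  have 1: "\<one>\<^bsub>UP T\<^esub> n = (if n = 0 then \<one>\<^bsub>T\<^esub> else \<zero>\<^bsub>T\<^esub>)" for n
    by (simp add: UP_def)
  have "exp_eval R T \<phi> \<one>\<^bsub>UP T\<^esub> a = (\<Oplus>\<^bsub>T\<^esub>n\<in>{..0}. (X.der R ^^ n) a (T, \<phi>) (e T) \<otimes>\<^bsub>T\<^esub> \<one>\<^bsub>UP T\<^esub> n)"
    by (rule exp_eval_eq[OF R T \<phi> one_char[OF T] a]) (simp add: 1)
  also have "\<dots> = (X.der R ^^ 0) a (T, \<phi>) (e T) \<otimes>\<^bsub>T\<^esub> \<one>\<^bsub>UP T\<^esub> 0"
    using c[of 0] by (intro T.finsum_0) (simp add: 1)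
  finally show ?thesis
    using c[of 0] by (simp add: 1)
qed

lemma expo_one: assumes S: "S \<in> algs K" shows "expo S \<one>\<^bsub>UP S\<^esub> = e S"
proof (rule expo_eqI[OF S one_char[OF S]])
  show "is_exp S \<one>\<^bsub>UP S\<^esub> (e S)"
    using U_e[OF S] by (auto simp: is_exp_def one_map[OF S] G_one[OF S] exp_eval_one A_functions)
qed

text \<open>The point on the right has the values that define the exponential of
  \<open>Ga_field S \<mu>\<close>. With u = \<psi>(\<epsilon>), \<open>eval_V\<close> evaluates a at
  it as a + u Da at the exponential of \<mu>. On the other side the coefficients of the character
  become \<mu>_n + u \<mu>_(n-1), and \<open>pairing_shift\<close> yields the same sum.\<close>

lemma expo_field:
  assumes S: "S \<in> algs K" and \<mu>: "\<mu> \<in> additive_chars S"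
  shows "expo (dual_num S) (Ga_field S \<mu>) = inv_field v S (expo S \<mu>)"
proof (rule expo_eqI[OF dual_num_algs[OF S] Ga_field_char[OF S \<mu>]])
  interpret S: algebra K S using algsD[OF S] .
  note E = is_exp_expo[OF S \<mu>] and x = expo_U[OF S \<mu>] and D = dual_num_algs[OF S]
  have "a (T', \<phi>) (Mor G (dual_num S) T' \<psi> (inv_field v S (expo S \<mu>))) = exp_eval T T' \<phi> (\<lambda>n. \<psi> (Ga_field S \<mu> n)) a"
    if *: "T \<in> algs K" "T' \<in> algs K" "\<phi> \<in> alg_hom K T T'" "\<psi> \<in> alg_hom K (dual_num S) T'" "a \<in> \<A> T" for T T' \<phi> \<psi> a
  proof -
    interpret T': algebra K T' using algsD[OF *(2)] .
    note a = A_functions[OF *(1,5)]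
    let ?\<psi> = "compose (carrier S) \<psi> (dual_incl S)"
    have \<psi>: "?\<psi> \<in> alg_hom K S T'"
      by (rule alg_hom_compose[OF dual_incl_alg_hom[OF S] *(4) S.algebra_axioms])
    let ?c = "\<lambda>n. (X.der T ^^ n) a (T', \<phi>) (e T')"
    note c = coeff_at_e[OF *(1,2,3) a]
    have \<psi>\<mu>: "(\<lambda>n. ?\<psi> (\<mu> n)) \<in> additive_chars T'"
      by (rule char_map[OF S *(2) \<psi> \<mu>])
    obtain N where N: "?\<psi> (\<mu> n) = \<zero>\<^bsub>T'\<^esub>" if "n > N" for n
      using additive_chars_finite[OF *(2) \<psi>\<mu>] by auto
    have u: "\<psi> (eps S) \<in> carrier T'"
      using alg_hom_closed[OF *(4) eps_closed[OF S]] .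
    have taylor: "b (T', \<phi>) (Mor G S T' ?\<psi> (expo S \<mu>)) = exp_eval T T' \<phi> (\<lambda>n. ?\<psi> (\<mu> n)) b" if "b \<in> \<A> T" for b
      using E * \<psi> that unfolding is_exp_def by blast
    \<comment> \<open>The n-th coefficient is split into its constant part and a multiple of
      \<epsilon>, in the form expected by \<open>pairing_shift\<close>.\<close>
    have "\<psi> (Ga_field S \<mu> n) = ?\<psi> (\<mu> n) \<oplus>\<^bsub>T'\<^esub> (if n = 0 then \<zero>\<^bsub>T'\<^esub> else ?\<psi> (\<mu> (n - 1))) \<otimes>\<^bsub>T'\<^esub> \<psi> (eps S)" for n
    proof -
      note m = additive_chars_closed[OF S \<mu>]
      let ?m = "if n = 0 then \<zero>\<^bsub>S\<^esub> else \<mu> (n - 1)"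
      have mc: "?m \<in> carrier S" using m by simp
      have "Ga_field S \<mu> n = dual_incl S (\<mu> n) \<oplus>\<^bsub>dual_num S\<^esub> dual_incl S ?m \<otimes>\<^bsub>dual_num S\<^esub> eps S"
        unfolding Ga_field_eq[OF S \<mu>]
        using m[of n] mc by (simp only: dual_incl_def restrict_apply' eps_def) (simp add: dual_num_simps[OF S] del: One_nat_def)
      then have "\<psi> (Ga_field S \<mu> n) = \<psi> (dual_incl S (\<mu> n)) \<oplus>\<^bsub>T'\<^esub> \<psi> (dual_incl S ?m) \<otimes>\<^bsub>T'\<^esub> \<psi> (eps S)"
        using m[of n] mc eps_closed[OF S] alg_hom_closed[OF dual_incl_alg_hom[OF S]] algs_cring[OF D]
        by (simp only: alg_hom_add[OF *(4)] alg_hom_mult[OF *(4)] monoid.m_closed[OF cring.axioms(1)[THEN ring.axioms(2)]])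
      moreover have "\<psi> (dual_incl S ?m) = (if n = 0 then \<zero>\<^bsub>T'\<^esub> else ?\<psi> (\<mu> (n - 1)))"
        using m mc alg_hom_zero[OF \<psi> S.is_cring T'.is_cring] by (cases "n = 0") (simp_all add: compose_eq_on)
      ultimately show ?thesis
        using m by (simp add: compose_eq_on)
    qed
    then have "pairing T' ?c (\<lambda>n. \<psi> (Ga_field S \<mu> n)) =
        pairing T' ?c (\<lambda>n. ?\<psi> (\<mu> n)) \<oplus>\<^bsub>T'\<^esub> pairing T' (\<lambda>n. ?c (Suc n)) (\<lambda>n. ?\<psi> (\<mu> n)) \<otimes>\<^bsub>T'\<^esub> \<psi> (eps S)"
      using T'.pairing_shift[of ?c "\<lambda>n. ?\<psi> (\<mu> n)" N, OF c additive_chars_closed[OF *(2) \<psi>\<mu>] N u] by simp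
    also have "pairing T' ?c (\<lambda>n. ?\<psi> (\<mu> n)) = a (T', \<phi>) (Mor G S T' ?\<psi> (expo S \<mu>))"
      by (rule taylor[OF *(5), symmetric, unfolded exp_eval_def])
    \<comment> \<open>The shifted coefficients belong to the function Da. Its value at the
      exponential is known because \<open>\<A>\<close> is closed under derivatives.\<close>
    also have "pairing T' (\<lambda>n. ?c (Suc n)) (\<lambda>n. ?\<psi> (\<mu> n)) = X.der T a (T', \<phi>) (Mor G S T' ?\<psi> (expo S \<mu>))"
      unfolding taylor[OF A_der[OF *(1,5)]] exp_eval_def funpow_Suc_right o_apply ..
    finally have eq: "pairing T' ?c (\<lambda>n. \<psi> (Ga_field S \<mu> n)) = a (T', \<phi>) (Mor G S T' ?\<psi> (expo S \<mu>)) \<oplus>\<^bsub>T'\<^esub>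
        X.der T a (T', \<phi>) (Mor G S T' ?\<psi> (expo S \<mu>)) \<otimes>\<^bsub>T'\<^esub> \<psi> (eps S)" .
    have "expo S \<mu> \<in> Ob X S" using x by simp
    from trans[OF trans[OF X.eval_V[OF *(1) a S this *(2,3,4), unfolded X_simps] eq[symmetric]] exp_eval_def[symmetric]] show ?thesis .
  qed
  then show "is_exp (dual_num S) (Ga_field S \<mu>) (inv_field v S (expo S \<mu>))"
    using U_field[OF S x] by (simp add: is_exp_def)
qed

lemma Ga_field_one: "S \<in> algs K \<Longrightarrow> Ga_field S \<one>\<^bsub>UP S\<^esub> = one_plus_eps S"
proof -
  assume S: "S \<in> algs K"
  interpret D: cring "dual_num S" using algs_cring[OF dual_num_algs[OF S]] .
  interpret P: UP_cring "dual_num S" "UP (dual_num S)" by unfold_locales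
  show "Ga_field S \<one>\<^bsub>UP S\<^esub> = one_plus_eps S"
    unfolding Ga_field_def one_map[OF S dual_num_algs[OF S] dual_incl_alg_hom[OF S]]
    using additive_chars_UP[OF dual_num_algs[OF S] one_plus_eps_char[OF S]] by (rule P.l_one)
qed

text \<open>Take \<open>expo_field\<close> at the trivial character: there the field on
  \<open>Ga_dual\<close> has the value 1 + \<epsilon> x, and the invariant field on G has the value
  v at the identity.\<close>

lemma expo_one_plus_eps: "expo (dual_num B) (one_plus_eps B) = v"
  using expo_field[OF B_algs one_char[OF B_algs]]
  by (simp only: Ga_field_one[OF B_algs] expo_one[OF B_algs] inv_field_one[OF v B_algs] base_change_base[OF v])

text \<open>Left invariance of the field, that is, associativity of the product of
  characters.\<close>

lemma Ga_field_mult: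
  assumes S: "S \<in> algs K" and \<mu>: "\<mu> \<in> additive_chars S" and \<nu>: "\<nu> \<in> additive_chars S"
  shows "Ga_field S (\<mu> \<otimes>\<^bsub>UP S\<^esub> \<nu>) = (\<lambda>n. dual_incl S (\<mu> n)) \<otimes>\<^bsub>UP (dual_num S)\<^esub> Ga_field S \<nu>"
proof -
  note D = dual_num_algs[OF S] and i = dual_incl_alg_hom[OF S]
  interpret D: cring "dual_num S" using algs_cring[OF D] .
  interpret P: UP_cring "dual_num S" "UP (dual_num S)" by unfold_locales
  note UP = additive_chars_UP[OF D]
  show ?thesis
    unfolding Ga_field_def Ga_mult_natural[OF S D i \<mu> \<nu>]
    by (rule P.m_assoc[OF UP[OF char_map[OF S D i \<mu>]] UP[OF char_map[OF S D i \<nu>]] UP[OF one_plus_eps_char[OF S]]])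
qed

lemma char_mult: "\<lbrakk>S \<in> algs K; \<mu> \<in> additive_chars S; \<nu> \<in> additive_chars S\<rbrakk> \<Longrightarrow> \<mu> \<otimes>\<^bsub>UP S\<^esub> \<nu> \<in> additive_chars S"
  by (rule cring.additive_chars_mult[OF algs_cring])

text \<open>Fix \<mu> and let the other factor vary: both sides are flows over S that start at
  \<open>expo S \<mu>\<close>. For the left side compatibility comes from the invariance of
  \<open>Ga_field\<close>, for the right side from that of \<open>inv_field v\<close>.\<close>

lemma expo_mult:
  assumes S: "S \<in> algs K" and \<mu>: "\<mu> \<in> additive_chars S" and \<nu>: "\<nu> \<in> additive_chars S"
  shows "expo S (\<mu> \<otimes>\<^bsub>UP S\<^esub> \<nu>) = mul S (expo S \<mu>) (expo S \<nu>)"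
proof -
  let ?id = "\<lambda>s\<in>carrier S. s"
  define g where "g T \<phi> \<xi> = expo T ((\<lambda>n. \<phi> (\<mu> n)) \<otimes>\<^bsub>UP T\<^esub> \<xi>)" for T \<phi> \<xi>
  define g' where "g' T \<phi> \<xi> = mul T (expo T (\<lambda>n. \<phi> (\<mu> n))) (expo T \<xi>)" for T \<phi> \<xi>
  have comp: "(\<lambda>n. compose (carrier S) \<psi> \<phi> (\<mu> n)) = (\<lambda>n. \<psi> (\<phi> (\<mu> n)))" for \<phi> \<psi> :: "'u \<Rightarrow> 'u"
    by (simp add: compose_eq_on additive_chars_closed[OF S \<mu>])
  have 1: "flow S g"
    unfolding flow_def
  proof (intro ballI conjI)
    fix T \<phi> \<xi> assume T: "T \<in> algs K" and \<phi>: "\<phi> \<in> alg_hom K S T" and \<xi>: "\<xi> \<in> additive_chars T"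
    note \<phi>\<mu> = char_map[OF S T \<phi> \<mu>]
    note m = char_mult[OF T \<phi>\<mu> \<xi>]
    show "g T \<phi> \<xi> \<in> U T"
      unfolding g_def by (rule expo_U[OF T m])
    show "g (dual_num T) (compose (carrier S) (dual_incl T) \<phi>) (Ga_field T \<xi>) = inv_field v T (g T \<phi> \<xi>)"
      by (simp only: g_def comp Ga_field_mult[OF T \<phi>\<mu> \<xi>, symmetric] expo_field[OF T m])
    fix T' \<psi> assume T': "T' \<in> algs K" and \<psi>: "\<psi> \<in> alg_hom K T T'"
    show "g T' (compose (carrier S) \<psi> \<phi>) (\<lambda>n. \<psi> (\<xi> n)) = Mor G T T' \<psi> (g T \<phi> \<xi>)"
      by (simp only: g_def comp Ga_mult_natural[OF T T' \<psi> \<phi>\<mu> \<xi>, symmetric] expo_natural[OF T T' \<psi> m])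
  qed
  have 2: "flow S g'"
    unfolding flow_def
  proof (intro ballI conjI)
    fix T \<phi> \<xi> assume T: "T \<in> algs K" and \<phi>: "\<phi> \<in> alg_hom K S T" and \<xi>: "\<xi> \<in> additive_chars T"
    note \<phi>\<mu> = char_map[OF S T \<phi> \<mu>]
    note x = U_sub[OF T expo_U[OF T \<phi>\<mu>]] and y = U_sub[OF T expo_U[OF T \<xi>]]
    obtain T' \<rho> where T': "T' \<in> algs K" and \<rho>: "\<rho> \<in> alg_hom K T T'"
      and near: "\<And>x. \<lbrakk>x \<in> pt T; Mor G T T' \<rho> x = e T'\<rbrakk> \<Longrightarrow> x \<in> U T"
      and triv: "\<And>\<mu>. \<mu> \<in> additive_chars T \<Longrightarrow> Mor Ga_dual T T' \<rho> \<mu> = \<one>\<^bsub>UP T'\<^esub>"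
      using near_one[OF T] by blast
    \<comment> \<open>U need not be closed under multiplication. Modulo nilpotents, however, both
      factors are the identity, and so is their product.\<close>
    have "Mor G T T' \<rho> (expo T \<kappa>) = e T'" if "\<kappa> \<in> additive_chars T" for \<kappa>
      using triv[OF that] expo_natural[OF T T' \<rho> that] by (simp add: Ga_simps expo_one[OF T'])
    then show "g' T \<phi> \<xi> \<in> U T"
      unfolding g'_def using \<phi>\<mu> \<xi>
      by (intro near mul_closed[OF T x y]) (simp add: G_mult[OF T T' \<rho> x y] monoid.l_one[OF G_monoid[OF T'] e_closed[OF T']])
    note i = dual_incl_alg_hom[OF T] and D = dual_num_algs[OF T]
    show "g' (dual_num T) (compose (carrier S) (dual_incl T) \<phi>) (Ga_field T \<xi>) = inv_field v T (g' T \<phi> \<xi>)"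
      by (simp only: g'_def comp expo_field[OF T \<xi>] expo_natural[OF T D i \<phi>\<mu>] inv_field_invariant[OF v T y x])
    fix T' \<psi> assume T': "T' \<in> algs K" and \<psi>: "\<psi> \<in> alg_hom K T T'"
    show "g' T' (compose (carrier S) \<psi> \<phi>) (\<lambda>n. \<psi> (\<xi> n)) = Mor G T T' \<psi> (g' T \<phi> \<xi>)"
      by (simp only: g'_def comp expo_natural[OF T T' \<psi> \<phi>\<mu>] expo_natural[OF T T' \<psi> \<xi>] G_mult[OF T T' \<psi> x y])
  qed
  have idm: "(\<lambda>n. ?id (\<mu> n)) = \<mu>"
    using additive_chars_closed[OF S \<mu>] by simp
  have "g S ?id \<one>\<^bsub>UP S\<^esub> = g' S ?id \<one>\<^bsub>UP S\<^esub>"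
    unfolding g_def g'_def idm
    by (simp only: Ga_one_mult[OF S \<mu>] expo_one[OF S] monoid.r_one[OF G_monoid[OF S] U_sub[OF S expo_U[OF S \<mu>]]])
  from flow_unique[OF S 1 2 this \<nu>] show ?thesis
    unfolding g_def g'_def idm .
qed

text \<open>The field on \<open>Ga_dual\<close> is multiplication by 1 + \<epsilon> x, which f
  carries to multiplication by the base change of v, the field on G. The values lie in U because
  they reduce to the identity modulo nilpotents.\<close>

lemma hom_flow:
  assumes f: "f \<in> hom_grp K Ga_dual G" and fv: "f (dual_num B) (one_plus_eps B) = v" and S: "S \<in> algs K"
  shows "flow S (\<lambda>T \<phi>. f T)"
  unfolding flow_def
proof (intro ballI conjI)
  fix T \<phi> \<xi> assume T: "T \<in> algs K" and \<phi>: "\<phi> \<in> alg_hom K S T" and \<xi>: "\<xi> \<in> additive_chars T"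
  have nat: "f R' (\<lambda>n. \<psi> (\<mu> n)) = Mor G R R' \<psi> (f R \<mu>)"
    if "R \<in> algs K" "R' \<in> algs K" "\<psi> \<in> alg_hom K R R'" "\<mu> \<in> additive_chars R" for R R' \<psi> \<mu>
    using hom_grp_natural[OF f that(1-3)] that(4) by (simp add: Ga_simps)
  obtain T' \<rho> where T': "T' \<in> algs K" and \<rho>: "\<rho> \<in> alg_hom K T T'"
    and near: "\<And>x. \<lbrakk>x \<in> pt T; Mor G T T' \<rho> x = e T'\<rbrakk> \<Longrightarrow> x \<in> U T"
    and triv: "\<And>\<mu>. \<mu> \<in> additive_chars T \<Longrightarrow> Mor Ga_dual T T' \<rho> \<mu> = \<one>\<^bsub>UP T'\<^esub>"
    using near_one[OF T] by blast
  show "f T \<xi> \<in> U T"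
    using nat[OF T T' \<rho> \<xi>] triv[OF \<xi>] hom_one_eq[OF f T'] hom_grp_closed[OF f T] \<xi>
    by (intro near) (auto simp: Ga_simps)
  note D = dual_num_algs[OF T] and i = dual_incl_alg_hom[OF T] and DB = dual_num_algs[OF B_algs]
    and s = dual_map_alg_hom[OF B_algs T struct_map_alg_hom[OF T]]
  \<comment> \<open>Over T this character arises by base change from the one over K, so naturality
    gives the value of f at it from the single value v.\<close>
  have "one_plus_eps T = (\<lambda>n. dual_map B T (struct_map K T) (one_plus_eps B n))"
    using alg_hom_one[OF s] alg_hom_zero[OF s algs_cring[OF DB] algs_cring[OF D]]
      alg_hom_zero[OF struct_map_alg_hom[OF T] algs_cring[OF B_algs] algs_cring[OF T]]
      alg_hom_one[OF struct_map_alg_hom[OF T]]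
      ring.ring_simprules(2,6)[OF cring.axioms(1)[OF algs_cring[OF B_algs]]]
    by (auto simp: one_plus_eps_def eps_def dual_map_mk[OF B_algs] fun_eq_iff)
  then have fo: "f (dual_num T) (one_plus_eps T) = base_change v T"
    using nat[OF DB D s one_plus_eps_char[OF B_algs]] fv by (simp add: base_change_def)
  have "f (dual_num T) (Ga_field T \<xi>) = mul (dual_num T) (f (dual_num T) (\<lambda>n. dual_incl T (\<xi> n))) (f (dual_num T) (one_plus_eps T))"
    using hom_grp_mult[OF f D] char_map[OF T D i \<xi>] one_plus_eps_char[OF T]
    by (simp add: Ga_field_def Ga_simps)
  then show "f (dual_num T) (Ga_field T \<xi>) = inv_field v T (f T \<xi>)"
    by (simp add: fo nat[OF T D i \<xi>] inv_field_def)
  fix T' \<psi> assume "T' \<in> algs K" "\<psi> \<in> alg_hom K T T'"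
  then show "f T' (\<lambda>n. \<psi> (\<xi> n)) = Mor G T T' \<psi> (f T \<xi>)"
    by (intro nat T \<xi>)
qed

theorem unique_hom: "\<exists>!f. f \<in> hom_grp K Ga_dual G \<and> f (dual_num B) (one_plus_eps B) = v"
proof (rule ex1I)
  let ?f = "\<lambda>S\<in>algs K. \<lambda>\<mu>\<in>additive_chars S. expo S \<mu>"
  have "?f \<in> hom_grp K Ga_dual G"
    by (auto simp: hom_grp_def hom_def Ga_simps U_sub expo_U expo_mult char_mult expo_natural char_map)
  then show "?f \<in> hom_grp K Ga_dual G \<and> ?f (dual_num B) (one_plus_eps B) = v"
    using dual_num_algs[OF B_algs] one_plus_eps_char[OF B_algs] by (simp add: expo_one_plus_eps)
  fix f assume f: "f \<in> hom_grp K Ga_dual G \<and> f (dual_num B) (one_plus_eps B) = v"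
  then have f: "f \<in> hom_grp K Ga_dual G" "f (dual_num B) (one_plus_eps B) = v" by auto
  have f': "?f \<in> hom_grp K Ga_dual G" "?f (dual_num B) (one_plus_eps B) = v"
    by fact (use dual_num_algs[OF B_algs] one_plus_eps_char[OF B_algs] in \<open>simp add: expo_one_plus_eps\<close>)
  show "f = ?f"
  proof (rule hom_grp_eqI[OF f(1) f'(1)])
    fix S \<mu> assume S: "S \<in> algs K" and "\<mu> \<in> carrier (Ob Ga_dual S)"
    then have \<mu>: "\<mu> \<in> additive_chars S" by (simp add: Ga_simps)
    show "f S \<mu> = ?f S \<mu>"
      by (rule flow_unique[OF S hom_flow[OF f S] hom_flow[OF f' S] _ \<mu>]) (simp only: hom_one_eq[OF f(1) S] hom_one_eq[OF f'(1) S])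
  qed
qed

end

section \<open>Schemes\<close>

text \<open>Put n = 1 - i. The recursion 1 - n^(k+1) = (1 - n^k) n + (1 - n) keeps 1 - n^k in I, and
  for n^k = 0 this element is 1.\<close>

lemma (in ideal) carrier_if_one_minus_nilpotent:
  assumes c: "cring R" and i: "i \<in> I" and nil: "\<one> \<ominus> i \<in> cring.nilpotents R"
  shows "I = carrier R"
proof -
  interpret cring R by (rule c)
  let ?n = "\<one> \<ominus> i"
  have ic: "i \<in> carrier R" using i by (rule a_Hcarr)
  have n: "?n \<in> carrier R" using nil by (rule nilpotents_closed)
  have "\<one> \<ominus> ?n [^] k \<in> I" for k :: nat
  proof (induction k)
    case 0
    have "\<one> \<ominus> \<one> = \<zero>" by (simp add: a_minus_def r_neg)
    then show ?case by simp
  next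
    case (Suc k)
    have "\<one> \<ominus> ?n = i"
    proof -
      have "\<one> \<ominus> ?n = \<one> \<oplus> (\<ominus> \<one> \<oplus> i)"
        using ic by (simp add: a_minus_def minus_add)
      then show ?thesis using ic by (simp add: r_neg2)
    qed
    moreover have "\<one> \<ominus> ?n [^] Suc k = (\<one> \<ominus> ?n [^] k) \<otimes> ?n \<oplus> (\<one> \<ominus> ?n)"
    proof -
      let ?m = "?n [^] k \<otimes> ?n"
      have m: "?m \<in> carrier R" using n by simp
      have "(\<one> \<ominus> ?n [^] k) \<otimes> ?n = ?n \<ominus> ?m"
        using n by (simp add: a_minus_def l_distr l_minus)
      then have "(\<one> \<ominus> ?n [^] k) \<otimes> ?n \<oplus> (\<one> \<ominus> ?n) = (\<one> \<ominus> ?n) \<oplus> (?n \<ominus> ?m)"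
        using n m by (simp only: a_comm minus_closed one_closed)
      also have "\<dots> = \<one> \<oplus> (\<ominus> ?n \<oplus> (?n \<oplus> \<ominus> ?m))"
        using n m unfolding a_minus_def[of R \<one> ?n] a_minus_def[of R ?n ?m] by (intro a_assoc) auto
      also have "\<ominus> ?n \<oplus> (?n \<oplus> \<ominus> ?m) = \<ominus> ?m"
        using n m by (intro r_neg1) auto
      finally show ?thesis by (simp only: a_minus_def nat_pow_Suc)
    qed
    ultimately show ?case
      using Suc.IH n i by (simp add: I_r_closed a_closed)
  qed
  moreover obtain k :: nat where "?n [^] k = \<zero>"
    using nil by (auto simp: nilpotents_def)
  ultimately have "\<one> \<ominus> \<zero> \<in> I" by metis
  then have "\<one> \<in> I" by (simp add: a_minus_def)
  then show ?thesis by (rule one_imp_carrier)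
qed

lemma surj_image_ideal:
  assumes "cring S" "cring T" "\<rho> \<in> ring_hom S T" "\<rho> ` carrier S = carrier T" and I: "ideal I S"
  shows "ideal (\<rho> ` I) T"
proof -
  interpret S: cring S by fact
  interpret T: cring T by fact
  interpret I: ideal I S by fact
  note h = ring_hom_add[OF assms(3)] ring_hom_mult[OF assms(3)] ring_hom_closed[OF assms(3)]
  have z: "\<rho> \<zero>\<^bsub>S\<^esub> = \<zero>\<^bsub>T\<^esub>"
    using assms(3) S.ring_axioms T.ring_axioms by (rule ring_hom_zero)
  have m: "\<ominus>\<^bsub>T\<^esub> (\<rho> x) = \<rho> (\<ominus>\<^bsub>S\<^esub> x)" if "x \<in> carrier S" for x
    using that by (intro T.minus_equality) (auto simp: h h(1)[symmetric] S.l_neg z)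
  show ?thesis
  proof (rule idealI[OF T.ring_axioms])
    show "subgroup (\<rho> ` I) (add_monoid T)"
    proof (rule T.add.subgroupI)
      show "\<rho> ` I \<subseteq> carrier T" using h(3) I.a_Hcarr by auto
      show "\<rho> ` I \<noteq> {}" using additive_subgroup.zero_closed[OF ideal.axioms(1)[OF I]] by blast
    next
      fix a assume "a \<in> \<rho> ` I"
      then show "\<ominus>\<^bsub>T\<^esub> a \<in> \<rho> ` I" using I.a_Hcarr by (auto simp: m)
    next
      fix a b assume "a \<in> \<rho> ` I" "b \<in> \<rho> ` I"
      then show "a \<oplus>\<^bsub>T\<^esub> b \<in> \<rho> ` I" using I.a_Hcarr by (auto simp: h(1)[symmetric])
    qed
  next
    fix a x assume "a \<in> \<rho> ` I" and "x \<in> carrier T"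
    then obtain i s where i: "i \<in> I" "a = \<rho> i" and s: "s \<in> carrier S" "x = \<rho> s"
      unfolding assms(4)[symmetric] by blast
    have "s \<otimes>\<^bsub>S\<^esub> i \<in> I" "i \<otimes>\<^bsub>S\<^esub> s \<in> I"
      using i s by (auto intro: I.I_l_closed I.I_r_closed)
    then show "x \<otimes>\<^bsub>T\<^esub> a \<in> \<rho> ` I" "a \<otimes>\<^bsub>T\<^esub> x \<in> \<rho> ` I"
      using i s I.a_Hcarr[OF i(1)] by (auto simp: h(2)[symmetric])
  qed
qed

lemma field_base_alg: assumes "field K" shows "field (base_alg K)"
proof -
  interpret K: field K by fact
  interpret B: cring "base_alg K" by (rule cring_base_alg[OF K.is_cring])
  have "Units (base_alg K) = Units K" "\<zero>\<^bsub>base_alg K\<^esub> = \<zero>\<^bsub>K\<^esub>"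
    by (auto simp: Units_def base_alg_def)
  then show ?thesis
    by (intro B.cring_fieldI) (simp add: K.field_Units)
qed

section \<open>Open subfunctors and nilpotents\<close>

context group_scheme_like
begin

text \<open>The ideal I that describes where x lies in U generates the unit ideal over T. Since
  \<rho> is surjective, its image is already an ideal, so some i in I maps to 1. Then 1 - i is in
  the kernel, hence nilpotent, and I is the whole ring.\<close>

lemma open_nil:
  assumes U: "open_subfunctor K (underlying G) U"
    and S: "S \<in> algs K" and T: "T \<in> algs K" and \<rho>: "\<rho> \<in> alg_hom K S T" "\<rho> ` carrier S = carrier T"
    and nil: "\<And>s. \<lbrakk>s \<in> carrier S; \<rho> s = \<zero>\<^bsub>T\<^esub>\<rbrakk> \<Longrightarrow> s \<in> cring.nilpotents S"
    and x: "x \<in> pt S" "Mor G S T \<rho> x \<in> U T"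
  shows "x \<in> U S"
proof -
  interpret S: algebra K S using algsD[OF S] .
  interpret T: algebra K T using algsD[OF T] .
  obtain I where I: "ideal I S"
    and iff: "\<And>T' \<phi>. \<lbrakk>T' \<in> algs K; \<phi> \<in> alg_hom K S T'\<rbrakk> \<Longrightarrow> Mor G S T' \<phi> x \<in> U T' \<longleftrightarrow> Idl\<^bsub>T'\<^esub> (\<phi> ` I) = carrier T'"
    using U S x(1) by (auto simp: open_subfunctor_def) blast
  interpret I: ideal I S by (rule I)
  have "ideal (\<rho> ` I) T"
    by (rule surj_image_ideal[OF S.is_cring T.is_cring alg_hom_ring_hom[OF \<rho>(1)] \<rho>(2) I])
  then have "Idl\<^bsub>T\<^esub> (\<rho> ` I) \<subseteq> \<rho> ` I"
    by (rule T.genideal_minimal) simp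
  moreover have "Idl\<^bsub>T\<^esub> (\<rho> ` I) = carrier T"
    using iff[OF T \<rho>(1)] x(2) by simp
  ultimately obtain i where i: "i \<in> I" "\<rho> i = \<one>\<^bsub>T\<^esub>"
    using T.one_closed by (metis imageE subsetD)
  have ic: "i \<in> carrier S" using i(1) by (rule I.a_Hcarr)
  have "\<rho> (\<one>\<^bsub>S\<^esub> \<ominus>\<^bsub>S\<^esub> i) \<oplus>\<^bsub>T\<^esub> \<rho> i = \<rho> \<one>\<^bsub>S\<^esub>"
    using ic by (simp add: alg_hom_add[OF \<rho>(1), symmetric] a_minus_def S.a_assoc S.l_neg)
  then have "\<rho> (\<one>\<^bsub>S\<^esub> \<ominus>\<^bsub>S\<^esub> i) = \<zero>\<^bsub>T\<^esub>"
    using i(2) ic alg_hom_closed[OF \<rho>(1), of "\<one>\<^bsub>S\<^esub> \<ominus>\<^bsub>S\<^esub> i"] alg_hom_one[OF \<rho>(1)]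
    by (metis S.minus_closed S.one_closed T.add.l_cancel_one' T.add.r_cancel_one' T.one_closed)
  then have "\<one>\<^bsub>S\<^esub> \<ominus>\<^bsub>S\<^esub> i \<in> S.nilpotents"
    using nil ic by simp
  then have "I = carrier S"
    by (rule I.carrier_if_one_minus_nilpotent[OF S.is_cring i(1)])
  moreover have id: "(\<lambda>s\<in>carrier S. s) \<in> alg_hom K S S"
    by (rule alg_hom_id[OF S.algebra_axioms])
  moreover have "Idl\<^bsub>S\<^esub> (carrier S) = carrier S"
    using S.genideal_self[of "carrier S"] S.genideal_minimal[OF S.oneideal] by auto
  ultimately show ?thesis
    using iff[OF S id] by (simp add: G_id[OF S x(1)])
qed

context
  fixes v U A \<eta>
  assumes v: "v \<in> Te" and U: "open_subfunctor K (underlying G) U" and eU: "e B \<in> U B" and A: "A \<in> algs K"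
    and \<eta>: "\<And>S. S \<in> algs K \<Longrightarrow> bij_betw (\<eta> S) (U S) (alg_hom K A S)"
    and \<eta>_natural: "\<And>S T \<phi> x. \<lbrakk>S \<in> algs K; T \<in> algs K; \<phi> \<in> alg_hom K S T; x \<in> U S\<rbrakk> \<Longrightarrow>
      \<eta> T (Mor G S T \<phi> x) = compose (carrier A) \<phi> (\<eta> S x)"
begin

lemma exponential_open: "exponential K G v U"
proof
  have sub: "subfunctor K (underlying G) U" using U by (simp add: open_subfunctor_def)
  fix S T \<rho> x assume S: "S \<in> algs K"
  show "x \<in> pt S" if "x \<in> U S"
    using sub S that by (auto simp: subfunctor_def)
  assume T: "T \<in> algs K" "\<rho> \<in> alg_hom K S T"
  show "Mor G S T \<rho> x \<in> U T" if "x \<in> U S"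
  proof -
    have "\<forall>S\<in>algs K. \<forall>T\<in>algs K. \<forall>\<phi>\<in>alg_hom K S T. Mor G S T \<phi> \<in> U S \<rightarrow> U T"
      using sub unfolding subfunctor_def underlying_simps by (rule conjunct2)
    from funcset_mem[OF bspec[OF bspec[OF bspec[OF this S] T(1)] T(2)] that] show ?thesis .
  qed
  show "x \<in> U S" if "\<rho> ` carrier S = carrier T" "\<And>s. \<lbrakk>s \<in> carrier S; \<rho> s = \<zero>\<^bsub>T\<^esub>\<rbrakk> \<Longrightarrow> s \<in> cring.nilpotents S"
    "x \<in> pt S" "Mor G S T \<rho> x \<in> U T"
    by (rule open_nil[OF U S T that(1) _ that(3,4)]) (rule that(2))
qed (rule v eU)+

section \<open>Functions on an affine neighbourhood of the identity\<close>

interpretation exponential K G v U by (rule exponential_open)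

lemma \<eta>_mem: "\<lbrakk>S \<in> algs K; x \<in> U S\<rbrakk> \<Longrightarrow> \<eta> S x \<in> alg_hom K A S"
  using \<eta> by (auto simp: bij_betw_def)

lemma \<eta>_inj: "\<lbrakk>S \<in> algs K; x \<in> U S; y \<in> U S; \<eta> S x = \<eta> S y\<rbrakk> \<Longrightarrow> x = y"
  using \<eta> by (auto simp: bij_betw_def inj_on_def)

lemma \<eta>_surj: "\<lbrakk>S \<in> algs K; \<chi> \<in> alg_hom K A S\<rbrakk> \<Longrightarrow> \<exists>x\<in>U S. \<eta> S x = \<chi>"
  using \<eta> unfolding bij_betw_def by (metis imageE)

text \<open>The element a of A as a function on U under the isomorphism of U with Spec A. By
  \<open>hat_surj\<close> every function on U over K is of this form.\<close>

definition hat :: "'u \<Rightarrow> ('u, 'x) fam" where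
  "hat a = restr_fun K X B (\<lambda>T \<phi> x. \<eta> T x a)"

lemma hat_apply: "\<lbrakk>T \<in> algs K; \<phi> \<in> alg_hom K B T; x \<in> U T\<rbrakk> \<Longrightarrow> hat a (T, \<phi>) x = \<eta> T x a"
  by (simp add: hat_def)

lemma hat_closed: "a \<in> carrier A \<Longrightarrow> hat a \<in> X.F B"
  unfolding hat_def
  by (rule X.restr_fun_F[OF B_algs]) (auto simp: alg_hom_closed[OF \<eta>_mem] \<eta>_natural compose_eq_on)

text \<open>Yoneda: a function on \<open>U \<cong> Spec A\<close> is determined by its value at the universal point.\<close>

lemma hat_surj:
  assumes b: "b \<in> X.F B" obtains a where "a \<in> carrier A" "b = hat a"
proof -
  let ?id = "\<lambda>a\<in>carrier A. a"
  note sA = struct_map_alg_hom[OF A]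
  obtain x0 where x0: "x0 \<in> U A" "\<eta> A x0 = ?id"
    using \<eta>_surj[OF A alg_hom_id[OF algsD[OF A]]] by blast
  let ?a = "b (A, struct_map K A) x0"
  have x0X: "x0 \<in> Ob X A" using x0 by simp
  have a: "?a \<in> carrier A"
    by (rule X.F_closed[OF B_algs b A sA x0X])
  have "b = hat ?a"
  proof (rule hom_over_eqI[OF b hat_closed[OF a]])
    fix T \<phi> x assume T: "T \<in> algs K" and \<phi>: "\<phi> \<in> alg_hom K B T" and "x \<in> Ob X T"
    then have x: "x \<in> U T" by simp
    note h = \<eta>_mem[OF T x]
    have "Mor G A T (\<eta> T x) x0 = x"
      by (rule \<eta>_inj[OF T U_mor[OF A T h x0(1)] x]) (simp only: \<eta>_natural[OF A T h x0(1)] x0(2) compose_id_alg_hom[OF h])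
    moreover have "compose (carrier B) (\<eta> T x) (struct_map K A) = \<phi>"
      using struct_map_natural[OF A T h] alg_hom_base_unique[OF \<phi> T K] by simp
    ultimately have "b (T, \<phi>) x = \<eta> T x ?a"
      using X.F_natural[OF B_algs b A sA x0X T h] by (simp only: X_simps)
    then show "b (T, \<phi>) x = hat ?a (T, \<phi>) x"
      by (simp only: hat_apply[OF T \<phi> x])
  qed
  with a show thesis by (rule that)
qed

lemma hat_hom:
  assumes a: "a \<in> carrier A" and b: "b \<in> carrier A"
  shows "hat (a \<otimes>\<^bsub>A\<^esub> b) = hat a \<otimes>\<^bsub>X.FA B\<^esub> hat b" "hat (a \<oplus>\<^bsub>A\<^esub> b) = hat a \<oplus>\<^bsub>X.FA B\<^esub> hat b"
    "hat \<one>\<^bsub>A\<^esub> = \<one>\<^bsub>X.FA B\<^esub>" "k \<in> carrier K \<Longrightarrow> hat (k \<odot>\<^bsub>A\<^esub> a) = k \<odot>\<^bsub>X.FA B\<^esub> hat a"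
proof -
  interpret A: algebra K A using algsD[OF A] .
  note [simp] = hat_apply alg_hom_mult[OF \<eta>_mem] alg_hom_add[OF \<eta>_mem] alg_hom_one[OF \<eta>_mem] alg_hom_smult[OF \<eta>_mem]
    X.FA_apply[OF B_algs]
  note FA = X.FA_closed[OF B_algs hat_closed[OF a] hat_closed[OF b]]
  show "hat (a \<otimes>\<^bsub>A\<^esub> b) = hat a \<otimes>\<^bsub>X.FA B\<^esub> hat b"
    by (rule hom_over_eqI[OF hat_closed FA(1)]) (use a b in simp_all)
  show "hat (a \<oplus>\<^bsub>A\<^esub> b) = hat a \<oplus>\<^bsub>X.FA B\<^esub> hat b"
    by (rule hom_over_eqI[OF hat_closed FA(2)]) (use a b in simp_all)
  show "hat \<one>\<^bsub>A\<^esub> = \<one>\<^bsub>X.FA B\<^esub>"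
    by (rule hom_over_eqI[OF hat_closed X.FA_one_closed[OF B_algs]]) simp_all
  assume k: "k \<in> carrier K"
  then have kB: "k \<in> carrier B" by simp
  show "hat (k \<odot>\<^bsub>A\<^esub> a) = k \<odot>\<^bsub>X.FA B\<^esub> hat a"
  proof (rule hom_over_eqI[OF hat_closed FA(3)[OF kB]])
    fix T \<phi> x assume T: "T \<in> algs K" and \<phi>: "\<phi> \<in> alg_hom K B T" and "x \<in> Ob X T"
    then have x: "x \<in> U T" by simp
    have "\<phi> k = k \<odot>\<^bsub>T\<^esub> \<one>\<^bsub>T\<^esub>"
      using alg_hom_base_unique[OF \<phi> T K] k by (simp add: struct_map_def)
    then show "hat (k \<odot>\<^bsub>A\<^esub> a) (T, \<phi>) x = (k \<odot>\<^bsub>X.FA B\<^esub> hat a) (T, \<phi>) x"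
      using T \<phi> x a k smult_eq_mult_one[OF algsD[OF T] k alg_hom_closed[OF \<eta>_mem[OF T x] a]] by simp
  qed (use a k in simp)
qed

text \<open>A point of U over S is an algebra morphism from A to S, that is, a choice of values for
  the functions \<open>hat a\<close>. This gives separation at once. For existence, the composite of
  \<open>exp_eval\<close> with \<open>hat\<close> is such a morphism, and naturality extends its
  defining property from S to all T'.\<close>

lemma exponential_functions_open:
  "exponential_functions K G v U (\<lambda>T. if T = B then X.F T else {})"
proof
  show "a \<in> X.F T" if "a \<in> (if T = B then X.F T else {})" for T a
    using that by (auto split: if_splits)
  show "X.der T a \<in> (if T = B then X.F T else {})" if "T \<in> algs K" "a \<in> (if T = B then X.F T else {})" for T a
    using that X.der_closed by (auto split: if_splits)
next
  fix S x y assume S: "S \<in> algs K" and x: "x \<in> U S" and y: "y \<in> U S"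
    and eq: "\<And>T T' \<phi> \<psi> a. \<lbrakk>T \<in> algs K; T' \<in> algs K; \<phi> \<in> alg_hom K T T'; \<psi> \<in> alg_hom K S T';
      a \<in> (if T = B then X.F T else {})\<rbrakk> \<Longrightarrow> a (T', \<phi>) (Mor G S T' \<psi> x) = a (T', \<phi>) (Mor G S T' \<psi> y)"
  note s = struct_map_alg_hom[OF S] and id = alg_hom_id[OF algsD[OF S]]
  show "x = y"
  proof (rule \<eta>_inj[OF S x y], rule alg_hom_eqI[OF \<eta>_mem[OF S x] \<eta>_mem[OF S y]])
    fix a assume a: "a \<in> carrier A"
    have "hat a (S, struct_map K S) (Mor G S S (\<lambda>s\<in>carrier S. s) x) = hat a (S, struct_map K S) (Mor G S S (\<lambda>s\<in>carrier S. s) y)"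
      by (rule eq[OF B_algs S s id]) (simp add: hat_closed[OF a])
    then show "\<eta> S x a = \<eta> S y a"
      by (simp only: G_id[OF S U_sub[OF S x]] G_id[OF S U_sub[OF S y]] hat_apply[OF S s x] hat_apply[OF S s y])
  qed
next
  fix S \<mu> assume S: "S \<in> algs K" and \<mu>: "\<mu> \<in> additive_chars S"
  interpret S: algebra K S using algsD[OF S] .
  interpret A: algebra K A using algsD[OF A] .
  note s = struct_map_alg_hom[OF S]
  note ev = exp_eval_ring_hom[OF B_algs S s \<mu>]
  have F: "hat a \<in> carrier (X.FA B)" if "a \<in> carrier A" for a
    using hat_closed[OF that] by (simp add: pointwise_def)
  let ?\<chi> = "\<lambda>a\<in>carrier A. exp_eval B S (struct_map K S) \<mu> (hat a)"
  have "?\<chi> \<in> alg_hom K A S"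
  proof (rule alg_homI)
    show "?\<chi> \<in> ring_hom A S"
      by (rule ring_hom_memI)
        (use A.one_closed hat_hom(3)[OF A.one_closed A.one_closed] in \<open>auto simp: hat_hom(1,2) ring_hom_mult[OF ev] ring_hom_add[OF ev] ring_hom_one[OF ev] ring_hom_closed[OF ev] F\<close>)
    fix k a assume k: "k \<in> carrier K" and a: "a \<in> carrier A"
    then have kB: "k \<in> carrier B" by simp
    have c: "exp_eval B S (struct_map K S) \<mu> (hat a) \<in> carrier S"
      by (rule ring_hom_closed[OF ev F[OF a]])
    show "?\<chi> (k \<odot>\<^bsub>A\<^esub> a) = k \<odot>\<^bsub>S\<^esub> ?\<chi> a"
      using k a exp_eval_smult[OF B_algs S s \<mu> hat_closed[OF a] kB] smult_eq_mult_one[OF S.algebra_axioms k c]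
      by (simp add: hat_hom(4)[OF a a k] struct_map_def)
  qed simp
  then obtain x where x: "x \<in> U S" "\<eta> S x = ?\<chi>"
    using \<eta>_surj[OF S] by blast
  have "a (T', \<phi>) (Mor G S T' \<psi> x) = exp_eval T T' \<phi> (\<lambda>n. \<psi> (\<mu> n)) a"
    if T: "T \<in> algs K" and T': "T' \<in> algs K" and \<phi>: "\<phi> \<in> alg_hom K T T'" and \<psi>: "\<psi> \<in> alg_hom K S T'"
      and a: "a \<in> (if T = B then X.F T else {})" for T T' \<phi> \<psi> a
  proof -
    have TB: "T = B" and aF: "a \<in> X.F B"
      using a by (auto split: if_splits)
    obtain a0 where a0: "a0 \<in> carrier A" "a = hat a0"
      using hat_surj[OF aF] by blast
    have \<phi>B: "\<phi> \<in> alg_hom K B T'" using \<phi> TB by simp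
    have "compose (carrier B) \<psi> (struct_map K S) = \<phi>"
      using struct_map_natural[OF S T' \<psi>] alg_hom_base_unique[OF \<phi>B T' K] by simp
    moreover have "a (T', \<phi>) (Mor G S T' \<psi> x) = \<psi> (exp_eval B S (struct_map K S) \<mu> a)"
      using a0 by (simp add: hat_apply[OF T' \<phi>B U_mor[OF S T' \<psi> x(1)]] \<eta>_natural[OF S T' \<psi> x(1)] x(2) compose_eq_on)
    ultimately show ?thesis
      using exp_eval_natural[OF B_algs S s \<mu> aF T' \<psi>] TB by (simp only:)
  qed
  then show "\<exists>x\<in>U S. \<forall>T\<in>algs K. \<forall>T'\<in>algs K. \<forall>\<phi>\<in>alg_hom K T T'. \<forall>\<psi>\<in>alg_hom K S T'.
      \<forall>a\<in>(if T = B then X.F T else {}). a (T', \<phi>) (Mor G S T' \<psi> x) = exp_eval T T' \<phi> (\<lambda>n. \<psi> (\<mu> n)) a"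
    using x(1) by blast
qed

end

theorem scheme_unique_hom:
  assumes K: "field K" and G: "is_scheme K (underlying G)" and v: "v \<in> Te"
  shows "\<exists>!f. f \<in> hom_grp K Ga_dual G \<and> f (dual_num B) (one_plus_eps B) = v"
proof -
  \<comment> \<open>Affine neighbourhoods are supplied for points with values in fields. The
    identity is such a point because K is a field.\<close>
  have "e B \<in> Ob (underlying G) B"
    using e_closed[OF B_algs] by simp
  then obtain U A where U: "e B \<in> U B" "open_subfunctor K (underlying G) U" "A \<in> algs K"
    "functor_iso K (underlying G\<lparr>Ob := U\<rparr>) (affine_scheme K A)"
    using G field_base_alg[OF K] B_algs unfolding is_scheme_def by blast
  then obtain \<eta> :: "('u, 'u) module \<Rightarrow> 'x \<Rightarrow> 'u \<Rightarrow> 'u" where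
    "\<forall>S\<in>algs K. bij_betw (\<eta> S) (U S) (alg_hom K A S)"
    "\<forall>S\<in>algs K. \<forall>T\<in>algs K. \<forall>\<phi>\<in>alg_hom K S T. \<forall>x\<in>U S. \<eta> T (Mor G S T \<phi> x) = compose (carrier A) \<phi> (\<eta> S x)"
    by (auto simp: functor_iso_def affine_scheme_def)
  then have "exponential_functions K G v U (\<lambda>T. if T = B then hom_over K T (exponential.X G U) scalars else {})"
    using U by (intro exponential_functions_open[OF v U(2,1,3)]) auto
  then show ?thesis
    by (rule exponential_functions.unique_hom)
qed

end

section \<open>Tensor products\<close>

lemma frag_extend_diff_fun: "frag_extend (\<lambda>x. f x - g x) p = frag_extend f p - frag_extend g p"
  using subset_UNIV by (induction p rule: frag_induction) (simp_all add: frag_extend_diff)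

text \<open>The product of \<open>tensor_cosets\<close> on formal sums, before classes are taken; it
  is linear in each argument.\<close>

definition tensor_mul ::
  "('k, 'a) module \<Rightarrow> ('k, 'b) module \<Rightarrow> ('a \<times> 'b \<Rightarrow>\<^sub>0 int) \<Rightarrow> ('a \<times> 'b \<Rightarrow>\<^sub>0 int) \<Rightarrow> ('a \<times> 'b \<Rightarrow>\<^sub>0 int)" where
  "tensor_mul S T p q = frag_extend (\<lambda>(s, t). frag_extend (\<lambda>(s', t'). frag_of (s \<otimes>\<^bsub>S\<^esub> s', t \<otimes>\<^bsub>T\<^esub> t')) q) p"

lemma tensor_mul_of [simp]:
  "tensor_mul S T (frag_of (s, t)) (frag_of (s', t')) = frag_of (s \<otimes>\<^bsub>S\<^esub> s', t \<otimes>\<^bsub>T\<^esub> t')"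
  by (simp add: tensor_mul_def)

lemma tensor_mul_zero [simp]: "tensor_mul S T 0 q = 0" "tensor_mul S T p 0 = 0"
  by (auto simp: tensor_mul_def intro: frag_extend_eq_0)

lemma tensor_mul_diff:
  "tensor_mul S T (p - p') q = tensor_mul S T p q - tensor_mul S T p' q"
  "tensor_mul S T p (q - q') = tensor_mul S T p q - tensor_mul S T p q'"
  by (simp_all add: tensor_mul_def frag_extend_diff case_prod_unfold frag_extend_diff_fun)

lemma tensor_mul_add:
  "tensor_mul S T (p + p') q = tensor_mul S T p q + tensor_mul S T p' q"
  "tensor_mul S T p (q + q') = tensor_mul S T p q + tensor_mul S T p q'"
  using tensor_mul_diff(1)[of S T p "- p'" q] tensor_mul_diff(1)[of S T 0 p' q]
    tensor_mul_diff(2)[of S T p q "- q'"] tensor_mul_diff(2)[of S T p 0 q'] by simp_all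

section \<open>The quotient of the free abelian group as an algebra\<close>

locale tensor_product =
  fixes K :: "('u, 'm) ring_scheme" and S T :: "('u, 'u) module"
  assumes S: "algebra K S" and T: "algebra K T"
begin

sublocale S: algebra K S by (rule S)
sublocale T: algebra K T by (rule T)

definition fr :: "('u \<times> 'u \<Rightarrow>\<^sub>0 int) set" where
  "fr = {p. Poly_Mapping.keys p \<subseteq> carrier S \<times> carrier T}"

abbreviation "null \<equiv> tensor_null K S T"
abbreviation "cl \<equiv> tensor_class K S T"
abbreviation "mul \<equiv> tensor_mul S T"

lemma carrier_tensor_free: "carrier (tensor_free S T) = fr"
  by (auto simp: tensor_free_def fr_def)

lemma fr_zero: "0 \<in> fr"
  by (simp add: fr_def)

lemma fr_minus: "p \<in> fr \<Longrightarrow> - p \<in> fr"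
  by (simp add: fr_def)

lemma fr_diff: "\<lbrakk>p \<in> fr; q \<in> fr\<rbrakk> \<Longrightarrow> p - q \<in> fr"
  using keys_diff[of p q] by (auto simp: fr_def)

lemma fr_add: "\<lbrakk>p \<in> fr; q \<in> fr\<rbrakk> \<Longrightarrow> p + q \<in> fr"
  using keys_add[of p q] by (auto simp: fr_def)

lemma fr_of: "\<lbrakk>s \<in> carrier S; t \<in> carrier T\<rbrakk> \<Longrightarrow> frag_of (s, t) \<in> fr"
  by (simp add: fr_def)

lemma fr_induct [consumes 1, case_names zero of diff]:
  assumes "p \<in> fr" "P 0" "\<And>s t. \<lbrakk>s \<in> carrier S; t \<in> carrier T\<rbrakk> \<Longrightarrow> P (frag_of (s, t))"
    "\<And>p q. \<lbrakk>p \<in> fr; q \<in> fr; P p; P q\<rbrakk> \<Longrightarrow> P (p - q)"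
  shows "P p"
proof -
  have "Poly_Mapping.keys p \<subseteq> carrier S \<times> carrier T"
    using assms(1) by (simp add: fr_def)
  then have "p \<in> fr \<and> P p"
    by (induction p rule: frag_induction) (use assms(2-4) in \<open>auto simp: fr_zero fr_of fr_diff\<close>)
  then show ?thesis ..
qed

lemma mul_closed: assumes "p \<in> fr" "q \<in> fr" shows "mul p q \<in> fr"
  using assms(1)
proof (induction p rule: fr_induct)
  case (of s t)
  show ?case
    using assms(2) by (induction q rule: fr_induct) (use of in \<open>simp_all add: tensor_mul_diff fr_diff fr_of fr_zero\<close>)
qed (simp_all add: tensor_mul_diff fr_diff fr_of fr_zero)

lemma mul_comm: assumes "p \<in> fr" "q \<in> fr" shows "mul p q = mul q p"
  using assms(1)
proof (induction p rule: fr_induct)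
  case (of s t)
  show ?case
    using assms(2) by (induction q rule: fr_induct) (use of in \<open>simp_all add: tensor_mul_diff S.m_comm T.m_comm\<close>)
qed (simp_all add: tensor_mul_diff)

lemma mul_assoc: assumes "p \<in> fr" "q \<in> fr" "r \<in> fr" shows "mul (mul p q) r = mul p (mul q r)"
  using assms(1)
proof (induction p rule: fr_induct)
  case p: (of s t)
  show ?case
    using assms(2)
  proof (induction q rule: fr_induct)
    case q: (of s' t')
    show ?case
      using assms(3) by (induction r rule: fr_induct) (use p q in \<open>simp_all add: tensor_mul_diff S.m_assoc T.m_assoc\<close>)
  qed (simp_all add: tensor_mul_diff)
qed (simp_all add: tensor_mul_diff)

lemma mul_one: assumes "p \<in> fr" shows "mul (frag_of (\<one>\<^bsub>S\<^esub>, \<one>\<^bsub>T\<^esub>)) p = p"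
  using assms by (induction p rule: fr_induct) (simp_all add: tensor_mul_diff)

text \<open>The integral monoid ring of the multiplicative monoid of pairs (s, t). It is a
  commutative ring before any relation is imposed, and the ring of classes inherits its
  axioms.\<close>

definition fr_ring :: "('u \<times> 'u \<Rightarrow>\<^sub>0 int) ring" where
  "fr_ring = \<lparr>carrier = fr, monoid.mult = mul, one = frag_of (\<one>\<^bsub>S\<^esub>, \<one>\<^bsub>T\<^esub>), ring.zero = 0, add = (+)\<rparr>"

lemma fr_ring_cring: "cring fr_ring"
proof (rule cringI)
  show "abelian_group fr_ring"
  proof (rule abelian_groupI)
    fix x assume "x \<in> carrier fr_ring"
    then show "\<exists>y\<in>carrier fr_ring. y \<oplus>\<^bsub>fr_ring\<^esub> x = \<zero>\<^bsub>fr_ring\<^esub>"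
      by (intro bexI[of _ "- x"]) (simp_all add: fr_ring_def fr_minus)
  qed (simp_all add: fr_ring_def fr_add fr_zero add_ac)
  show "Group.comm_monoid fr_ring"
  proof (rule comm_monoidI)
    show "x \<otimes>\<^bsub>fr_ring\<^esub> y = y \<otimes>\<^bsub>fr_ring\<^esub> x" if "x \<in> carrier fr_ring" "y \<in> carrier fr_ring" for x y
      using mul_comm that by (simp add: fr_ring_def)
  qed (simp_all add: fr_ring_def mul_closed mul_assoc mul_one fr_of)
qed (simp add: fr_ring_def tensor_mul_add)

lemma relators_fr: "tensor_relators K S T \<subseteq> fr"
  by (auto simp: tensor_relators_def intro!: fr_diff fr_of)

lemma null_subgroup: "subgroup null (tensor_free S T)"
  unfolding tensor_null_def tensor_free_def
  using relators_fr by (intro group.generate_is_subgroup) (auto simp: fr_def)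

lemma null_fr: "p \<in> null \<Longrightarrow> p \<in> fr"
  using subgroup.subset[OF null_subgroup] by (auto simp: carrier_tensor_free)

lemma null_zero: "0 \<in> null"
  using subgroup.one_closed[OF null_subgroup] by (simp add: tensor_free_def)

lemma null_add: "\<lbrakk>p \<in> null; q \<in> null\<rbrakk> \<Longrightarrow> p + q \<in> null"
  using subgroup.m_closed[OF null_subgroup, of p q] by (simp add: tensor_free_def)

lemma null_minus: "p \<in> null \<Longrightarrow> - p \<in> null"
  using subgroup.m_inv_closed[OF null_subgroup, of p] null_fr[of p] by (simp add: tensor_free_def fr_def)

lemma null_diff: "\<lbrakk>p \<in> null; q \<in> null\<rbrakk> \<Longrightarrow> p - q \<in> null"
  using null_add[of p "- q"] null_minus[of q] by simp

lemma null_relator: "p \<in> tensor_relators K S T \<Longrightarrow> p \<in> null"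
  unfolding tensor_null_def by (rule generate.incl)

text \<open>Closure under differences covers both rules of a generated subgroup: - r is 0 - r, and p
  + q is p - (- q).\<close>

lemma null_induct [consumes 1, case_names zero relator diff]:
  assumes "p \<in> null" "P 0" "\<And>r. r \<in> tensor_relators K S T \<Longrightarrow> P r"
    "\<And>p q. \<lbrakk>p \<in> fr; q \<in> fr; P p; P q\<rbrakk> \<Longrightarrow> P (p - q)"
  shows "P p"
proof -
  have "p \<in> fr \<and> P p"
    using assms(1) unfolding tensor_null_def
  proof (induction p rule: generate.induct)
    case one
    then show ?case by (simp add: tensor_free_def assms(2) fr_zero)
  next
    case (incl r)
    then show ?case using relators_fr assms(3) by auto
  next
    case (inv r)
    then have r: "r \<in> fr" "P r" using relators_fr assms(3) by auto
    then have "inv\<^bsub>tensor_free S T\<^esub> r = - r"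
      by (simp add: tensor_free_def fr_def)
    then show ?case
      using assms(4)[OF fr_zero r(1) assms(2) r(2)] fr_minus[OF r(1)] by simp
  next
    case (eng p q)
    have m: "- q \<in> fr" "P (- q)"
      using assms(4)[OF fr_zero _ assms(2), of q] eng fr_minus[of q] by auto
    show ?case
      using assms(4)[of p "- q"] eng m fr_add[of p q] by (auto simp: tensor_free_def)
  qed
  then show ?thesis by simp
qed

lemma cl_iff: "q \<in> cl p \<longleftrightarrow> q - p \<in> null"
proof -
  have "q \<in> cl p \<longleftrightarrow> (\<exists>n\<in>null. q = n + p)"
    by (auto simp: tensor_class_def r_coset_def tensor_free_def)
  then show ?thesis by (force simp: algebra_simps)
qed

lemma cl_self: "p \<in> cl p"
  by (simp add: cl_iff null_zero)

lemma cl_eq_iff: "cl p = cl q \<longleftrightarrow> p - q \<in> null"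
proof
  assume "cl p = cl q" then show "p - q \<in> null" using cl_self[of p] by (simp add: cl_iff)
next
  assume d: "p - q \<in> null"
  have "r - p \<in> null \<longleftrightarrow> r - q \<in> null" for r
    using null_add[OF d, of "r - p"] null_diff[OF _ d, of "r - q"] by auto
  then show "cl p = cl q" by (auto simp: cl_iff)
qed

lemma cosets_carrier: "carrier (tensor_cosets K S T) = cl ` fr"
  by (auto simp: tensor_cosets_def RCOSETS_def tensor_class_def carrier_tensor_free)

lemma cl_fr: "\<lbrakk>p \<in> fr; q \<in> cl p\<rbrakk> \<Longrightarrow> q \<in> fr"
  using null_fr[of "q - p"] fr_add[of "q - p" p] by (simp add: cl_iff)

text \<open>Operations on classes are defined as unions over all representatives. When the result
  does not depend on the representative, the union collapses to a single value.\<close>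

lemma UN_cl:
  assumes "p \<in> fr" "\<And>q. \<lbrakk>q \<in> fr; q - p \<in> null\<rbrakk> \<Longrightarrow> f q = f p"
  shows "(\<Union>q\<in>cl p. f q) = f p"
proof -
  have "f q = f p" if "q \<in> cl p" for q
    using assms(2)[OF cl_fr[OF assms(1) that]] that unfolding cl_iff by blast
  then have "(\<Union>q\<in>cl p. f q) = (\<Union>q\<in>cl p. f p)"
    by (intro SUP_cong refl)
  then show ?thesis
    using cl_self[of p] by blast
qed

lemma relator_cases:
  assumes "r \<in> tensor_relators K S T"
  obtains (left) s s' t where "s \<in> carrier S" "s' \<in> carrier S" "t \<in> carrier T" "r = frag_of (s \<oplus>\<^bsub>S\<^esub> s', t) - frag_of (s, t) - frag_of (s', t)"
  | (right) s t t' where "s \<in> carrier S" "t \<in> carrier T" "t' \<in> carrier T" "r = frag_of (s, t \<oplus>\<^bsub>T\<^esub> t') - frag_of (s, t) - frag_of (s, t')"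
  | (scalar) k s t where "k \<in> carrier K" "s \<in> carrier S" "t \<in> carrier T" "r = frag_of (k \<odot>\<^bsub>S\<^esub> s, t) - frag_of (s, k \<odot>\<^bsub>T\<^esub> t)"
  using assms unfolding tensor_relators_def Un_iff mem_Collect_eq
  by (elim disjE exE conjE) (rule left right scalar; assumption)+

lemma relator_intros:
  "\<lbrakk>s \<in> carrier S; s' \<in> carrier S; t \<in> carrier T\<rbrakk> \<Longrightarrow> frag_of (s \<oplus>\<^bsub>S\<^esub> s', t) - frag_of (s, t) - frag_of (s', t) \<in> null"
  "\<lbrakk>s \<in> carrier S; t \<in> carrier T; t' \<in> carrier T\<rbrakk> \<Longrightarrow> frag_of (s, t \<oplus>\<^bsub>T\<^esub> t') - frag_of (s, t) - frag_of (s, t') \<in> null"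
  "\<lbrakk>k \<in> carrier K; s \<in> carrier S; t \<in> carrier T\<rbrakk> \<Longrightarrow> frag_of (k \<odot>\<^bsub>S\<^esub> s, t) - frag_of (s, k \<odot>\<^bsub>T\<^esub> t) \<in> null"
  by (rule null_relator; unfold tensor_relators_def; blast)+

text \<open>The relations form an ideal. By linearity it suffices to multiply a relator by a pair
  (s', t'), and the result is again a relator by distributivity.\<close>

lemma mul_null: assumes "n \<in> null" "q \<in> fr" shows "mul n q \<in> null"
  using assms(1)
proof (induction n rule: null_induct)
  case (relator r)
  show ?case
    using assms(2)
  proof (induction q rule: fr_induct)
    case (of s' t')
    from relator show ?case
      by (cases rule: relator_cases)
        (use of in \<open>auto simp: tensor_mul_diff S.l_distr T.l_distr S.smult_assoc2 T.smult_assoc2 intro!: relator_intros\<close>)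
  qed (simp_all add: tensor_mul_diff null_zero null_diff)
qed (simp_all add: tensor_mul_diff null_zero null_diff)

lemma cl_mul_cong:
  assumes "p \<in> fr" "q \<in> fr" "p' \<in> fr" "q' \<in> fr" "p' - p \<in> null" "q' - q \<in> null"
  shows "cl (mul p' q') = cl (mul p q)"
proof -
  have "mul p' q' - mul p q = mul (p' - p) q' + mul (q' - q) p"
    using mul_comm[of p q] mul_comm[of p q'] assms by (simp add: tensor_mul_diff)
  then show ?thesis
    unfolding cl_eq_iff using assms by (auto intro!: null_add mul_null)
qed

lemma cosets_mult:
  assumes "p \<in> fr" "q \<in> fr" shows "cl p \<otimes>\<^bsub>tensor_cosets K S T\<^esub> cl q = cl (mul p q)"
proof -
  have "cl p \<otimes>\<^bsub>tensor_cosets K S T\<^esub> cl q = (\<Union>p'\<in>cl p. \<Union>q'\<in>cl q. cl (mul p' q'))"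
    by (simp add: tensor_cosets_def tensor_mul_def)
  also have "\<dots> = (\<Union>p'\<in>cl p. cl (mul p' q))"
    using assms by (intro SUP_cong refl UN_cl cl_mul_cong) (auto simp: null_zero intro: cl_fr)
  also have "\<dots> = cl (mul p q)"
    using assms by (intro UN_cl cl_mul_cong) (auto simp: null_zero)
  finally show ?thesis .
qed

lemma cosets_add: "cl p \<oplus>\<^bsub>tensor_cosets K S T\<^esub> cl q = cl (p + q)"
proof -
  have "r \<in> cl p <#>\<^bsub>tensor_free S T\<^esub> cl q \<longleftrightarrow> (\<exists>p' q'. p' \<in> cl p \<and> q' \<in> cl q \<and> r = p' + q')" for r
    unfolding set_mult_def tensor_free_def mult_free_Abelian_group by blast
  then have "r \<in> cl p <#>\<^bsub>tensor_free S T\<^esub> cl q \<longleftrightarrow> (\<exists>p' q'. p' - p \<in> null \<and> q' - q \<in> null \<and> r = p' + q')" for r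
    by (simp only: cl_iff)
  moreover have "(\<exists>p' q'. p' - p \<in> null \<and> q' - q \<in> null \<and> r = p' + q') \<longleftrightarrow> r - (p + q) \<in> null" for r
  proof
    assume "\<exists>p' q'. p' - p \<in> null \<and> q' - q \<in> null \<and> r = p' + q'"
    then obtain p' q' where "p' - p \<in> null" "q' - q \<in> null" "r = p' + q'" by blast
    then show "r - (p + q) \<in> null"
      using null_add[of "p' - p" "q' - q"] by (simp add: algebra_simps)
  next
    assume "r - (p + q) \<in> null"
    then have "(r - q) - p \<in> null \<and> q - q \<in> null \<and> r = (r - q) + q"
      by (simp add: null_zero diff_diff_eq add.commute)
    then show "\<exists>p' q'. p' - p \<in> null \<and> q' - q \<in> null \<and> r = p' + q'" by blast
  qed
  ultimately show ?thesis
    by (auto simp: tensor_cosets_def cl_iff)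
qed

lemma cosets_zero: "\<zero>\<^bsub>tensor_cosets K S T\<^esub> = cl 0"
  by (auto simp: tensor_cosets_def cl_iff)

lemma cosets_one: "\<one>\<^bsub>tensor_cosets K S T\<^esub> = cl (frag_of (\<one>\<^bsub>S\<^esub>, \<one>\<^bsub>T\<^esub>))"
  by (simp add: tensor_cosets_def)

definition scal :: "'u \<Rightarrow> 'u \<times> 'u \<Rightarrow>\<^sub>0 int" where
  "scal k = frag_of (k \<odot>\<^bsub>S\<^esub> \<one>\<^bsub>S\<^esub>, \<one>\<^bsub>T\<^esub>)"

lemma scal_fr: "k \<in> carrier K \<Longrightarrow> scal k \<in> fr"
  by (simp add: scal_def fr_of)

lemma scal_one: "scal \<one>\<^bsub>K\<^esub> = frag_of (\<one>\<^bsub>S\<^esub>, \<one>\<^bsub>T\<^esub>)"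
  by (simp add: scal_def)

text \<open>Acting on the left factor is multiplication by the class of (k 1, 1). The scalar action
  is thereby reduced to the product of classes.\<close>

lemma cosets_smult:
  assumes k: "k \<in> carrier K" and p: "p \<in> fr"
  shows "k \<odot>\<^bsub>tensor_cosets K S T\<^esub> cl p = cl (mul (scal k) p)"
proof -
  have *: "frag_extend (\<lambda>(s, t). frag_of (k \<odot>\<^bsub>S\<^esub> s, t)) q = mul (scal k) q" if "q \<in> fr" for q
    using that by (induction q rule: fr_induct) (use k in \<open>simp_all add: frag_extend_diff tensor_mul_diff scal_def S.smult_assoc2\<close>)
  have "k \<odot>\<^bsub>tensor_cosets K S T\<^esub> cl p = (\<Union>q\<in>cl p. cl (mul (scal k) q))"
    using cl_fr[OF p] by (simp add: tensor_cosets_def *)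
  also have "\<dots> = cl (mul (scal k) p)"
    using p scal_fr[OF k] by (intro UN_cl cl_mul_cong) (auto simp: null_zero)
  finally show ?thesis .
qed

text \<open>Taking classes maps \<open>fr_ring\<close> onto the quotient, which gives the ring
  axioms. The structure homomorphism is k \<mapsto> k 1 \<otimes> 1, and its additivity is a relator
  of the first kind.\<close>

lemma cosets_algebra: "algebra K (tensor_cosets K S T)"
proof -
  have c: "cring (tensor_cosets K S T)"
    by (rule cring_hom_image[OF fr_ring_cring, of _ cl])
      (simp_all add: fr_ring_def cosets_carrier cosets_mult cosets_add cosets_zero cosets_one)
  have "(\<lambda>k. cl (scal k)) \<in> ring_hom K (tensor_cosets K S T)"
  proof (rule ring_hom_memI)
    fix k l assume k: "k \<in> carrier K" and l: "l \<in> carrier K"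
    have "mul (scal k) (scal l) = scal (k \<otimes>\<^bsub>K\<^esub> l)"
      using k l by (simp add: scal_def S.smult_assoc1 S.smult_assoc2)
    then show "cl (scal (k \<otimes>\<^bsub>K\<^esub> l)) = cl (scal k) \<otimes>\<^bsub>tensor_cosets K S T\<^esub> cl (scal l)"
      using cosets_mult[OF scal_fr[OF k] scal_fr[OF l]] by simp
    show "cl (scal (k \<oplus>\<^bsub>K\<^esub> l)) = cl (scal k) \<oplus>\<^bsub>tensor_cosets K S T\<^esub> cl (scal l)"
      using k l relator_intros(1)[of "k \<odot>\<^bsub>S\<^esub> \<one>\<^bsub>S\<^esub>" "l \<odot>\<^bsub>S\<^esub> \<one>\<^bsub>S\<^esub>" "\<one>\<^bsub>T\<^esub>"]
      by (simp add: cosets_add cl_eq_iff scal_def S.smult_l_distr diff_diff_eq)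
  qed (use scal_fr in \<open>auto simp: cosets_carrier cosets_one scal_one\<close>)
  then show ?thesis
    by (rule algebra_of_ring_hom[OF S.R.cring_axioms c])
      (use scal_fr in \<open>auto simp: cosets_carrier cosets_smult cosets_mult\<close>)
qed

end

section \<open>The tensor product inside the universe and its universal property\<close>

context universe
begin

context
  fixes S T :: "('u, 'u) module"
  assumes S: "S \<in> algs K" and T: "T \<in> algs K"
begin

interpretation tensor_product K S T
  using S T by (simp add: tensor_product_def algs_def)

text \<open>A class is recovered from any of its elements, so the code of a chosen representative
  determines it.\<close>

lemma cosets_emb: "\<exists>h :: ('u \<times> 'u \<Rightarrow>\<^sub>0 int) set \<Rightarrow> 'u. inj_on h (carrier (tensor_cosets K S T))"
proof -
  obtain h :: "('u \<times> 'u \<Rightarrow>\<^sub>0 int) \<Rightarrow> 'u" where h: "inj h"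
    using infinite_frag_inj[OF inf] by blast
  have "inj_on (\<lambda>P. h (SOME p. p \<in> P)) (carrier (tensor_cosets K S T))"
  proof (rule inj_onI)
    fix P Q assume "P \<in> carrier (tensor_cosets K S T)" "Q \<in> carrier (tensor_cosets K S T)"
      and eq: "h (SOME p. p \<in> P) = h (SOME p. p \<in> Q)"
    then obtain p q where P: "P = cl p" and Q: "Q = cl q"
      by (auto simp: cosets_carrier)
    have "(SOME p. p \<in> P) \<in> cl p" "(SOME p. p \<in> Q) \<in> cl q"
      unfolding P Q by (rule someI[of _ p], rule cl_self) (rule someI[of _ q], rule cl_self)
    then have *: "cl (SOME p. p \<in> P) = P" "cl (SOME p. p \<in> Q) = Q"
      unfolding P Q by (simp_all only: cl_iff cl_eq_iff)
    note *(1)[symmetric]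
    also have "cl (SOME p. p \<in> P) = cl (SOME p. p \<in> Q)"
      by (rule arg_cong[OF injD[OF h eq]])
    also note *(2)
    finally show "P = Q" .
  qed
  then show ?thesis by blast
qed

lemmas copy = cosets_emb cosets_algebra

lemma tensor_algs: "tensor K S T \<in> algs K"
  using copy_alg_algebra[OF copy] by (simp add: algs_def tensor_def)

definition tc :: "('u \<times> 'u \<Rightarrow>\<^sub>0 int) \<Rightarrow> 'u" where
  "tc p = tensor_emb K S T (cl p)"

lemma tc_carrier: "carrier (tensor K S T) = tc ` fr"
  using copy_alg_carrier[OF copy] by (auto simp: tensor_def tc_def tensor_emb_def cosets_carrier)

lemma tc_closed: "p \<in> fr \<Longrightarrow> tc p \<in> carrier (tensor K S T)"
  by (simp add: tc_carrier)

lemma tc_hom: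
  assumes p: "p \<in> fr" and q: "q \<in> fr"
  shows "tc p \<otimes>\<^bsub>tensor K S T\<^esub> tc q = tc (mul p q)" "tc p \<oplus>\<^bsub>tensor K S T\<^esub> tc q = tc (p + q)"
proof -
  have c: "cl p \<in> carrier (tensor_cosets K S T)" "cl q \<in> carrier (tensor_cosets K S T)"
    using p q by (auto simp: cosets_carrier)
  show "tc p \<otimes>\<^bsub>tensor K S T\<^esub> tc q = tc (mul p q)"
    using ring_hom_mult[OF copy_alg_hom[OF copy] c] cosets_mult[OF p q] by (simp add: tc_def tensor_def tensor_emb_def)
  show "tc p \<oplus>\<^bsub>tensor K S T\<^esub> tc q = tc (p + q)"
    using ring_hom_add[OF copy_alg_hom[OF copy] c] by (simp add: tc_def tensor_def tensor_emb_def cosets_add)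
qed

lemma tc_one: "\<one>\<^bsub>tensor K S T\<^esub> = tc (frag_of (\<one>\<^bsub>S\<^esub>, \<one>\<^bsub>T\<^esub>))"
  using ring_hom_one[OF copy_alg_hom[OF copy]] by (simp add: tc_def tensor_def tensor_emb_def cosets_one)

lemma tc_smult: "\<lbrakk>k \<in> carrier K; p \<in> fr\<rbrakk> \<Longrightarrow> k \<odot>\<^bsub>tensor K S T\<^esub> tc p = tc (mul (scal k) p)"
  using copy_alg_smult[OF copy, of "cl p" k] by (simp add: tc_def tensor_def tensor_emb_def cosets_smult cosets_carrier)

lemma unemb_tc: "p \<in> fr \<Longrightarrow> unemb (carrier (tensor_cosets K S T)) (tc p) = cl p"
  unfolding tc_def tensor_emb_def by (rule unemb_emb[OF cosets_emb]) (simp add: cosets_carrier)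

lemma tc_eq_iff: "\<lbrakk>p \<in> fr; q \<in> fr\<rbrakk> \<Longrightarrow> tc p = tc q \<longleftrightarrow> p - q \<in> null"
  using unemb_tc cl_eq_iff tc_def by metis

lemma in1_eq: "s \<in> carrier S \<Longrightarrow> tensor_in1 K S T s = tc (frag_of (s, \<one>\<^bsub>T\<^esub>))"
  by (simp add: tensor_in1_def tc_def)

lemma in2_eq: "t \<in> carrier T \<Longrightarrow> tensor_in2 K S T t = tc (frag_of (\<one>\<^bsub>S\<^esub>, t))"
  by (simp add: tensor_in2_def tc_def)

lemma tensor_in1_alg_hom: "tensor_in1 K S T \<in> alg_hom K S (tensor K S T)"
proof (rule alg_homI)
  show "tensor_in1 K S T \<in> ring_hom S (tensor K S T)"
    by (rule ring_hom_memI)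
      (auto simp: in1_eq tc_closed tc_hom tc_one fr_of tc_eq_iff fr_add diff_diff_eq[symmetric] intro!: relator_intros)
  show "tensor_in1 K S T \<in> extensional (carrier S)"
    by (simp add: tensor_in1_def)
qed (simp add: in1_eq tc_smult fr_of scal_def S.smult_assoc2)

text \<open>Scalars act on the left factor, so linearity of the second inclusion is the relation
  that moves a scalar across the tensor sign.\<close>

lemma tensor_in2_alg_hom: "tensor_in2 K S T \<in> alg_hom K T (tensor K S T)"
proof (rule alg_homI)
  show "tensor_in2 K S T \<in> ring_hom T (tensor K S T)"
    by (rule ring_hom_memI)
      (auto simp: in2_eq tc_closed tc_hom tc_one fr_of tc_eq_iff fr_add diff_diff_eq[symmetric] intro!: relator_intros)
  show "tensor_in2 K S T \<in> extensional (carrier T)"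
    by (simp add: tensor_in2_def)
  fix k t assume k: "k \<in> carrier K" and t: "t \<in> carrier T"
  have "frag_of (k \<odot>\<^bsub>S\<^esub> \<one>\<^bsub>S\<^esub>, t) - frag_of (\<one>\<^bsub>S\<^esub>, k \<odot>\<^bsub>T\<^esub> t) \<in> null"
    using k t by (intro relator_intros) auto
  then have "tc (frag_of (k \<odot>\<^bsub>S\<^esub> \<one>\<^bsub>S\<^esub>, t)) = tc (frag_of (\<one>\<^bsub>S\<^esub>, k \<odot>\<^bsub>T\<^esub> t))"
    using k t by (simp add: tc_eq_iff fr_of)
  then show "tensor_in2 K S T (k \<odot>\<^bsub>T\<^esub> t) = k \<odot>\<^bsub>tensor K S T\<^esub> tensor_in2 K S T t"
    using k t by (simp add: in2_eq tc_smult fr_of scal_def)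
qed

text \<open>Extend (s, t) \<mapsto> \<psi>(s) \<phi>(t) additively to formal sums; relators go to
  zero and products to products. Thus a statement about a function over T and a point over S need
  only be checked in S \<otimes> T.\<close>

lemma tensor_universal:
  assumes T': "T' \<in> algs K" and \<psi>: "\<psi> \<in> alg_hom K S T'" and \<phi>: "\<phi> \<in> alg_hom K T T'"
  obtains m where "m \<in> alg_hom K (tensor K S T) T'" "compose (carrier S) m (tensor_in1 K S T) = \<psi>"
    "compose (carrier T) m (tensor_in2 K S T) = \<phi>"
proof -
  interpret T': algebra K T' using algsD[OF T'] .
  have "(\<lambda>(s, t). \<psi> s \<otimes>\<^bsub>T'\<^esub> \<phi> t) ` (carrier S \<times> carrier T) \<subseteq> carrier (add_monoid T')"
    using alg_hom_closed[OF \<psi>] alg_hom_closed[OF \<phi>] by auto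
  then obtain h where h: "h \<in> hom (free_Abelian_group (carrier S \<times> carrier T)) (add_monoid T')"
    and h_of': "\<And>x. x \<in> carrier S \<times> carrier T \<Longrightarrow> h (frag_of x) = (\<lambda>(s, t). \<psi> s \<otimes>\<^bsub>T'\<^esub> \<phi> t) x"
    using comm_group.free_Abelian_group_universal[OF T'.a_comm_group] by blast
  have h_of: "h (frag_of (s, t)) = \<psi> s \<otimes>\<^bsub>T'\<^esub> \<phi> t" if "s \<in> carrier S" "t \<in> carrier T" for s t
    using h_of'[of "(s, t)"] that by simp
  have hc: "h p \<in> carrier T'" if "p \<in> fr" for p
    using hom_in_carrier[OF h, of p] that by (simp add: fr_def)
  have ha: "h (p + q) = h p \<oplus>\<^bsub>T'\<^esub> h q" if "p \<in> fr" "q \<in> fr" for p q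
    using hom_mult[OF h, of p q] that by (simp add: fr_def)
  have h0: "h 0 = \<zero>\<^bsub>T'\<^esub>"
    using ha[OF fr_zero fr_zero] hc[OF fr_zero] by simp
  have hd: "h (p - q) = h p \<ominus>\<^bsub>T'\<^esub> h q" if "p \<in> fr" "q \<in> fr" for p q
  proof -
    have "h p = h (p - q) \<oplus>\<^bsub>T'\<^esub> h q"
      using ha[OF fr_diff[OF that] that(2)] by simp
    then show ?thesis
      using hc that fr_diff[OF that] by (simp add: a_minus_def T'.a_assoc T'.r_neg)
  qed
  note hs = alg_hom_add[OF \<psi>] alg_hom_add[OF \<phi>] alg_hom_mult[OF \<psi>] alg_hom_mult[OF \<phi>] alg_hom_closed[OF \<psi>]
    alg_hom_closed[OF \<phi>] alg_hom_smult[OF \<psi>] alg_hom_smult[OF \<phi>] alg_hom_one[OF \<psi>] alg_hom_one[OF \<phi>]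
  have cancel: "x \<oplus>\<^bsub>T'\<^esub> y \<ominus>\<^bsub>T'\<^esub> x \<ominus>\<^bsub>T'\<^esub> y = \<zero>\<^bsub>T'\<^esub>" if "x \<in> carrier T'" "y \<in> carrier T'" for x y
  proof -
    have "x \<oplus>\<^bsub>T'\<^esub> y \<ominus>\<^bsub>T'\<^esub> x = y"
      using that by (simp add: a_minus_def T'.a_comm[of x y] T'.a_assoc T'.r_neg)
    then show ?thesis using that by (simp add: a_minus_def T'.r_neg)
  qed
  have hnull: "h p = \<zero>\<^bsub>T'\<^esub>" if "p \<in> null" for p
    using that
  proof (induction p rule: null_induct)
    case (relator r)
    then show ?case
    proof (cases rule: relator_cases)
      case (left s s' t)
      then show ?thesis
        by (simp add: hd fr_diff fr_of h_of hs T'.l_distr cancel)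
    next
      case (right s t t')
      then show ?thesis
        by (simp add: hd fr_diff fr_of h_of hs T'.r_distr cancel)
    next
      case (scalar k s t)
      then have "\<psi> s \<otimes>\<^bsub>T'\<^esub> (k \<odot>\<^bsub>T'\<^esub> \<phi> t) = k \<odot>\<^bsub>T'\<^esub> (\<psi> s \<otimes>\<^bsub>T'\<^esub> \<phi> t)"
        by (simp add: hs T'.m_comm[of "\<psi> s"] T'.smult_assoc2)
      with scalar show ?thesis
        by (simp add: hd fr_of h_of hs T'.smult_assoc2 a_minus_def T'.r_neg)
    qed
  qed (simp_all add: h0 hd a_minus_def T'.r_neg)
  have hm: "h (mul p q) = h p \<otimes>\<^bsub>T'\<^esub> h q" if "p \<in> fr" "q \<in> fr" for p q
    using that(1)
  proof (induction p rule: fr_induct)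
    case zero
    then show ?case using hc[OF that(2)] by (simp add: h0)
  next
    case p: (of s t)
    show ?case
      using that(2)
    proof (induction q rule: fr_induct)
      case zero
      then show ?case using p by (simp add: h0 hs h_of)
    next
      case q: (of s' t')
      then show ?case using p by (simp add: h_of hs T'.m_ac)
    next
      case (diff q q')
      then show ?case
        using p mul_closed[OF fr_of[OF p]] hc
        by (simp add: tensor_mul_diff hd h_of hs a_minus_def T'.r_distr T'.r_minus)
    qed
  next
    case (diff p p')
    then show ?case
      using mul_closed[OF _ that(2)] hc that(2)
      by (simp add: tensor_mul_diff hd a_minus_def T'.l_distr T'.l_minus)
  qed
  \<comment> \<open>The choice of the representative is immaterial: two of them differ by an element
    of \<open>null\<close>, where h vanishes.\<close>
  define m where "m = (\<lambda>z\<in>carrier (tensor K S T). h (SOME p. p \<in> fr \<and> tc p = z))"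
  have m: "m (tc p) = h p" if p: "p \<in> fr" for p
  proof -
    let ?q = "SOME q. q \<in> fr \<and> tc q = tc p"
    have q: "?q \<in> fr \<and> tc ?q = tc p"
      by (rule someI[of _ p]) (simp add: p)
    then have "p - ?q \<in> null"
      using tc_eq_iff[OF p, of ?q] by auto
    then have "h p = h ?q"
      using ha[OF _ conjunct1[OF q], of "p - ?q"] hnull hc[OF conjunct1[OF q]] fr_diff[OF p conjunct1[OF q]] by simp
    then show ?thesis using p by (simp add: m_def tc_closed)
  qed
  show thesis
  proof (rule that)
    show m_hom: "m \<in> alg_hom K (tensor K S T) T'"
    proof (rule alg_homI)
      show "m \<in> ring_hom (tensor K S T) T'"
        by (rule ring_hom_memI)
          (auto simp: tc_carrier tc_hom m mul_closed fr_add hm ha hc tc_one fr_of h_of hs)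
      show "m \<in> extensional (carrier (tensor K S T))" by (simp add: m_def)
      fix k z assume k: "k \<in> carrier K" and "z \<in> carrier (tensor K S T)"
      then obtain p where p: "p \<in> fr" "z = tc p" by (auto simp: tc_carrier)
      have "h (scal k) = k \<odot>\<^bsub>T'\<^esub> \<one>\<^bsub>T'\<^esub>"
        using k by (simp add: scal_def h_of hs)
      then show "m (k \<odot>\<^bsub>tensor K S T\<^esub> z) = k \<odot>\<^bsub>T'\<^esub> m z"
        using k p hc[OF p(1)] by (simp add: tc_smult m mul_closed scal_fr hm T'.smult_assoc2)
    qed
    show "compose (carrier S) m (tensor_in1 K S T) = \<psi>"
      by (rule alg_hom_eqI[OF alg_hom_compose[OF tensor_in1_alg_hom m_hom S.algebra_axioms] \<psi>])
        (simp add: compose_eq_on in1_eq m fr_of h_of hs)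
    show "compose (carrier T) m (tensor_in2 K S T) = \<phi>"
      by (rule alg_hom_eqI[OF alg_hom_compose[OF tensor_in2_alg_hom m_hom T.algebra_axioms] \<phi>])
        (simp add: compose_eq_on in2_eq m fr_of h_of hs)
  qed
qed

end

text \<open>\<open>tensor_map\<close> is given by a formula on representatives. It is therefore
  computed from the additive map L on formal sums, which respects relators and products.\<close>

lemma tensor_map_hom:
  assumes S: "S \<in> algs K" and T: "T \<in> algs K" and T': "T' \<in> algs K" and \<psi>: "\<psi> \<in> alg_hom K T T'"
  shows "tensor_map K S T T' \<psi> \<in> alg_hom K (tensor K S T) (tensor K S T')"
    and "compose (carrier S) (tensor_map K S T T' \<psi>) (tensor_in1 K S T) = tensor_in1 K S T'"
    and "compose (carrier T) (tensor_map K S T T' \<psi>) (tensor_in2 K S T) = compose (carrier T) (tensor_in2 K S T') \<psi>"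
proof -
  interpret A: tensor_product K S T
    using S T by (simp add: tensor_product_def algs_def)
  interpret B: tensor_product K S T'
    using S T' by (simp add: tensor_product_def algs_def)
  define L where "L = frag_extend (\<lambda>(s, t). frag_of (s :: 'u, \<psi> t))"
  note hs = alg_hom_add[OF \<psi>] alg_hom_mult[OF \<psi>] alg_hom_closed[OF \<psi>] alg_hom_smult[OF \<psi>] alg_hom_one[OF \<psi>]
  have L_of: "L (frag_of (s, t)) = frag_of (s, \<psi> t)" for s t
    by (simp add: L_def)
  have Ld: "L (p - q) = L p - L q" and La: "L (p + q) = L p + L q" and L0: "L 0 = 0" for p q
    by (simp_all add: L_def frag_extend_diff frag_extend_add)
  have L_fr: "L p \<in> B.fr" if "p \<in> A.fr" for p
    using that by (induction p rule: A.fr_induct) (simp_all add: L0 Ld L_of B.fr_zero B.fr_diff B.fr_of hs)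
  have L_null: "L p \<in> B.null" if "p \<in> A.null" for p
    using that
  proof (induction p rule: A.null_induct)
    case (relator r)
    then show ?case
      by (cases rule: A.relator_cases) (auto simp: Ld L_of hs intro!: B.relator_intros)
  qed (simp_all add: L0 Ld B.null_zero B.null_diff)
  have Lm: "L (A.mul p q) = B.mul (L p) (L q)" if "p \<in> A.fr" "q \<in> A.fr" for p q
    using that(1)
  proof (induction p rule: A.fr_induct)
    case p: (of s t)
    show ?case
      using that(2) by (induction q rule: A.fr_induct) (use p in \<open>simp_all add: L0 L_of Ld tensor_mul_diff hs\<close>)
  qed (simp_all add: L0 Ld tensor_mul_diff)
  let ?m = "tensor_map K S T T' \<psi>"
  have m: "?m (tc S T p) = tc S T' (L p)" if p: "p \<in> A.fr" for p
  proof -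
    have "(\<Union>q\<in>A.cl p. B.cl (L q)) = B.cl (L p)"
      using L_null by (intro A.UN_cl[OF p]) (simp add: B.cl_eq_iff Ld[symmetric])
    then show ?thesis
      using p by (simp add: tensor_map_def tc_closed[OF S T] unemb_tc[OF S T] tc_def[OF S T'] L_def)
  qed
  show hom: "?m \<in> alg_hom K (tensor K S T) (tensor K S T')"
  proof (rule alg_homI)
    show "?m \<in> ring_hom (tensor K S T) (tensor K S T')"
      by (rule ring_hom_memI)
        (auto simp: tc_carrier[OF S T] tc_hom[OF S T] tc_hom[OF S T'] m A.mul_closed A.fr_add Lm La L_fr
          tc_closed[OF S T'] tc_one[OF S T] tc_one[OF S T'] A.fr_of L_of hs)
    show "?m \<in> extensional (carrier (tensor K S T))"
      by (simp add: tensor_map_def)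
    fix k z assume k: "k \<in> carrier K" and "z \<in> carrier (tensor K S T)"
    then obtain p where p: "p \<in> A.fr" "z = tc S T p" by (auto simp: tc_carrier[OF S T])
    have "L (A.scal k) = B.scal k"
      by (simp add: A.scal_def B.scal_def L_of hs)
    then show "?m (k \<odot>\<^bsub>tensor K S T\<^esub> z) = k \<odot>\<^bsub>tensor K S T'\<^esub> ?m z"
      using k p by (simp add: tc_smult[OF S T] tc_smult[OF S T'] m A.mul_closed A.scal_fr Lm L_fr)
  qed
  show "compose (carrier S) ?m (tensor_in1 K S T) = tensor_in1 K S T'"
    by (rule alg_hom_eqI[OF alg_hom_compose[OF tensor_in1_alg_hom[OF S T] hom A.S.algebra_axioms] tensor_in1_alg_hom[OF S T']])
      (simp add: compose_eq_on in1_eq[OF S T] in1_eq[OF S T'] m A.fr_of L_of hs)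
  show "compose (carrier T) ?m (tensor_in2 K S T) = compose (carrier T) (tensor_in2 K S T') \<psi>"
    by (rule alg_hom_eqI[OF alg_hom_compose[OF tensor_in2_alg_hom[OF S T] hom A.T.algebra_axioms]
          alg_hom_compose[OF \<psi> tensor_in2_alg_hom[OF S T'] A.T.algebra_axioms]])
      (simp add: compose_eq_on in2_eq[OF S T] in2_eq[OF S T'] m A.fr_of L_of hs)
qed

end

section \<open>Affine functors\<close>

context group_scheme_like
begin

lemma exponential_all: "v \<in> Te \<Longrightarrow> exponential K G v (\<lambda>S. pt S)"
  by unfold_locales (auto intro: G_closed e_closed[OF B_algs])

context
  fixes v
  assumes v: "v \<in> Te" and aff: "affine_functor K (underlying G)"
begin

interpretation exponential K G v "\<lambda>S. pt S" by (rule exponential_all[OF v])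

lemma X_eq: "X = underlying G"
  by (simp add: X_def underlying_def)

lemma spec_map_bij:
  "S \<in> algs K \<Longrightarrow> bij_betw (spec_map K X S) (pt S) (hom_alg K (function_algebra K X) (quasi_coherent K S))"
  using aff by (simp add: affine_functor_def X_eq)

lemma function_algebra_simps: "Ob (function_algebra K X) T = pointwise K T X (X.F T)" "Mor (function_algebra K X) = reindex K"
  by (simp_all add: function_algebra_def)

lemma carrier_pointwise: "carrier (pointwise K T X C) = C"
  by (simp add: pointwise_def)

text \<open>This family is the point of Spec of the function algebra that the exponential has to be.
  T-linearity is \<open>exp_eval_smult\<close>; naturality in T combines
  \<open>exp_eval_natural\<close> with the fact that derivatives commute with
  \<open>reindex\<close>.\<close>

lemma exp_hom_alg:
  assumes S: "S \<in> algs K" and \<mu>: "\<mu> \<in> additive_chars S"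
  shows "(\<lambda>T\<in>algs K. \<lambda>a\<in>X.F T. exp_eval T (tensor K S T) (tensor_in2 K S T) (\<lambda>n. tensor_in1 K S T (\<mu> n)) a) \<in>
    hom_alg K (function_algebra K X) (quasi_coherent K S)" (is "?F \<in> _")
proof -
  have \<mu>T: "(\<lambda>n. tensor_in1 K S T (\<mu> n)) \<in> additive_chars (tensor K S T)" if "T \<in> algs K" for T
    by (rule char_map[OF S tensor_algs[OF S that] tensor_in1_alg_hom[OF S that] \<mu>])
  have "?F T \<in> alg_hom T (Ob (function_algebra K X) T) (Ob (quasi_coherent K S) T)" if T: "T \<in> algs K" for T
  proof -
    note t = tensor_algs[OF S T] tensor_in2_alg_hom[OF S T] \<mu>T[OF T]
    note h = exp_eval_ring_hom[OF T t]
    have "?F T \<in> ring_hom (pointwise K T X (X.F T)) (tensor K S T)"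
      using ring_hom_mult[OF h] ring_hom_add[OF h] ring_hom_one[OF h] ring_hom_closed[OF h] T
      by (intro ring_hom_memI) (simp_all add: carrier_pointwise X.FA_closed(1,2)[OF T] X.FA_one_closed[OF T])
    moreover have "?F T (r \<odot>\<^bsub>pointwise K T X (X.F T)\<^esub> a) = tensor_in2 K S T r \<otimes>\<^bsub>tensor K S T\<^esub> ?F T a"
      if "r \<in> carrier T" "a \<in> X.F T" for r a
      using exp_eval_smult[OF T t that(2,1)] that T by (simp add: X.FA_closed(3)[OF T that(2) that(2,1)])
    ultimately show ?thesis
      using T by (simp add: alg_hom_def function_algebra_simps quasi_coherent_def carrier_pointwise ring_hom_def)
  qed
  moreover have "?F T' (reindex K T T' \<psi> a) = tensor_map K S T T' \<psi> (?F T a)"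
    if T: "T \<in> algs K" and T': "T' \<in> algs K" and \<psi>: "\<psi> \<in> alg_hom K T T'" and a: "a \<in> X.F T" for T T' \<psi> a
  proof -
    note tm = tensor_map_hom[OF S T T' \<psi>] and i = tensor_in1_alg_hom[OF S T] and j = tensor_in2_alg_hom[OF S T]
      and j' = tensor_in2_alg_hom[OF S T']
    note ra = X.der_reindex(1)[OF T T' \<psi> a]
    have eT: "e (tensor K S T') \<in> pt (tensor K S T')"
      by (rule e_closed[OF tensor_algs[OF S T']])
    have m: "tensor_map K S T T' \<psi> (tensor_in1 K S T s) = tensor_in1 K S T' s" if "s \<in> carrier S" for s
      using fun_cong[OF tm(2), of s] that by (simp add: compose_eq_on)
    have "tensor_map K S T T' \<psi> (exp_eval T (tensor K S T) (tensor_in2 K S T) (\<lambda>n. tensor_in1 K S T (\<mu> n)) a) =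
        exp_eval T (tensor K S T') (compose (carrier T) (tensor_in2 K S T') \<psi>) (\<lambda>n. tensor_in1 K S T' (\<mu> n)) a"
      by (simp add: exp_eval_natural[OF T tensor_algs[OF S T] j \<mu>T[OF T] a tensor_algs[OF S T'] tm(1)] tm(3) m
          additive_chars_closed[OF S \<mu>])
    also have "\<dots> = exp_eval T' (tensor K S T') (tensor_in2 K S T') (\<lambda>n. tensor_in1 K S T' (\<mu> n)) (reindex K T T' \<psi> a)"
    proof -
      have "(X.der T' ^^ n) (reindex K T T' \<psi> a) (tensor K S T', tensor_in2 K S T') =
          (X.der T ^^ n) a (tensor K S T', compose (carrier T) (tensor_in2 K S T') \<psi>)" for n
        unfolding X.der_pow_reindex[OF T T' \<psi> a]
        using tensor_algs[OF S T'] j' by (simp add: reindex_def coslice_iff)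
      then show ?thesis by (simp only: exp_eval_def)
    qed
    finally show ?thesis
      using T T' a ra by simp
  qed
  ultimately show ?thesis
    by (auto simp: hom_alg_def function_algebra_simps carrier_pointwise quasi_coherent_def)
qed

text \<open>Injectivity of \<open>spec_map\<close> separates points, and surjectivity provides a
  point with the required values in S \<otimes> T. Any T' that receives both S and T is reached from
  S \<otimes> T by a morphism, along which both sides are natural.\<close>

lemma exponential_functions_affine: "exponential_functions K G v (\<lambda>S. pt S) (\<lambda>T. X.F T)"
proof
  fix S x y assume S: "S \<in> algs K" and x: "x \<in> pt S" and y: "y \<in> pt S"
    and eq: "\<And>T T' \<phi> \<psi> a. \<lbrakk>T \<in> algs K; T' \<in> algs K; \<phi> \<in> alg_hom K T T'; \<psi> \<in> alg_hom K S T'; a \<in> X.F T\<rbrakk> \<Longrightarrow>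
      a (T', \<phi>) (Mor G S T' \<psi> x) = a (T', \<phi>) (Mor G S T' \<psi> y)"
  have "spec_map K X S x = spec_map K X S y"
    using eq[OF _ tensor_algs[OF S] tensor_in2_alg_hom[OF S] tensor_in1_alg_hom[OF S]]
    by (auto simp: spec_map_def function_algebra_simps carrier_pointwise fun_eq_iff restrict_def)
  then show "x = y"
    using spec_map_bij[OF S] x y by (auto simp: bij_betw_def inj_on_def)
next
  fix S \<mu> assume S: "S \<in> algs K" and \<mu>: "\<mu> \<in> additive_chars S"
  let ?F = "(\<lambda>T\<in>algs K. \<lambda>a\<in>X.F T. exp_eval T (tensor K S T) (tensor_in2 K S T) (\<lambda>n. tensor_in1 K S T (\<mu> n)) a)"
  have "?F \<in> spec_map K X S ` pt S"
    unfolding bij_betw_imp_surj_on[OF spec_map_bij[OF S]] by (rule exp_hom_alg[OF S \<mu>])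
  then obtain x where F: "spec_map K X S x = ?F" and x: "x \<in> pt S"
    by (rule imageE) (erule that[OF sym])
  have "a (T', \<phi>) (Mor G S T' \<psi> x) = exp_eval T T' \<phi> (\<lambda>n. \<psi> (\<mu> n)) a"
    if T: "T \<in> algs K" and T': "T' \<in> algs K" and \<phi>: "\<phi> \<in> alg_hom K T T'" and \<psi>: "\<psi> \<in> alg_hom K S T'" and a: "a \<in> X.F T"
    for T T' \<phi> \<psi> a
  proof -
    note t = tensor_algs[OF S T] and i = tensor_in1_alg_hom[OF S T] and j = tensor_in2_alg_hom[OF S T]
    obtain m where m: "m \<in> alg_hom K (tensor K S T) T'" "compose (carrier S) m (tensor_in1 K S T) = \<psi>"
      "compose (carrier T) m (tensor_in2 K S T) = \<phi>"
      using tensor_universal[OF S T T' \<psi> \<phi>] by blast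
    have y: "Mor G S (tensor K S T) (tensor_in1 K S T) x \<in> Ob X (tensor K S T)"
      using G_closed[OF S t i x] by simp
    have "a (tensor K S T, tensor_in2 K S T) (Mor G S (tensor K S T) (tensor_in1 K S T) x) = spec_map K X S x T a"
      using T a by (simp add: spec_map_def function_algebra_simps carrier_pointwise)
    also have "\<dots> = exp_eval T (tensor K S T) (tensor_in2 K S T) (\<lambda>n. tensor_in1 K S T (\<mu> n)) a"
      using T a by (simp add: F)
    finally have "m (a (tensor K S T, tensor_in2 K S T) (Mor G S (tensor K S T) (tensor_in1 K S T) x)) =
        m (exp_eval T (tensor K S T) (tensor_in2 K S T) (\<lambda>n. tensor_in1 K S T (\<mu> n)) a)" by simp
    also have "\<dots> = exp_eval T T' \<phi> (\<lambda>n. m (tensor_in1 K S T (\<mu> n))) a"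
      by (simp add: exp_eval_natural[OF T t j char_map[OF S t i \<mu>] a T' m(1)] m(3))
    also have "(\<lambda>n. m (tensor_in1 K S T (\<mu> n))) = (\<lambda>n. \<psi> (\<mu> n))"
      using additive_chars_closed[OF S \<mu>] by (simp add: m(2)[symmetric] compose_eq_on)
    finally show ?thesis
      using X.F_natural[OF T a t j y T' m(1)] by (simp add: m(2,3) G_compose[OF S t T' i m(1) x])
  qed
  then show "\<exists>x\<in>pt S. \<forall>T\<in>algs K. \<forall>T'\<in>algs K. \<forall>\<phi>\<in>alg_hom K T T'. \<forall>\<psi>\<in>alg_hom K S T'. \<forall>a\<in>X.F T.
      a (T', \<phi>) (Mor G S T' \<psi> x) = exp_eval T T' \<phi> (\<lambda>n. \<psi> (\<mu> n)) a"
    using x by blast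
qed (simp_all add: X.der_closed)

end

theorem affine_unique_hom:
  assumes "affine_functor K (underlying G)" and "v \<in> Te"
  shows "\<exists>!f. f \<in> hom_grp K Ga_dual G \<and> f (dual_num B) (one_plus_eps B) = v"
  by (rule exponential_functions.unique_hom[OF exponential_functions_affine[OF assms(2,1)]])

end

theorem theorem8p12:
  fixes K :: "'u ring" and G :: "('u, 'x monoid, 'x) kfunctor"
  assumes "infinite (UNIV :: 'u set)"
    and "field K"
    and "group_functor K G"
    and "affine_functor K (underlying G) \<or> is_scheme K (underlying G)"
  defines "e \<equiv> \<one>\<^bsub>Ob G (base_alg K)\<^esub>"
  defines "T\<^sub>e \<equiv> tangent (underlying G) (base_alg K) e"
  shows "bij_betw (\<lambda>D. D (base_alg K) e) (Derinv K G) T\<^sub>e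
       \<and> bij_betw (\<lambda>f. f (dual_num (base_alg K)) (one_plus_eps_x K)) (hom_grp K Ga_dual G) T\<^sub>e"
proof -
  interpret K: field K by fact
  interpret group_scheme_like K G
    by (intro group_scheme_like.intro universe.intro group_scheme_like_axioms.intro assms(1,3) K.is_cring)
  have unique: "\<exists>!f. f \<in> hom_grp K Ga_dual G \<and> f (dual_num (base_alg K)) (one_plus_eps (base_alg K)) = v" if "v \<in> Te" for v
    using assms(4)
  proof
    show ?thesis if "affine_functor K (underlying G)" by (rule affine_unique_hom[OF that \<open>v \<in> Te\<close>])
    show ?thesis if "is_scheme K (underlying G)" by (rule scheme_unique_hom[OF assms(2) that \<open>v \<in> Te\<close>])
  qed
  have "bij_betw (\<lambda>f. f (dual_num (base_alg K)) (one_plus_eps (base_alg K))) (hom_grp K Ga_dual G) Te"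
  proof (rule bij_betw_imageI)
    \<comment> \<open>The common value of two homomorphisms is a tangent vector by
      \<open>hom_value_Te\<close>, so both are the unique homomorphism belonging to it.\<close>
    show "inj_on (\<lambda>f. f (dual_num (base_alg K)) (one_plus_eps (base_alg K))) (hom_grp K Ga_dual G)"
      using unique[OF hom_value_Te] by (blast intro: inj_onI)
    show "(\<lambda>f. f (dual_num (base_alg K)) (one_plus_eps (base_alg K))) ` hom_grp K Ga_dual G = Te"
      using unique hom_value_Te by blast
  qed
  moreover have "T\<^sub>e = Te"
    by (simp only: T\<^sub>e_def e_def Te_def)
  ultimately show ?thesis
    using Derinv_bij by (simp only: e_def one_plus_eps_x_eq simp_thms)
qed

end
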